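(* Let $r,d\in\mathbb{N}$, $d\ge3$, let $0\le k_1<k_2<\dots<k_d<r$ be integers, $\mathbf{k}=(k_1,\dots,k_d)$, $\mathbf{k}^2=(k_2,\dots,k_d)$, and let $M_{\mathbf{k}}=\{M_{k_1},\dots,M_{k_d}\}$ be positive numbers, $M_{\mathbf{k}^2}=\{M_{k_2},\dots,M_{k_d}\}$. Then $M_{\mathbf{k}}\in A_d(L^{r,r}_{\infty,\infty}(\mathbb{R}_-))$ if and only if $M_{\mathbf{k}^2}\in A_{d-1}(L^{r,r}_{\infty,\infty}(\mathbb{R}_-))$ and $$M_{k_1}>\lim_{l\to\infty}\left\|\phi_l^{(k_1)}\right\|,$$ where $\phi_l\in\Phi_{r,d-1}$ is such that $\|\phi_l^{(k_i)}\|=M_{k_i}$, $i=2,\dots,d$, and $\|\phi_l^{(r)}\|=l$ (such a $\phi_l$ exists for all $l\ge\|\phi^{(r)}(M_{\mathbf{k}^2})\|$).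
   Context: $\mathbb{R}_-=(-\infty,0]$ and $\|\cdot\|$ is the (essential) supremum norm of $L_\infty(\mathbb{R}_-)$. For $r\in\mathbb{N}$, $L^{r}_{\infty,\infty}(\mathbb{R}_-)$ is the space of functions $x:\mathbb{R}_-\to\mathbb{R}$, $x\in L_\infty(\mathbb{R}_-)$, with locally absolutely continuous derivative of order $r-1$ ($x^{(0)}=x$, one-sided derivatives at $0$) and $x^{(r)}\in L_\infty(\mathbb{R}_-)$. $L^{r,r}_{\infty,\infty}(\mathbb{R}_-)$ is the class of $x\in L^r_{\infty,\infty}(\mathbb{R}_-)$ that are nonnegative together with all derivatives up to and including order $r$ (with $x^{(r)}\ge0$ almost everywhere). For $s\in\mathbb{N}$, $a_1>a_2>\dots>a_s>0$ and $l>0$, define on $\mathbb{R}_-$ the spline $$\phi(a_1,\dots,a_s,l;t):=\frac{l}{r!}\sum_{j=1}^s(-1)^{j+1}(t+a_j)_+^r ,$$ and $\Phi_{r,n}:=\{\phi(a_1,\dots,a_s,l;\cdot): s\in\mathbb{N},\ s\le n,\ a_1>\dots>a_s>0,\ l>0\}$. For a vector of $m$ integers $0\le q_1<\dots<q_m\le r$, $\mathbf{q}=(q_1,\dots,q_m)$, a system of positive numbers $M_{\mathbf{q}}=\{M_{q_1},\dots,M_{q_m}\}$ is admissible, written $M_{\mathbf{q}}\in A_m(L^{r,r}_{\infty,\infty}(\mathbb{R}_-))$, if there is $x\in L^{r,r}_{\infty,\infty}(\mathbb{R}_-)$ with $\|x^{(q_i)}\|=M_{q_i}$, $i=1,\dots,m$.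 $\phi(M_{\mathbf{q}};t)$ denotes the spline $\phi\in\Phi_{r,m-1}$ such that $\|\phi^{(q_i)}\|=\phi^{(q_i)}(0)=M_{q_i}$, $i=1,\dots,m$, and $\phi^{(r)}(M_{\mathbf{k}^2})$ is its derivative of order $r$ when $\mathbf{q}=\mathbf{k}^2$.
   Formalization: The spline φ(M_{k²}) need not exist for admissible M_{k²} (e.g. r=5, k²=(2,3,4), all M=1); existence of φ_l is proved for all l ≥ ‖φ^{(r)}(M_{k²})‖ when φ(M_{k²}) exists, and in general for all sufficiently large l. *)

theory Defs
  imports "HOL-Analysis.Analysis" "HOL-Probability.Essential_Supremum"
begin

text \<open>
  Functions on \<open>(-\<infinity>, 0]\<close> are represented by functions \<open>real \<Rightarrow> real\<close>; all notions below
  depend only on their values on \<open>{..0}\<close>.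
\<close>

text \<open>
  Derivatives are taken within \<open>{..0}\<close>, hence one-sided at \<open>0\<close>. Where a derivative does not
  exist, \<open>half_deriv\<close> has an unspecified value; for functions in the classes below this concerns
  only the derivative of highest order, on a null set.
\<close>

definition half_deriv :: "nat \<Rightarrow> (real \<Rightarrow> real) \<Rightarrow> real \<Rightarrow> real" where
  "half_deriv j = (\<lambda>f t. vector_derivative f (at t within {..0})) ^^ j"

definition Linf_norm :: "(real \<Rightarrow> real) \<Rightarrow> ereal" where
  "Linf_norm f = esssup (lebesgue_on {..0}) (\<lambda>t. ereal \<bar>f t\<bar>)"

definition Linf :: "(real \<Rightarrow> real) set" where
  "Linf = {f. f \<in> borel_measurable (lebesgue_on {..0}) \<and> Linf_norm f < \<infinity>}"

definition abs_continuous_on :: "real \<Rightarrow> real \<Rightarrow> (real \<Rightarrow> real) \<Rightarrow> bool" where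
  "abs_continuous_on a b f \<longleftrightarrow>
     (\<forall>\<epsilon>>0. \<exists>\<delta>>0. \<forall>(n::nat) u v.
        (\<forall>i<n. a \<le> u i \<and> u i \<le> v i \<and> v i \<le> b) \<longrightarrow>
        (\<forall>i<n. \<forall>j<n. i \<noteq> j \<longrightarrow> {u i<..<v i} \<inter> {u j<..<v j} = {}) \<longrightarrow>
        (\<Sum>i<n. v i - u i) < \<delta> \<longrightarrow>
        (\<Sum>i<n. \<bar>f (v i) - f (u i)\<bar>) < \<epsilon>)"

definition loc_abs_continuous :: "(real \<Rightarrow> real) \<Rightarrow> bool" where
  "loc_abs_continuous f \<longleftrightarrow> (\<forall>a b. a \<le> b \<and> b \<le> 0 \<longrightarrow> abs_continuous_on a b f)"

definition L_space :: "nat \<Rightarrow> (real \<Rightarrow> real) set" where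
  "L_space r = {x. x \<in> Linf
      \<and> (\<forall>j<r - 1. half_deriv j x differentiable_on {..0})
      \<and> loc_abs_continuous (half_deriv (r - 1) x)
      \<and> half_deriv r x \<in> Linf}"

definition L_monotone :: "nat \<Rightarrow> (real \<Rightarrow> real) set" where
  "L_monotone r = {x \<in> L_space r.
      (\<forall>j<r. \<forall>t\<le>0. half_deriv j x t \<ge> 0)
      \<and> (AE t in lebesgue_on {..0}. half_deriv r x t \<ge> 0)}"

definition spline :: "nat \<Rightarrow> nat \<Rightarrow> (nat \<Rightarrow> real) \<Rightarrow> real \<Rightarrow> real \<Rightarrow> real" where
  "spline r s a l t = l / fact r * (\<Sum>j=1..s. (-1) ^ (j + 1) * (max 0 (t + a j)) ^ r)"

definition Phi :: "nat \<Rightarrow> nat \<Rightarrow> (real \<Rightarrow> real) set" where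
  "Phi r n = {spline r s a l | s a l. 1 \<le> s \<and> s \<le> n
      \<and> (\<forall>i\<in>{1..s}. \<forall>j\<in>{1..s}. i < j \<longrightarrow> a i > a j)
      \<and> (\<forall>i\<in>{1..s}. a i > 0) \<and> l > 0}"

text \<open>
  A vector \<open>(q\<^sub>1, \<dots>, q\<^sub>m)\<close> is a function \<open>q\<close> on indices \<open>1, \<dots>, m\<close>; a system of numbers is
  indexed by the orders of the derivatives, i.e. \<open>M (q i)\<close> is the number attached to \<open>q i\<close>.
\<close>

definition admissible :: "nat \<Rightarrow> nat \<Rightarrow> (nat \<Rightarrow> nat) \<Rightarrow> (nat \<Rightarrow> real) \<Rightarrow> bool" where
  "admissible r m q M \<longleftrightarrow>
     (\<exists>x\<in>L_monotone r. \<forall>i\<in>{1..m}. Linf_norm (half_deriv (q i) x) = ereal (M (q i)))"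

text \<open>
  \<open>interp_spline\<close> and \<open>extremal_spline\<close> express that \<open>\<phi>\<close> is \<open>\<phi>(M\<^sub>q; \<cdot>)\<close> and \<open>\<phi>\<^sub>l\<close>, respectively; they
  are relations because these splines are introduced by their properties and need not always exist.
\<close>

definition interp_spline ::
  "nat \<Rightarrow> nat \<Rightarrow> (nat \<Rightarrow> nat) \<Rightarrow> (nat \<Rightarrow> real) \<Rightarrow> (real \<Rightarrow> real) \<Rightarrow> bool" where
  "interp_spline r m q M \<phi> \<longleftrightarrow> \<phi> \<in> Phi r (m - 1) \<and>
     (\<forall>i\<in>{1..m}. Linf_norm (half_deriv (q i) \<phi>) = ereal (M (q i))
        \<and> half_deriv (q i) \<phi> 0 = M (q i))"

definition extremal_spline ::
  "nat \<Rightarrow> nat \<Rightarrow> (nat \<Rightarrow> nat) \<Rightarrow> (nat \<Rightarrow> real) \<Rightarrow> real \<Rightarrow> (real \<Rightarrow> real) \<Rightarrow> bool" where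
  "extremal_spline r d k M l \<phi> \<longleftrightarrow> \<phi> \<in> Phi r (d - 1) \<and>
     (\<forall>i\<in>{2..d}. Linf_norm (half_deriv (k i) \<phi>) = ereal (M (k i))) \<and>
     Linf_norm (half_deriv r \<phi>) = ereal l"

end

theory Submission
  imports Defs
begin

text \<open>
  Put \<open>u = - t\<close>. In the class considered the derivatives of positive order vanish at \<open>-\<infinity>\<close>, so with
  the density \<open>h(u) = x\<^bsup>(r)\<^esup>(-u)\<close> the value \<open>x\<^bsup>(j)\<^esup>(0)\<close> is the moment of order \<open>r - 1 - j\<close> of \<open>h\<close> divided by
  \<open>(r - 1 - j)!\<close>, up to a nonnegative constant if \<open>j = 0\<close>. By monotonicity it is also the norm of \<open>x\<^bsup>(j)\<^esup>\<close>.
  So the question is which vectors are moment vectors of bounded densities \<open>h \<ge> 0\<close> on \<open>[0, \<infinity>)\<close>, and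
  the splines are the densities that take only the values \<open>0\<close> and \<open>l\<close>, with few jumps
  (\<open>L_monotone_moments\<close>, \<open>spline_properties\<close>).

  Existence of \<open>\<phi>\<^sub>l\<close>. Moments of a density below \<open>l\<close> are also moments of a density with values \<open>0\<close> and \<open>l\<close>:
  the minimum of \<open>l \<integral> (Q - u\<^sup>q)\<^sub>+ - \<Sum> c\<^sub>i m\<^sub>i\<close> over generalized polynomials \<open>Q = \<Sum> c\<^sub>i u\<^sup>i\<close> exists, and
  stationarity says that \<open>l\<close> times the indicator function of \<open>Q > u\<^sup>q\<close> has the moments \<open>m\<close>. By Descartes'
  rule of signs it has no more jumps than there are moments (\<open>bang_bang_moments\<close>, \<open>extremal_spline_exists\<close>).

  Minimality of \<open>\<phi>\<^sub>l\<close>. Some polynomial with leading power \<open>u\<^sup>q\<close>, \<open>q = r - 1 - k\<^sub>1\<close>, and otherwise only the exponents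
  of the prescribed moments changes sign exactly at the knots of \<open>\<phi>\<^sub>l\<close>. Integrating it against the
  difference of two densities shows that \<open>\<phi>\<^sub>l\<close> has a strictly smaller moment of order \<open>q\<close> than every
  function with the same prescribed moments and a top derivative of norm below \<open>l\<close>
  (\<open>spline_minimizes\<close>). In particular these moments decrease strictly in \<open>l\<close>, the limit is their
  infimum, and no function of the class attains it; this is necessity of the strict inequality.

  Sufficiency. If \<open>M\<^bsub>k\<^sub>1\<^esub>\<close> exceeds the value for some \<open>\<phi>\<^sub>l\<close>, the enlarged moment vector is
  interior: raising the moment of highest order only helps, since a polynomial that is nonpositive on
  the half-line has a nonpositive leading coefficient. So the minimisation argument solves the
  enlarged problem as well, with a larger bound (\<open>admissible_extension\<close>).

  The derivative of order \<open>r\<close> is given only almost everywhere, as the derivative of a locally absolutely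
  continuous function. That such functions are differentiable almost everywhere and have increments
  governed by this derivative is derived from the Vitali covering theorem
  (\<open>abs_continuous_on_differentiable_ae\<close>, \<open>abs_continuous_on_increment_le\<close>).
\<close>

section \<open>Increments over divisions and the Vitali covering theorem\<close>

definition incr :: "(real \<Rightarrow> real) \<Rightarrow> real set \<Rightarrow> real" where
  "incr f K = f (Sup K) - f (Inf K)"

lemma incr_interval [simp]: "u \<le> v \<Longrightarrow> incr f {u..v} = f v - f u"
  by (simp add: incr_def)

lemma division_member:
  assumes "D division_of S" "K \<in> D"
  obtains u v :: real where "u \<le> v" "K = {u..v}" "{u..v} \<subseteq> S"
proof -
  obtain u v where "K = cbox u v" "K \<noteq> {}" "K \<subseteq> S"
    using division_ofD(2-4)[OF assms(1)] assms(2) by metis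
  then show ?thesis using that by (auto simp: box_real)
qed

lemma sum_incr_division:
  assumes "D division_of {a..b}" "a \<le> b"
  shows "sum (incr f) D = f b - f a"
proof -
  have "(\<lambda>K. (Inf K, K)) ` D tagged_division_of {a..b}"
  proof (rule tagged_division_ofI)
    show "finite ((\<lambda>K. (Inf K, K)) ` D)" using assms(1) by (auto dest: division_of_finite)
    show "\<Union> {K. \<exists>x. (x, K) \<in> (\<lambda>K. (Inf K, K)) ` D} = {a..b}"
      using division_ofD(6)[OF assms(1)] by (auto simp: image_iff)
  next
    fix x K assume "(x, K) \<in> (\<lambda>K. (Inf K, K)) ` D"
    then have K: "K \<in> D" "x = Inf K" by auto
    then obtain u v where uv: "u \<le> v" "K = {u..v}" "{u..v} \<subseteq> {a..b}"
      using division_member[OF assms(1)] by metis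
    show "x \<in> K" "K \<subseteq> {a..b}" "\<exists>u v. K = cbox u v" using uv K by (auto simp: box_real)
  next
    fix x K x' K' assume "(x, K) \<in> (\<lambda>K. (Inf K, K)) ` D" "(x', K') \<in> (\<lambda>K. (Inf K, K)) ` D"
      "(x, K) \<noteq> (x', K')"
    then show "interior K \<inter> interior K' = {}"
      using division_ofD(5)[OF assms(1)] by auto
  qed
  from additive_tagged_division_1[OF assms(2) this, of f] show ?thesis
    by (subst (asm) sum.reindex) (auto simp: inj_on_def incr_def o_def)
qed

text \<open>
  A finite family of intervals covers \<open>[a, b]\<close> only in part. The gaps complete it to
  a division, so whatever the increments over the family miss is accounted for by the gaps, for
  every function at once. Used with the identity it says that the gaps are short, and then
  absolute continuity makes the increments of \<open>f\<close> over them small.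
\<close>

lemma sum_incr_split:
  assumes "D division_of \<Union>D" "\<Union>D \<subseteq> {a..b}" "a \<le> b"
  obtains G where "finite G" "D \<inter> G = {}" "(D \<union> G) division_of {a..b}"
    "\<And>f. sum (incr f) D + sum (incr f) G = f b - f a"
proof -
  obtain q where q: "D \<subseteq> q" "q division_of cbox a b"
    using partial_division_extend_interval[OF assms(1)] assms(2) by (metis box_real(2))
  have fin: "finite q" using q(2) by (rule division_of_finite)
  show ?thesis
  proof (rule that[of "q - D"])
    show "(D \<union> (q - D)) division_of {a..b}" using q by (simp add: Un_absorb1 Un_Diff_cancel box_real)
    fix f
    have "sum (incr f) q = f b - f a" using q(2) assms(3) by (simp add: sum_incr_division box_real)
    moreover have "sum (incr f) q = sum (incr f) (q - D) + sum (incr f) D"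
      using fin q(1) by (rule sum.subset_diff[rotated])
    ultimately show "sum (incr f) D + sum (incr f) (q - D) = f b - f a" by simp
  qed (use fin in auto)
qed

lemma abs_continuous_on_division:
  assumes "abs_continuous_on a b f" "\<epsilon> > 0"
  obtains \<delta> where "\<delta> > 0" "\<And>D. D division_of \<Union>D \<Longrightarrow> \<Union>D \<subseteq> {a..b} \<Longrightarrow>
      sum (incr (\<lambda>x. x)) D < \<delta> \<Longrightarrow> (\<Sum>K\<in>D. \<bar>incr f K\<bar>) < \<epsilon>"
proof -
  obtain \<delta> where \<delta>: "\<delta> > 0" and ac': "\<forall>(n::nat) u v.
        (\<forall>i<n. a \<le> u i \<and> u i \<le> v i \<and> v i \<le> b) \<longrightarrow>
        (\<forall>i<n. \<forall>j<n. i \<noteq> j \<longrightarrow> {u i<..<v i} \<inter> {u j<..<v j} = {}) \<longrightarrow>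
        (\<Sum>i<n. v i - u i) < \<delta> \<longrightarrow> (\<Sum>i<n. \<bar>f (v i) - f (u i)\<bar>) < \<epsilon>"
    using assms(1)[unfolded abs_continuous_on_def, rule_format, OF assms(2)] by auto
  show ?thesis
  proof (rule that[OF \<delta>])
    fix D :: "real set set"
    assume D: "D division_of \<Union>D" "\<Union>D \<subseteq> {a..b}" and s: "sum (incr (\<lambda>x. x)) D < \<delta>"
    obtain h where h: "bij_betw h {..<card D} D"
      using ex_bij_betw_nat_finite[OF division_of_finite[OF D(1)]] by (auto simp: atLeast0LessThan)
    define u v where "u i = Inf (h i)" and "v i = Sup (h i)" for i
    have hi: "u i \<le> v i \<and> h i = {u i..v i} \<and> a \<le> u i \<and> v i \<le> b" if "i < card D" for i
    proof -
      have "h i \<in> D" using h that by (auto simp: bij_betw_def)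
      then obtain c d where cd: "c \<le> d" "h i = {c..d}" "{c..d} \<subseteq> \<Union>D"
        using division_member[OF D(1)] by metis
      then have "{c..d} \<subseteq> {a..b}" using D(2) by blast
      then show ?thesis using cd by (auto simp: u_def v_def)
    qed
    have "(\<Sum>i<card D. \<bar>f (v i) - f (u i)\<bar>) < \<epsilon>"
    proof (rule ac'[THEN spec, THEN spec, THEN spec, THEN mp, THEN mp, THEN mp])
      show "\<forall>i<card D. \<forall>j<card D. i \<noteq> j \<longrightarrow> {u i<..<v i} \<inter> {u j<..<v j} = {}"
      proof (intro allI impI)
        fix i j assume ij: "i < card D" "j < card D" "i \<noteq> j"
        then have "h i \<in> D" "h j \<in> D" "h i \<noteq> h j" using h
          by (auto simp: bij_betw_def inj_on_def)
        then have "interior (h i) \<inter> interior (h j) = {}"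
          using division_ofD(5)[OF D(1)] by blast
        then show "{u i<..<v i} \<inter> {u j<..<v j} = {}" using hi ij
          by (metis interior_atLeastAtMost_real)
      qed
      have "(\<Sum>i<card D. v i - u i) = sum (incr (\<lambda>x. x)) D"
        using sum.reindex_bij_betw[OF h, of "incr (\<lambda>x. x)"] by (simp add: u_def v_def incr_def)
      then show "(\<Sum>i<card D. v i - u i) < \<delta>" using s by simp
    qed (use hi in auto)
    then show "(\<Sum>K\<in>D. \<bar>incr f K\<bar>) < \<epsilon>"
      using sum.reindex_bij_betw[OF h, of "\<lambda>K. \<bar>incr f K\<bar>"] by (simp add: u_def v_def incr_def)
  qed
qed

text \<open>
  The hypothesis of the Vitali covering theorem at the point \<open>t\<close>. Intervals having
  \<open>t\<close> as an endpoint are allowed, which is what makes difference quotients at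
  \<open>t\<close> accessible.
\<close>

definition fine_at :: "(real \<Rightarrow> real \<Rightarrow> bool) \<Rightarrow> real \<Rightarrow> bool" where
  "fine_at P t \<longleftrightarrow> (\<forall>e>0. \<exists>u v. u < v \<and> u \<le> t \<and> t \<le> v \<and> v - u < e \<and> P u v)"

lemma pairwise_disjnt_division:
  fixes u v :: "'i \<Rightarrow> real"
  assumes "finite I" "pairwise (\<lambda>i j. disjnt {u i..v i} {u j..v j}) I" "\<And>i. i \<in> I \<Longrightarrow> u i \<le> v i"
  shows "((\<lambda>i. {u i..v i}) ` I) division_of (\<Union>i\<in>I. {u i..v i})"
proof -
  show ?thesis
  proof (rule division_ofI)
    fix K L assume KL: "K \<in> (\<lambda>i. {u i..v i}) ` I" "L \<in> (\<lambda>i. {u i..v i}) ` I" "K \<noteq> L"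
    then obtain i j where "i \<in> I" "j \<in> I" "i \<noteq> j" "K = {u i..v i}" "L = {u j..v j}" by auto
    then have "K \<inter> L = {}" using assms(2) by (auto simp: pairwise_def disjnt_def)
    then show "interior K \<inter> interior L = {}" using interior_subset by blast
  next
    fix K assume "K \<in> (\<lambda>i. {u i..v i}) ` I"
    then obtain i where i: "i \<in> I" "K = {u i..v i}" by auto
    show "K \<subseteq> (\<Union>i\<in>I. {u i..v i})" using i by auto
    show "K \<noteq> {}" using i assms(3) by auto
    show "\<exists>a b. K = cbox a b" using i by (metis box_real(2))
  qed (use assms(1) in auto)
qed

lemma measure_division:
  assumes "D division_of S"
  shows "measure lebesgue S = sum (incr (\<lambda>x. x)) D" "S \<in> lmeasurable"
proof -
  have "(\<Sum>K\<in>D. measure lebesgue K) = measure lebesgue S"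
    using content_division assms by blast
  moreover have "measure lebesgue K = incr (\<lambda>x. x) K" if "K \<in> D" for K
    by (rule division_member[OF assms that]) simp
  ultimately show "measure lebesgue S = sum (incr (\<lambda>x. x)) D" by simp
  show "S \<in> lmeasurable"
    using assms by (rule lmeasurable_division)
qed

text \<open>
  The number \<open>\<mu>\<close> plays the role of the outer measure of \<open>S\<close>; the
  sets to which this is applied are mostly sets of points with given Dini derivatives, whose
  measurability would require a separate argument. By the Vitali covering theorem countably many
  disjoint intervals with property \<open>P\<close> cover \<open>S\<close> up to a null set, and
  finitely many of them already have total length close to \<open>\<mu>\<close>.
\<close>

lemma Vitali_fine:
  assumes S: "S \<subseteq> U" "open U" "U \<subseteq> {a..b}"
    and fine: "\<And>t. t \<in> S \<Longrightarrow> fine_at P t"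
    and outer: "\<And>T. T \<in> lmeasurable \<Longrightarrow> negligible (S - T) \<Longrightarrow> \<mu> \<le> measure lebesgue T"
    and \<eta>: "\<eta> > 0"
  obtains D where "D division_of \<Union>D" "\<Union>D \<subseteq> U" "sum (incr (\<lambda>x. x)) D > \<mu> - \<eta>"
    "\<And>K. K \<in> D \<Longrightarrow> \<exists>u v. u < v \<and> K = {u..v} \<and> P u v"
proof -
  define K where "K = {(u, v). u < v \<and> {u..v} \<subseteq> U \<and> P u v}"
  define c where "c = (\<lambda>(u::real, v). (u + v) / 2)"
  define r where "r = (\<lambda>(u::real, v). (v - u) / 2)"
  have cb: "cball (c i) (r i) = {fst i..snd i}" for i :: "real \<times> real"
    by (cases i) (auto simp: c_def r_def cball_eq_atLeastAtMost field_simps)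
  have "\<exists>i. i \<in> K \<and> x \<in> cball (c i) (r i) \<and> r i < d" if x: "x \<in> S" "0 < d" for x d
  proof -
    obtain e where e: "e > 0" "ball x e \<subseteq> U" using S x open_contains_ball by blast
    have "min d e > 0" using e x by simp
    then obtain u v where uv: "u < v" "u \<le> x" "x \<le> v" "v - u < min d e" "P u v"
      using fine[OF x(1)] unfolding fine_at_def by metis
    have "{u..v} \<subseteq> ball x e" using uv by (auto simp: dist_real_def)
    then have "(u, v) \<in> K" using uv e by (auto simp: K_def)
    moreover have "x \<in> cball (c (u, v)) (r (u, v))" unfolding cb using uv by auto
    moreover have "r (u, v) < d" using uv by (auto simp: r_def)
    ultimately show ?thesis by blast
  qed
  moreover have "\<And>i. i \<in> K \<Longrightarrow> 0 < r i" by (auto simp: K_def r_def)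
  ultimately obtain C where C: "countable C" "C \<subseteq> K"
     "pairwise (\<lambda>i j. disjnt (cball (c i) (r i)) (cball (c j) (r j))) C"
     "negligible(S - (\<Union>i \<in> C. cball (c i) (r i)))"
    using Vitali_covering_theorem_cballs[where K = K and r = r and S = S and a = c and thesis = thesis]
    by blast
  note C = C[unfolded cb]
  have sub: "{fst i..snd i} \<subseteq> U" if "i \<in> C" for i
    using subsetD[OF C(2) that] by (cases i) (auto simp: K_def)
  have "(\<Union>i\<in>C. {fst i..snd i}) \<in> sets lebesgue"
    using C(1) by (intro sets.countable_UN') auto
  moreover have "(\<Union>i\<in>C. {fst i..snd i}) \<subseteq> {a..b}" using sub S(3) by blast
  ultimately have "(\<Union>i\<in>C. {fst i..snd i}) \<in> lmeasurable"
    by (intro bounded_set_imp_lmeasurable) (auto intro: bounded_subset[of "{a..b}"])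
  from outer[OF this C(4)] have \<mu>: "\<mu> \<le> measure lebesgue (\<Union>i\<in>C. {fst i..snd i})" .
  have "\<exists>I\<subseteq>C. finite I \<and> measure lebesgue (\<Union>i\<in>I. {fst i..snd i}) > \<mu> - \<eta>"
  proof (rule ccontr)
    assume "\<not> ?thesis"
    then have "measure lebesgue (\<Union>i\<in>I. {fst i..snd i}) \<le> \<mu> - \<eta>" if "I \<subseteq> C" "finite I" for I
      using that by (meson not_le)
    then have "measure lebesgue (\<Union>i\<in>C. {fst i..snd i}) \<le> \<mu> - \<eta>"
      by (intro measure_UN_bound[OF C(1)]) simp_all
    then show False using \<mu> \<eta> by simp
  qed
  then obtain I where I: "I \<subseteq> C" "finite I" "measure lebesgue (\<Union>i\<in>I. {fst i..snd i}) > \<mu> - \<eta>"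
    by blast
  have lt: "fst i < snd i \<and> P (fst i) (snd i)" if "i \<in> I" for i
    using subsetD[OF C(2) subsetD[OF I(1) that]] by (cases i) (auto simp: K_def)
  have div: "((\<lambda>i. {fst i..snd i}) ` I) division_of (\<Union>i\<in>I. {fst i..snd i})"
    using lt by (intro pairwise_disjnt_division I(2) pairwise_subset[OF C(3) I(1)]) (auto intro: less_imp_le)
  show ?thesis
  proof (rule that[of "(\<lambda>i. {fst i..snd i}) ` I"])
    show "(\<lambda>i. {fst i..snd i}) ` I division_of \<Union> ((\<lambda>i. {fst i..snd i}) ` I)" using div by simp
    show "\<Union> ((\<lambda>i. {fst i..snd i}) ` I) \<subseteq> U" using sub I(1) by blast
    show "\<mu> - \<eta> < sum (incr (\<lambda>x. x)) ((\<lambda>i. {fst i..snd i}) ` I)"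
      using I(3) measure_division(1)[OF div] by simp
  next
    fix K assume "K \<in> (\<lambda>i. {fst i..snd i}) ` I"
    then obtain i where "i \<in> I" "K = {fst i..snd i}" by blast
    then show "\<exists>u v. u < v \<and> K = {u..v} \<and> P u v" using lt by blast
  qed
qed

section \<open>Almost everywhere differentiability of absolutely continuous functions\<close>

text \<open>
  The outer Lebesgue measure \<open>\<mu>\<close> of a bounded set, approximated from outside by
  open sets.
\<close>

lemma open_outer_measure:
  fixes S :: "real set"
  assumes S: "S \<subseteq> {a<..<b}"
  obtains \<mu> where "\<mu> \<ge> 0"
    "\<And>T. T \<in> lmeasurable \<Longrightarrow> negligible (S - T) \<Longrightarrow> \<mu> \<le> measure lebesgue T"
    "\<And>\<eta>. \<eta> > 0 \<Longrightarrow>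
      \<exists>U. open U \<and> S \<subseteq> U \<and> U \<subseteq> {a<..<b} \<and> U \<in> lmeasurable \<and> measure lebesgue U < \<mu> + \<eta>"
    "\<mu> = 0 \<Longrightarrow> negligible S"
proof -
  define X where "X = {measure lebesgue T | T. T \<in> lmeasurable \<and> negligible (S - T)}"
  have ne: "X \<noteq> {}"
  proof -
    have "measure lebesgue {a..b} \<in> X"
      unfolding X_def using S by (intro CollectI exI[of _ "{a..b}"]) (auto simp: subset_iff
        intro!: negligible_subset[OF negligible_empty])
    then show ?thesis by blast
  qed
  have bdd: "bdd_below X" by (rule bdd_belowI[of _ 0]) (auto simp: X_def)
  have ex: "\<exists>U. open U \<and> S \<subseteq> U \<and> U \<subseteq> {a<..<b} \<and> U \<in> lmeasurable \<and> measure lebesgue U < Inf X + \<eta>"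
    if \<eta>: "\<eta> > 0" for \<eta>
  proof -
    have lt: "Inf X < Inf X + \<eta> / 2" using \<eta> by simp
    obtain T where T: "T \<in> lmeasurable" "negligible (S - T)" "measure lebesgue T < Inf X + \<eta> / 2"
      using cInf_lessD[OF ne lt] unfolding X_def by blast
    define T' where "T' = T \<union> (S - T)"
    have T': "T' \<in> lmeasurable" "measure lebesgue T' = measure lebesgue T" "S \<subseteq> T'"
    proof -
      have N: "S - T \<in> null_sets lebesgue" using T(2) by (simp add: negligible_iff_null_sets)
      show "measure lebesgue T' = measure lebesgue T"
        unfolding T'_def using T(1) N by (intro measure_Un_null_set) auto
      show "T' \<in> lmeasurable"
        unfolding T'_def by (rule fmeasurable.Un[OF T(1) negligible_imp_measurable[OF T(2)]])
    qed (auto simp: T'_def)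
    obtain U where U: "open U" "T' \<subseteq> U" "U - T' \<in> lmeasurable" "emeasure lebesgue (U - T') < ennreal (\<eta>/2)"
      using sets_lebesgue_outer_open[of T' "\<eta>/2"] T'(1) \<eta> by auto
    have mU: "measure lebesgue (U - T') < \<eta> / 2"
      using U(3,4) \<eta> by (simp add: emeasure_eq_measure2 ennreal_less_iff)
    have Ue: "U = T' \<union> (U - T')" using U(2) by blast
    have "U \<in> lmeasurable" using T'(1) U(3) fmeasurable.Un Ue by metis
    have "measure lebesgue U \<le> measure lebesgue T' + measure lebesgue (U - T')"
      using measure_Un_le[of T' lebesgue "U - T'"] T'(1) U(3) Ue by (metis fmeasurableD)
    then have mU': "measure lebesgue U < Inf X + \<eta>" using mU T T' by simp
    let ?V = "U \<inter> {a<..<b}"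
    have "?V \<in> lmeasurable" using \<open>U \<in> lmeasurable\<close> by (auto intro!: fmeasurable_Int_fmeasurable)
    moreover have "measure lebesgue ?V \<le> measure lebesgue U"
      using \<open>U \<in> lmeasurable\<close> \<open>?V \<in> lmeasurable\<close> by (intro measure_mono_fmeasurable) auto
    ultimately show ?thesis using U T' S mU' by (intro exI[of _ ?V]) auto
  qed
  show ?thesis
  proof (rule that[of "Inf X"])
    show "Inf X \<ge> 0" using ne by (rule cInf_greatest) (auto simp: X_def)
    show "Inf X \<le> measure lebesgue T" if "T \<in> lmeasurable" "negligible (S - T)" for T
      using bdd that by (intro cInf_lower) (auto simp: X_def)
    show "negligible S" if "Inf X = 0"
      unfolding negligible_outer
    proof (intro allI impI)
      fix e :: real assume "e > 0"
      from ex[OF this] show "\<exists>T. S \<subseteq> T \<and> T \<in> lmeasurable \<and> measure lebesgue T < e"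
        using that by auto
    qed
  qed (rule ex)
qed

text \<open>
  Cover \<open>S\<close> almost exactly by intervals of slope at most \<open>p\<close>, and then
  cover the part of \<open>S\<close> inside these intervals again, almost exactly, by intervals of
  slope at least \<open>q\<close>. Both families have total length about the outer measure
  \<open>\<mu>\<close> of \<open>S\<close>, so the first has increment at most about \<open>p
  \<mu>\<close> and the second at least about \<open>q \<mu>\<close>. The first family minus the
  second consists of short gaps, over which an absolutely continuous function hardly changes;
  hence \<open>q \<mu> \<le> p \<mu>\<close>, and \<open>p < q\<close> leaves only \<open>\<mu> =
  0\<close>.
\<close>

lemma two_slopes_negligible:
  assumes ac: "abs_continuous_on a b f" and ab: "a \<le> b" and S: "S \<subseteq> {a<..<b}" and pq: "p < q"
    and lo: "\<And>t. t \<in> S \<Longrightarrow> fine_at (\<lambda>u v. f v - f u \<le> p * (v - u)) t"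
    and hi: "\<And>t. t \<in> S \<Longrightarrow> fine_at (\<lambda>u v. f v - f u \<ge> q * (v - u)) t"
  shows "negligible S"
proof -
  obtain \<mu> where \<mu>: "\<mu> \<ge> 0"
    "\<And>T. T \<in> lmeasurable \<Longrightarrow> negligible (S - T) \<Longrightarrow> \<mu> \<le> measure lebesgue T"
    "\<And>\<eta>. \<eta> > 0 \<Longrightarrow> \<exists>U. open U \<and> S \<subseteq> U \<and> U \<subseteq> {a<..<b} \<and> U \<in> lmeasurable \<and> measure lebesgue U < \<mu> + \<eta>"
    "\<mu> = 0 \<Longrightarrow> negligible S"
    by (rule open_outer_measure[OF S]) blast
  let ?len = "incr (\<lambda>x. x)"
  \<comment> \<open>The choice of \<open>U\<close> and each of the two covering steps lose a length
      \<open>\<eta>\<close>; these losses add up to the factors 3 and 4.\<close>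
  have key: "(q - p) * (\<mu> - 3 * \<eta>) \<le> \<bar>p\<bar> * (4 * \<eta>) + \<epsilon>"
    if \<epsilon>: "\<epsilon> > 0" and \<eta>: "\<eta> > 0" and \<delta>: "4 * \<eta> < \<delta>"
      and AC: "\<And>D. D division_of \<Union>D \<Longrightarrow> \<Union>D \<subseteq> {a..b} \<Longrightarrow> sum ?len D < \<delta> \<Longrightarrow> (\<Sum>K\<in>D. \<bar>incr f K\<bar>) < \<epsilon>"
    for \<epsilon> \<eta> \<delta>
  proof -
    obtain U where U: "open U" "S \<subseteq> U" "U \<subseteq> {a<..<b}" "U \<in> lmeasurable" "measure lebesgue U < \<mu> + \<eta>"
      using \<mu>(3)[OF \<eta>] by blast
    have Uab: "U \<subseteq> {a..b}" using U(3) by (auto simp: subset_iff)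
    obtain D where D: "D division_of \<Union>D" "\<Union>D \<subseteq> U" "sum ?len D > \<mu> - \<eta>"
      "\<And>K. K \<in> D \<Longrightarrow> \<exists>u v. u < v \<and> K = {u..v} \<and> f v - f u \<le> p * (v - u)"
      using Vitali_fine[where P = "\<lambda>u v. f v - f u \<le> p * (v - u)", OF U(2) U(1) Uab lo \<mu>(2) \<eta>] by blast
    have mD: "measure lebesgue (\<Union>D) = sum ?len D" "\<Union>D \<in> lmeasurable" using measure_division[OF D(1)] by auto
    have sD: "sum ?len D < \<mu> + \<eta>"
      using measure_mono_fmeasurable[OF D(2)] mD U(4,5) by fastforce
    define V where "V = (\<Union>K\<in>D. interior K)"
    have V: "open V" "V \<subseteq> \<Union>D" unfolding V_def using interior_subset by auto
    have VN: "negligible (\<Union>D - V)"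
    proof (rule negligible_subset)
      have "negligible (K - interior K)" if KD: "K \<in> D" for K
      proof -
        obtain u v where "K = {u..v}" using D(4)[OF KD] by blast
        then have "K - interior K \<subseteq> {u, v}" by auto
        then show ?thesis by (rule negligible_subset[rotated]) simp
      qed
      then show "negligible (\<Union>K\<in>D. K - interior K)"
        using division_of_finite[OF D(1)] by (intro negligible_Union) auto
      show "\<Union>D - V \<subseteq> (\<Union>K\<in>D. K - interior K)" by (auto simp: V_def)
    qed
    have out2: "\<mu> - 2 * \<eta> \<le> measure lebesgue T" if T: "T \<in> lmeasurable" "negligible (S \<inter> V - T)" for T
    proof -
      let ?T = "T \<union> (U - \<Union>D)"
      have UD: "U - \<Union>D \<in> lmeasurable" using U(4) mD(2) by (intro fmeasurable.Diff) auto
      then have T': "?T \<in> lmeasurable" using T(1) by (intro fmeasurable.Un)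
      have "S - ?T \<subseteq> (S \<inter> V - T) \<union> (\<Union>D - V)" using U(2) by auto
      then have "negligible (S - ?T)" by (rule negligible_subset[rotated]) (use T VN in \<open>auto intro: negligible_Un\<close>)
      then have "\<mu> \<le> measure lebesgue ?T" using \<mu>(2) T' by blast
      also have "\<dots> \<le> measure lebesgue T + measure lebesgue (U - \<Union>D)"
        using T(1) UD by (intro measure_Un_le) auto
      also have "measure lebesgue (U - \<Union>D) = measure lebesgue U - measure lebesgue (\<Union>D)"
        using U(4) mD(2) D(2) by (intro measurable_measure_Diff) auto
      finally show ?thesis using U(5) D(3) mD by simp
    qed
    have Vab: "V \<subseteq> {a..b}" using V(2) D(2) Uab by blast
    have hi': "fine_at (\<lambda>u v. f v - f u \<ge> q * (v - u)) t" if "t \<in> S \<inter> V" for t using hi that by blast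
    obtain E where E: "E division_of \<Union>E" "\<Union>E \<subseteq> V" "sum ?len E > (\<mu> - 2 * \<eta>) - \<eta>"
      "\<And>K. K \<in> E \<Longrightarrow> \<exists>u v. u < v \<and> K = {u..v} \<and> f v - f u \<ge> q * (v - u)"
      using Vitali_fine[where P = "\<lambda>u v. f v - f u \<ge> q * (v - u)", OF Int_lower2 V(1) Vab hi' out2 \<eta>] by blast
    obtain F where F: "finite F" "D \<inter> F = {}" "(D \<union> F) division_of {a..b}"
        "\<And>f. sum (incr f) D + sum (incr f) F = f b - f a"
      using sum_incr_split[OF D(1) order_trans[OF D(2) Uab] ab] by blast
    have EF: "interior K \<inter> interior L = {}" if "K \<in> E" "L \<in> F" for K L
    proof -
      have "interior L \<inter> interior I = {}" if "I \<in> D" for I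
        using division_ofD(5)[OF F(3), of L I] \<open>L \<in> F\<close> that F(2) by blast
      then have "interior L \<inter> V = {}" by (auto simp: V_def)
      moreover have "interior K \<subseteq> V" using E(2) \<open>K \<in> E\<close> interior_subset by blast
      ultimately show ?thesis by blast
    qed
    have EF0: "E \<inter> F = {}"
    proof (rule ccontr)
      assume "E \<inter> F \<noteq> {}"
      then obtain K where K: "K \<in> E" "K \<in> F" by blast
      then obtain u v where "u < v" "K = {u..v}" using E(4) by blast
      then show False using EF[OF K] by auto
    qed
    have divF: "F division_of \<Union>F"
      using division_of_subset[OF division_of_union_self[OF F(3)], of F] by simp
    have "(E \<union> F) division_of (\<Union>E \<union> \<Union>F)"
    proof (rule division_ofI)
      show "finite (E \<union> F)" using F(1) E(1) by (auto dest: division_of_finite)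
      fix K assume "K \<in> E \<union> F"
      then show "K \<subseteq> \<Union> E \<union> \<Union> F" "K \<noteq> {}" "\<exists>a b. K = cbox a b"
        using division_ofD(3,4)[OF E(1), of K] division_ofD(3,4)[OF divF, of K] by auto
    next
      fix K L assume "K \<in> E \<union> F" "L \<in> E \<union> F" "K \<noteq> L"
      then show "interior K \<inter> interior L = {}"
        using division_ofD(5)[OF E(1), of K L] division_ofD(5)[OF divF, of K L] EF[of K L] EF[of L K]
        by (auto simp: Int_commute)
    qed auto
    then have divEF: "(E \<union> F) division_of \<Union>(E \<union> F)" by (simp add: Union_Un_distrib)
    have sub: "\<Union>(E \<union> F) \<subseteq> {a..b}"
    proof -
      have "\<Union>E \<subseteq> {a..b}" using E(2) Vab by (rule order_trans)
      moreover have "\<Union>F \<subseteq> {a..b}" using division_ofD(6)[OF F(3)] by blast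
      ultimately show ?thesis by (simp add: Union_Un_distrib)
    qed
    obtain G where G: "finite G" "(E \<union> F) \<inter> G = {}" "((E \<union> F) \<union> G) division_of {a..b}"
        "\<And>f. sum (incr f) (E \<union> F) + sum (incr f) G = f b - f a"
      using sum_incr_split[OF divEF sub ab] by blast
    \<comment> \<open>\<open>D \<union> F\<close> and \<open>E \<union> F \<union> G\<close> are
        divisions of the same interval, so \<open>G\<close> is what \<open>D\<close>
        has in excess of \<open>E\<close>.\<close>
    have bal: "sum (incr g) D = sum (incr g) E + sum (incr g) G" for g
    proof -
      have "sum (incr g) (E \<union> F) = sum (incr g) E + sum (incr g) F"
        using EF0 F(1) division_of_finite[OF E(1)] by (intro sum.union_disjoint) auto
      then show ?thesis using F(4)[of g] G(4)[of g] by simp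
    qed
    have divG: "G division_of \<Union>G"
      using division_of_subset[OF division_of_union_self[OF G(3)], of G] by simp
    have Gab: "\<Union>G \<subseteq> {a..b}" using division_ofD(6)[OF G(3)] by blast
    have lenG: "sum ?len G < \<delta>" using bal[of "\<lambda>x. x"] sD E(3) \<delta> by simp
    have "\<bar>sum (incr f) G\<bar> \<le> (\<Sum>K\<in>G. \<bar>incr f K\<bar>)" by (rule sum_abs)
    also have "\<dots> < \<epsilon>" using AC[OF divG Gab lenG] .
    finally have fG: "\<bar>sum (incr f) G\<bar> < \<epsilon>" .
    have "sum (incr f) D \<le> (\<Sum>K\<in>D. p * ?len K)"
      by (intro sum_mono) (use D(4) in fastforce)
    then have 1: "sum (incr f) D \<le> p * sum ?len D" by (simp add: sum_distrib_left)
    have "(\<Sum>K\<in>E. q * ?len K) \<le> sum (incr f) E"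
      by (intro sum_mono) (use E(4) in fastforce)
    then have 2: "q * sum ?len E \<le> sum (incr f) E" by (simp add: sum_distrib_left)
    have diff: "\<bar>sum ?len D - sum ?len E\<bar> \<le> 4 * \<eta>"
    proof -
      have "sum ?len G \<ge> 0"
        using division_member[OF divG] by (intro sum_nonneg) (metis incr_interval diff_ge_0_iff_ge)
      then show ?thesis using bal[of "\<lambda>x. x"] sD E(3) by linarith
    qed
    have "(q - p) * (\<mu> - 3 * \<eta>) \<le> (q - p) * sum ?len E"
      using E(3) pq by (intro mult_left_mono) auto
    also have "\<dots> \<le> p * (sum ?len D - sum ?len E) + \<epsilon>"
      using 1 2 fG bal[of f] by (simp add: algebra_simps)
    also have "p * (sum ?len D - sum ?len E) \<le> \<bar>p\<bar> * (4 * \<eta>)"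
      using order_trans[OF abs_ge_self[of "p * (sum ?len D - sum ?len E)"]]
        mult_left_mono[OF diff abs_ge_zero[of p]] by (simp add: abs_mult)
    finally show ?thesis by simp
  qed
  have "(q - p) * \<mu> \<le> \<epsilon>" if \<epsilon>: "\<epsilon> > 0" for \<epsilon>
  proof (rule field_le_epsilon)
    fix e :: real assume e: "e > 0"
    obtain \<delta> where \<delta>: "\<delta> > 0" "\<And>D. D division_of \<Union>D \<Longrightarrow> \<Union>D \<subseteq> {a..b} \<Longrightarrow>
        sum ?len D < \<delta> \<Longrightarrow> (\<Sum>K\<in>D. \<bar>incr f K\<bar>) < \<epsilon>"
      using abs_continuous_on_division[OF ac \<epsilon>] by blast
    define c where "c = 4 * \<bar>p\<bar> + 3 * (q - p)"
    have c: "c > 0" using pq by (simp add: c_def add_nonneg_pos)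
    define \<eta> where "\<eta> = min (\<delta> / 5) (e / c)"
    have \<eta>: "\<eta> > 0" "4 * \<eta> < \<delta>" using \<delta>(1) e c by (auto simp: \<eta>_def min_def field_simps)
    have "c * \<eta> \<le> e" using c by (simp add: \<eta>_def min_def field_simps)
    with key[OF \<epsilon> \<eta>(1,2) \<delta>(2)] show "(q - p) * \<mu> \<le> \<epsilon> + e"
      by (simp add: c_def algebra_simps)
  qed
  then have "(q - p) * \<mu> \<le> 0" by (rule dense_ge)
  then have "\<mu> = 0" using \<mu>(1) pq by (simp add: mult_le_0_iff)
  then show ?thesis by (rule \<mu>(4))
qed

lemma not_fine_atD:
  assumes "\<not> fine_at P t"
  shows "\<exists>e>0. \<forall>u v. u < v \<longrightarrow> u \<le> t \<longrightarrow> t \<le> v \<longrightarrow> v - u < e \<longrightarrow> \<not> P u v"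
proof -
  obtain e where e: "e > 0" "\<not> (\<exists>u v. u < v \<and> u \<le> t \<and> t \<le> v \<and> v - u < e \<and> P u v)"
    using assms unfolding fine_at_def by (auto simp only: not_all not_imp)
  show ?thesis
    by (rule exI[of _ e]) (use e in simp)
qed

text \<open>
  On an interval shorter than the \<open>\<delta>\<close> that belongs to \<open>\<epsilon> =
  1\<close>, disjoint intervals have increments of total size below 1. If they have slopes at
  least \<open>n\<close> and total length about the outer measure \<open>\<mu>\<close>, then
  \<open>n \<mu>\<close> stays bounded for all \<open>n\<close>.
\<close>

lemma infinite_slope_negligible:
  assumes ac: "abs_continuous_on a b f" and S: "S \<subseteq> {a<..<b}"
    and fine: "\<And>t n. t \<in> S \<Longrightarrow> fine_at (\<lambda>u v. \<bar>f v - f u\<bar> \<ge> real n * (v - u)) t"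
  shows "negligible S"
proof -
  let ?len = "incr (\<lambda>x. x)"
  obtain \<delta> where \<delta>: "\<delta> > 0" "\<And>D. D division_of \<Union>D \<Longrightarrow> \<Union>D \<subseteq> {a..b} \<Longrightarrow>
      sum ?len D < \<delta> \<Longrightarrow> (\<Sum>K\<in>D. \<bar>incr f K\<bar>) < 1"
    using abs_continuous_on_division[OF ac zero_less_one] by blast
  have local: "negligible (S \<inter> {c<..<d})" if cd: "a \<le> c" "d \<le> b" "c < d" "d - c < \<delta>" for c d
  proof -
    have "S \<inter> {c<..<d} \<subseteq> {c<..<d}" by blast
    then obtain \<mu> where \<mu>: "\<mu> \<ge> 0"
      "\<And>T. T \<in> lmeasurable \<Longrightarrow> negligible (S \<inter> {c<..<d} - T) \<Longrightarrow> \<mu> \<le> measure lebesgue T"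
      "\<And>\<eta>. \<eta> > 0 \<Longrightarrow> \<exists>U. open U \<and> S \<inter> {c<..<d} \<subseteq> U \<and> U \<subseteq> {c<..<d} \<and> U \<in> lmeasurable
         \<and> measure lebesgue U < \<mu> + \<eta>"
      "\<mu> = 0 \<Longrightarrow> negligible (S \<inter> {c<..<d})"
      by (rule open_outer_measure) blast
    have bound: "real n * \<mu> \<le> 2" for n :: nat
    proof (cases "\<mu> = 0")
      case False
      then have \<mu>2: "\<mu> / 2 > 0" using \<mu>(1) by simp
      have f': "fine_at (\<lambda>u v. \<bar>f v - f u\<bar> \<ge> real n * (v - u)) t" if "t \<in> S \<inter> {c<..<d}" for t
        using fine that by blast
      have sub: "{c<..<d} \<subseteq> {a..b}" using cd by auto
      obtain D where D: "D division_of \<Union>D" "\<Union>D \<subseteq> {c<..<d}" "sum ?len D > \<mu> - \<mu> / 2"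
          "\<And>K. K \<in> D \<Longrightarrow> \<exists>u v. u < v \<and> K = {u..v} \<and> \<bar>f v - f u\<bar> \<ge> real n * (v - u)"
        using Vitali_fine[where P = "\<lambda>u v. \<bar>f v - f u\<bar> \<ge> real n * (v - u)",
            OF Int_lower2 open_greaterThanLessThan sub f' \<mu>(2) \<mu>2] by blast
      have "sum ?len D = measure lebesgue (\<Union>D)" using measure_division(1)[OF D(1)] by simp
      also have "\<dots> \<le> measure lebesgue {c<..<d}"
        using D(2) measure_division(2)[OF D(1)] by (intro measure_mono_fmeasurable) auto
      also have "\<dots> < \<delta>" using cd by simp
      finally have "(\<Sum>K\<in>D. \<bar>incr f K\<bar>) < 1"
        using \<delta>(2)[OF D(1) order_trans[OF D(2) sub]] by blast
      moreover have "(\<Sum>K\<in>D. real n * ?len K) \<le> (\<Sum>K\<in>D. \<bar>incr f K\<bar>)"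
        by (intro sum_mono) (use D(4) in fastforce)
      ultimately have "real n * sum ?len D < 1" by (simp add: sum_distrib_left)
      moreover have "real n * (\<mu> / 2) \<le> real n * sum ?len D" using D(3) by (intro mult_left_mono) auto
      ultimately show ?thesis by simp
    qed simp
    have "\<mu> = 0"
    proof (rule ccontr)
      assume "\<mu> \<noteq> 0"
      then obtain n :: nat where "2 < real n * \<mu>" using \<mu>(1) reals_Archimedean3[of \<mu>] by auto
      then show False using bound[of n] by simp
    qed
    then show ?thesis by (rule \<mu>(4))
  qed
  show ?thesis
  proof (rule locally_negligible_alt[THEN iffD2], rule ballI)
    fix x assume x: "x \<in> S"
    define c d where "c = max a (x - \<delta> / 3)" and "d = min b (x + \<delta> / 3)"
    have xab: "a < x" "x < b" using x S by auto
    have "x - \<delta> / 3 \<le> c" "d \<le> x + \<delta> / 3" by (auto simp: c_def d_def)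
    then have "d - c < \<delta>" using \<delta>(1) by linarith
    moreover have "c < x" "x < d" using xab \<delta>(1) by (auto simp: c_def d_def)
    moreover have "a \<le> c" "d \<le> b" by (auto simp: c_def d_def)
    ultimately have cd: "a \<le> c" "d \<le> b" "c < d" "d - c < \<delta>" "x \<in> {c<..<d}" by auto
    show "\<exists>U. openin (top_of_set S) U \<and> x \<in> U \<and> negligible U"
    proof (intro exI conjI)
      show "openin (top_of_set S) (S \<inter> {c<..<d})" by (simp add: openin_open_Int)
      show "x \<in> S \<inter> {c<..<d}" using x cd(5) by blast
      show "negligible (S \<inter> {c<..<d})" by (rule local[OF cd(1-4)])
    qed
  qed
qed

text \<open>
  Outside the countably many exceptional sets given by rational \<open>p < q\<close>, no two
  different numbers are both approached by slopes of short intervals around \<open>t\<close>;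
  outside the set of infinite slopes the slopes stay bounded. So they converge, and their limit is
  the derivative.
\<close>

theorem abs_continuous_on_differentiable_ae:
  assumes ac: "abs_continuous_on a b f" and ab: "a \<le> b"
  shows "negligible {t \<in> {a<..<b}. \<not> f differentiable (at t)}"
proof -
  define A where "A p = {t \<in> {a<..<b}. fine_at (\<lambda>u v. f v - f u \<le> p * (v - u)) t}" for p
  define B where "B q = {t \<in> {a<..<b}. fine_at (\<lambda>u v. f v - f u \<ge> q * (v - u)) t}" for q
  define I where "I = {t \<in> {a<..<b}. \<forall>n::nat. fine_at (\<lambda>u v. \<bar>f v - f u\<bar> \<ge> real n * (v - u)) t}"
  define N where "N = I \<union> (\<Union>(p, q)\<in>{(p, q). p \<in> \<rat> \<and> q \<in> \<rat> \<and> p < q}. A p \<inter> B q)"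
  have "countable {(p, q). p \<in> (\<rat>::real set) \<and> q \<in> \<rat> \<and> p < q}"
    by (rule countable_subset[of _ "\<rat> \<times> \<rat>"]) (auto intro: countable_rat)
  moreover have "negligible (A p \<inter> B q)" if "p < q" for p q
    using that by (intro two_slopes_negligible[OF ac ab, of _ p q]) (auto simp: A_def B_def)
  ultimately have "negligible (\<Union>(p, q)\<in>{(p, q). p \<in> \<rat> \<and> q \<in> \<rat> \<and> p < q}. A p \<inter> B q)"
    by (intro negligible_countable_Union) (auto intro!: countable_image)
  moreover have "negligible I"
    by (rule infinite_slope_negligible[OF ac]) (auto simp: I_def)
  ultimately have "negligible N" unfolding N_def by (rule negligible_Un[rotated])
  moreover have "{t \<in> {a<..<b}. \<not> f differentiable (at t)} \<subseteq> N"
  proof (rule subsetI, rule ccontr)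
    fix t assume t: "t \<in> {t \<in> {a<..<b}. \<not> f differentiable (at t)}" and tN: "t \<notin> N"
    then have tab: "t \<in> {a<..<b}" and "t \<notin> I" by (auto simp: N_def)
    obtain n :: nat where nf: "\<not> fine_at (\<lambda>u v. \<bar>f v - f u\<bar> \<ge> real n * (v - u)) t"
      using \<open>t \<notin> I\<close> tab unfolding I_def by blast
    obtain e0 where n: "e0 > 0"
      "\<And>u v. u < v \<Longrightarrow> u \<le> t \<Longrightarrow> t \<le> v \<Longrightarrow> v - u < e0 \<Longrightarrow> \<bar>f v - f u\<bar> < real n * (v - u)"
      using not_fine_atD[OF nf] unfolding not_le by blast
    have nA: "\<exists>e>0. \<forall>u v. u < v \<longrightarrow> u \<le> t \<longrightarrow> t \<le> v \<longrightarrow> v - u < e \<longrightarrow> f v - f u > p * (v - u)" if tA: "t \<notin> A p" for p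
    proof -
      have "\<not> fine_at (\<lambda>u v. f v - f u \<le> p * (v - u)) t" using tA tab unfolding A_def by blast
      from not_fine_atD[OF this] show ?thesis unfolding not_le .
    qed
    have nB: "\<exists>e>0. \<forall>u v. u < v \<longrightarrow> u \<le> t \<longrightarrow> t \<le> v \<longrightarrow> v - u < e \<longrightarrow> f v - f u < q * (v - u)" if tB: "t \<notin> B q" for q
    proof -
      have "\<not> fine_at (\<lambda>u v. f v - f u \<ge> q * (v - u)) t" using tB tab unfolding B_def by blast
      from not_fine_atD[OF this] show ?thesis unfolding not_le .
    qed
    define X where "X = {p. t \<notin> A p}"
    have "- real n \<in> X"
    proof -
      have "\<not> fine_at (\<lambda>u v. f v - f u \<le> - real n * (v - u)) t"
      proof
        assume "fine_at (\<lambda>u v. f v - f u \<le> - real n * (v - u)) t"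
        then obtain u v where uv: "u < v" "u \<le> t" "t \<le> v" "v - u < e0" "f v - f u \<le> - real n * (v - u)"
          using n(1) unfolding fine_at_def by blast
        then show False using n(2)[OF uv(1-4)] by (simp add: abs_less_iff)
      qed
      then show ?thesis by (simp add: X_def A_def)
    qed
    moreover have Xb: "p \<le> real n" if pX: "p \<in> X" for p
    proof -
      obtain e where e: "e > 0" "\<And>u v. u < v \<Longrightarrow> u \<le> t \<Longrightarrow> t \<le> v \<Longrightarrow> v - u < e \<Longrightarrow> f v - f u > p * (v - u)"
        using nA[of p] pX unfolding X_def by blast
      define h where "h = min e e0 / 2"
      have h: "h > 0" "h < e" "h < e0" using e(1) n(1) by (auto simp: h_def min_def)
      have "p * h < f (t + h) - f t" using e(2)[of t "t + h"] h by simp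
      moreover have "\<bar>f (t + h) - f t\<bar> < real n * h" using n(2)[of t "t + h"] h by simp
      ultimately have "p * h < real n * h" by linarith
      then show ?thesis using h(1) by simp
    qed
    ultimately have X: "X \<noteq> {}" "bdd_above X" by (blast, intro bdd_aboveI[of _ "real n"])
    define s where "s = Sup X"
    have low: "\<exists>e>0. \<forall>u v. u < v \<longrightarrow> u \<le> t \<longrightarrow> t \<le> v \<longrightarrow> v - u < e \<longrightarrow> f v - f u > p * (v - u)" if p: "p < s" for p
    proof -
      obtain p' where p': "p' \<in> X" "p < p'" using less_cSupD[OF X(1) p[unfolded s_def]] by blast
      then obtain e where e: "e > 0" "\<And>u v. u < v \<Longrightarrow> u \<le> t \<Longrightarrow> t \<le> v \<Longrightarrow> v - u < e \<Longrightarrow> f v - f u > p' * (v - u)"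
        using nA unfolding X_def by blast
      have "f v - f u > p * (v - u)" if "u < v" "u \<le> t" "t \<le> v" "v - u < e" for u v
      proof -
        have "p * (v - u) \<le> p' * (v - u)" using p'(2) that(1) by (intro mult_right_mono) auto
        then show ?thesis using e(2)[OF that] by simp
      qed
      then show ?thesis using e(1) by blast
    qed
    have up: "\<exists>e>0. \<forall>u v. u < v \<longrightarrow> u \<le> t \<longrightarrow> t \<le> v \<longrightarrow> v - u < e \<longrightarrow> f v - f u < q * (v - u)" if q: "s < q" for q
    proof -
      obtain p1 where p1: "p1 \<in> \<rat>" "s < p1" "p1 < q" using Rats_dense_in_real[OF q] by blast
      obtain q1 where q1: "q1 \<in> \<rat>" "p1 < q1" "q1 < q" using Rats_dense_in_real[OF p1(3)] by blast
      have "p1 \<notin> X" using p1(2) cSup_upper[OF _ X(2), of p1] unfolding s_def by auto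
      then have "t \<in> A p1" by (simp add: X_def)
      then have "t \<notin> B q1" using tN p1 q1 unfolding N_def by blast
      then obtain e where e: "e > 0" "\<And>u v. u < v \<Longrightarrow> u \<le> t \<Longrightarrow> t \<le> v \<Longrightarrow> v - u < e \<Longrightarrow> f v - f u < q1 * (v - u)"
        using nB by blast
      have "f v - f u < q * (v - u)" if "u < v" "u \<le> t" "t \<le> v" "v - u < e" for u v
      proof -
        have "q1 * (v - u) \<le> q * (v - u)" using q1(3) that(1) by (intro mult_right_mono) auto
        then show ?thesis using e(2)[OF that] by simp
      qed
      then show ?thesis using e(1) by blast
    qed
    have "(f has_real_derivative s) (at t)"
      unfolding has_field_derivative_iff LIM_def
    proof (intro allI impI)
      fix e :: real assume e: "e > 0"
      obtain e1 where e1: "e1 > 0"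
          "\<And>u v. u < v \<Longrightarrow> u \<le> t \<Longrightarrow> t \<le> v \<Longrightarrow> v - u < e1 \<Longrightarrow> f v - f u > (s - e) * (v - u)"
        using low[of "s - e"] e by auto
      obtain e2 where e2: "e2 > 0"
          "\<And>u v. u < v \<Longrightarrow> u \<le> t \<Longrightarrow> t \<le> v \<Longrightarrow> v - u < e2 \<Longrightarrow> f v - f u < (s + e) * (v - u)"
        using up[of "s + e"] e by auto
      have "dist ((f y - f t) / (y - t)) s < e" if y: "y \<noteq> t" "dist y t < min e1 e2" for y
      proof (cases "y < t")
        case True
        then have "(s - e) * (t - y) < f t - f y" "f t - f y < (s + e) * (t - y)"
          using e1(2)[of y t] e2(2)[of y t] y by (auto simp: dist_real_def)
        then have "s - e < (f t - f y) / (t - y)" "(f t - f y) / (t - y) < s + e"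
          using True by (auto simp: less_divide_eq divide_less_eq)
        moreover have "(f y - f t) / (y - t) = (f t - f y) / (t - y)"
          by (metis minus_diff_eq minus_divide_divide)
        ultimately show ?thesis by (auto simp: dist_real_def abs_less_iff)
      next
        case False
        then have ty: "t < y" using y by simp
        then have "(s - e) * (y - t) < f y - f t" "f y - f t < (s + e) * (y - t)"
          using e1(2)[of t y] e2(2)[of t y] y by (auto simp: dist_real_def)
        then have "s - e < (f y - f t) / (y - t)" "(f y - f t) / (y - t) < s + e"
          using ty by (auto simp: less_divide_eq divide_less_eq)
        then show ?thesis by (auto simp: dist_real_def abs_less_iff)
      qed
      then show "\<exists>d>0. \<forall>x. x \<noteq> t \<and> dist x t < d \<longrightarrow> dist ((f x - f t) / (x - t)) s < e"
        using e1(1) e2(1) by (intro exI[of _ "min e1 e2"]) auto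
    qed
    then have "f differentiable (at t)" using real_differentiable_def by blast
    then show False using t by simp
  qed
  ultimately show ?thesis by (rule negligible_subset)
qed

text \<open>
  Almost all of \<open>[a, b]\<close> is covered by disjoint intervals of slope at most \<open>L +
  e\<close>, and the gaps contribute little by absolute continuity. The Cantor function, with
  \<open>L = 0\<close> and \<open>N\<close> the Cantor set, shows that continuity would not be
  enough.
\<close>

theorem abs_continuous_on_increment_le:
  assumes ac: "abs_continuous_on a b f" and ab: "a \<le> b" and N: "negligible N"
    and der: "\<And>t. t \<in> {a<..<b} - N \<Longrightarrow> \<exists>s\<le>L. (f has_real_derivative s) (at t)"
  shows "f b - f a \<le> L * (b - a)"
proof (rule field_le_epsilon)
  fix \<epsilon> :: real assume \<epsilon>: "\<epsilon> > 0"
  let ?len = "incr (\<lambda>x. x)"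
  define e where "e = \<epsilon> / (4 * (b - a + 1))"
  have e: "e > 0" "e * (b - a) \<le> \<epsilon> / 4" using \<epsilon> ab by (auto simp: e_def field_simps)
  have \<epsilon>2: "\<epsilon> / 2 > 0" using \<epsilon> by simp
  obtain \<delta> where \<delta>: "\<delta> > 0" "\<And>D. D division_of \<Union>D \<Longrightarrow> \<Union>D \<subseteq> {a..b} \<Longrightarrow>
      sum ?len D < \<delta> \<Longrightarrow> (\<Sum>K\<in>D. \<bar>incr f K\<bar>) < \<epsilon> / 2"
    using abs_continuous_on_division[OF ac \<epsilon>2] by blast
  define \<eta> where "\<eta> = min \<delta> (\<epsilon> / (4 * (\<bar>L + e\<bar> + 1)))"
  have \<eta>: "\<eta> > 0" using \<delta>(1) \<epsilon> by (simp add: \<eta>_def add_nonneg_pos)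
  have \<eta>L: "\<bar>L + e\<bar> * \<eta> \<le> \<epsilon> / 4"
  proof -
    define c where "c = \<bar>L + e\<bar>"
    have c: "c \<ge> 0" by (simp add: c_def)
    have "\<bar>L + e\<bar> * \<eta> \<le> (c + 1) * (\<epsilon> / (4 * (c + 1)))"
      using \<eta> c by (intro mult_mono) (auto simp: \<eta>_def c_def)
    also have "\<dots> = \<epsilon> / 4" using c by (simp add: field_simps)
    finally show ?thesis .
  qed
  have fine: "fine_at (\<lambda>u v. f v - f u \<le> (L + e) * (v - u)) t" if t: "t \<in> {a<..<b} - N" for t
  proof -
    obtain s where s: "s \<le> L" "(f has_real_derivative s) (at t)" using der[OF t] by blast
    obtain d where d: "d > 0" "\<And>y. y \<noteq> t \<Longrightarrow> dist y t < d \<Longrightarrow> dist ((f y - f t) / (y - t)) s < e"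
      using s(2)[unfolded has_field_derivative_iff LIM_def, rule_format, OF e(1)] by blast
    show ?thesis unfolding fine_at_def
    proof (intro allI impI)
      fix h :: real assume h: "h > 0"
      define v where "v = t + min h d / 2"
      have v: "t < v" "v - t < h" "dist v t < d" using h d(1) by (auto simp: v_def dist_real_def min_def)
      have "(f v - f t) / (v - t) \<le> L + e" using d(2)[of v] v s(1) by (auto simp: dist_real_def)
      then have "f v - f t \<le> (L + e) * (v - t)" using v(1) by (simp add: divide_le_eq)
      then show "\<exists>u v. u < v \<and> u \<le> t \<and> t \<le> v \<and> v - u < h \<and> f v - f u \<le> (L + e) * (v - u)"
        using v by (intro exI[of _ t] exI[of _ v]) auto
    qed
  qed
  have outer: "b - a \<le> measure lebesgue T" if T: "T \<in> lmeasurable" "negligible ({a<..<b} - N - T)" for T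
  proof -
    let ?T = "T \<union> (({a<..<b} - N - T) \<union> N)"
    have n: "negligible (({a<..<b} - N - T) \<union> N)" using T(2) N by (rule negligible_Un)
    have T': "?T \<in> lmeasurable" by (rule fmeasurable.Un[OF T(1) negligible_imp_measurable[OF n]])
    have "measure lebesgue {a<..<b} \<le> measure lebesgue ?T"
      using T' by (intro measure_mono_fmeasurable) auto
    also have "\<dots> = measure lebesgue T"
      using T(1) n by (intro measure_Un_null_set) (auto simp: negligible_iff_null_sets)
    finally show ?thesis using ab by simp
  qed
  have sub: "{a<..<b} \<subseteq> {a..b}" by auto
  obtain D where D: "D division_of \<Union>D" "\<Union>D \<subseteq> {a<..<b}" "sum ?len D > (b - a) - \<eta>"
      "\<And>K. K \<in> D \<Longrightarrow> \<exists>u v. u < v \<and> K = {u..v} \<and> f v - f u \<le> (L + e) * (v - u)"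
    using Vitali_fine[where P = "\<lambda>u v. f v - f u \<le> (L + e) * (v - u)",
        OF Diff_subset open_greaterThanLessThan sub fine outer \<eta>] by blast
  obtain G where G: "finite G" "D \<inter> G = {}" "(D \<union> G) division_of {a..b}"
    "\<And>f. sum (incr f) D + sum (incr f) G = f b - f a"
    using sum_incr_split[OF D(1) order_trans[OF D(2) sub] ab] by blast
  have divG: "G division_of \<Union>G"
    using division_of_subset[OF division_of_union_self[OF G(3)], of G] by simp
  have Gab: "\<Union>G \<subseteq> {a..b}" using division_ofD(6)[OF G(3)] by blast
  have lenG: "sum ?len G < \<eta>" using G(4)[of "\<lambda>x. x"] D(3) by simp
  have lenG0: "sum ?len G \<ge> 0"
    using measure_nonneg[of lebesgue "\<Union>G"] unfolding measure_division(1)[OF divG] .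
  have "sum (incr f) G \<le> (\<Sum>K\<in>G. \<bar>incr f K\<bar>)" by (intro sum_mono) simp
  also have "\<dots> < \<epsilon> / 2" using \<delta>(2)[OF divG Gab] lenG by (simp add: \<eta>_def)
  finally have fG: "sum (incr f) G < \<epsilon> / 2" .
  have "sum (incr f) D \<le> (\<Sum>K\<in>D. (L + e) * ?len K)"
    by (intro sum_mono) (use D(4) in fastforce)
  also have "\<dots> = (L + e) * sum ?len D" by (simp add: sum_distrib_left)
  also have "\<dots> = (L + e) * (b - a) - (L + e) * sum ?len G"
  proof -
    have "sum ?len D = (b - a) - sum ?len G" using G(4)[of "\<lambda>x. x"] by simp
    then show ?thesis by (simp only: right_diff_distrib)
  qed
  also have "\<dots> \<le> (L + e) * (b - a) + \<bar>L + e\<bar> * \<eta>"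
  proof -
    have "- ((L + e) * sum ?len G) \<le> \<bar>L + e\<bar> * sum ?len G"
      using mult_right_mono[OF abs_ge_minus_self[of "L + e"] lenG0] by (simp only: mult_minus_left)
    also have "\<dots> \<le> \<bar>L + e\<bar> * \<eta>" using lenG by (intro mult_left_mono) auto
    finally show ?thesis by simp
  qed
  also have "\<dots> \<le> L * (b - a) + \<epsilon> / 4 + \<epsilon> / 4" using \<eta>L e(2) by (simp add: algebra_simps)
  finally show "f b - f a \<le> L * (b - a) + \<epsilon>" using G(4)[of f] fG by simp
qed

section \<open>Multiply monotone functions on the half-line\<close>

lemma half_deriv_Suc: "half_deriv (Suc j) x t = vector_derivative (half_deriv j x) (at t within {..0})"
  by (simp add: half_deriv_def)

lemma at_within_atMost_interior: "t < 0 \<Longrightarrow> at t within {..0::real} = at t"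
  by (rule at_within_interior) simp

text \<open>
  Below the top order the derivatives exist everywhere, so the unspecified values of
  \<^const>\<open>half_deriv\<close> do not occur.
\<close>

lemma half_deriv_step:
  assumes "half_deriv j x differentiable_on {..0}" "t \<le> 0"
  shows "(half_deriv j x has_real_derivative half_deriv (Suc j) x t) (at t within {..0})"
  unfolding half_deriv_Suc has_real_derivative_iff_has_vector_derivative
  using assms by (intro vector_derivative_works[THEN iffD1]) (simp add: differentiable_on_def)

lemma AE_lebesgue_on_negligible:
  assumes "AE t in lebesgue_on {..0}. P t"
  shows "negligible {t::real. t \<le> 0 \<and> \<not> P t}"
proof -
  have "AE t in lebesgue. t \<in> {..0} \<longrightarrow> P t"
    using assms by (subst (asm) AE_restrict_space_iff) auto
  then obtain N where "N \<in> null_sets lebesgue" "{t \<in> space lebesgue. \<not> (t \<in> {..0} \<longrightarrow> P t)} \<subseteq> N"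
    unfolding eventually_ae_filter by blast
  moreover have "{t. t \<le> 0 \<and> \<not> P t} = {t \<in> space lebesgue. \<not> (t \<in> {..0} \<longrightarrow> P t)}" by simp
  ultimately show ?thesis
    using negligible_subset[of N] negligible_iff_null_sets by blast
qed

lemma abs_continuous_on_uminus:
  assumes "abs_continuous_on a b f" shows "abs_continuous_on a b (\<lambda>t. - f t)"
proof -
  have "\<bar>- x - (- y)\<bar> = \<bar>x - y\<bar>" for x y :: real by linarith
  then show ?thesis using assms unfolding abs_continuous_on_def by simp
qed

lemma Linf_norm_AE:
  assumes "f \<in> Linf" "Linf_norm f \<le> ereal L"
  shows "AE t in lebesgue_on {..0}. \<bar>f t\<bar> \<le> L"
proof -
  have "AE t in lebesgue_on {..0}. ereal \<bar>f t\<bar> \<le> Linf_norm f"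
    unfolding Linf_norm_def by (rule esssup_AE)
  then show ?thesis
  proof eventually_elim
    case (elim t)
    then have "ereal \<bar>f t\<bar> \<le> ereal L" using assms(2) by (rule order_trans)
    then show ?case by simp
  qed
qed

text \<open>
  The conditions on the derivative of order \<open>r\<close> hold only almost everywhere, and
  where the derivative does not exist they say nothing about \<open>x\<close>. Since the
  derivative of order \<open>r - 1\<close> is absolutely continuous, such points form a null set,
  and the bounds \<open>0\<close> and \<open>L\<close> for the derivative become bounds for all
  slopes.
\<close>

lemma L_monotone_slopes:
  assumes x: "x \<in> L_monotone r" and r: "r \<ge> 1" and L: "Linf_norm (half_deriv r x) \<le> ereal L"
    and uv: "u \<le> v" "v \<le> 0"
  shows "half_deriv (r - 1) x u \<le> half_deriv (r - 1) x v"
    and "half_deriv (r - 1) x v - half_deriv (r - 1) x u \<le> L * (v - u)"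
    and "negligible {t \<in> {u<..<v}. \<not> half_deriv (r - 1) x differentiable (at t)}"
proof -
  let ?F = "half_deriv (r - 1) x"
  have ac: "abs_continuous_on u v ?F"
    using x uv unfolding L_monotone_def L_space_def loc_abs_continuous_def by blast
  let ?N1 = "{t \<in> {u<..<v}. \<not> ?F differentiable (at t)}"
  show N1: "negligible ?N1" by (rule abs_continuous_on_differentiable_ae[OF ac uv(1)])
  let ?N2 = "{t. t \<le> 0 \<and> \<not> (\<bar>half_deriv r x t\<bar> \<le> L)}"
  let ?N3 = "{t. t \<le> 0 \<and> \<not> (half_deriv r x t \<ge> 0)}"
  have "half_deriv r x \<in> Linf" "AE t in lebesgue_on {..0}. half_deriv r x t \<ge> 0"
    using x by (auto simp: L_monotone_def L_space_def)
  then have N23: "negligible ?N2" "negligible ?N3"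
    using Linf_norm_AE[OF _ L] by (auto intro!: AE_lebesgue_on_negligible)
  define N where "N = ?N1 \<union> ?N2 \<union> ?N3"
  have N: "negligible N" unfolding N_def using N1 N23 by (intro negligible_Un)
  have der: "\<exists>s. 0 \<le> s \<and> s \<le> L \<and> (?F has_real_derivative s) (at t)" if t: "t \<in> {u<..<v} - N" for t
  proof -
    have t0: "t < 0" using t uv by auto
    have d: "?F differentiable (at t)" using t by (auto simp: N_def)
    have "half_deriv r x t = vector_derivative ?F (at t)"
      using half_deriv_Suc[of "r - 1" x t] r at_within_atMost_interior[OF t0] by simp
    moreover have "(?F has_vector_derivative vector_derivative ?F (at t)) (at t)"
      using d by (simp add: vector_derivative_works)
    ultimately have "(?F has_real_derivative half_deriv r x t) (at t)"
      by (simp add: has_real_derivative_iff_has_vector_derivative)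
    moreover have "0 \<le> half_deriv r x t" "half_deriv r x t \<le> L" using t t0 by (auto simp: N_def)
    ultimately show ?thesis by blast
  qed
  have "\<exists>s\<le>0. ((\<lambda>t. - ?F t) has_real_derivative s) (at t)" if t: "t \<in> {u<..<v} - N" for t
  proof -
    obtain s where s: "0 \<le> s" "(?F has_real_derivative s) (at t)" using der[OF t] by blast
    then show ?thesis by (intro exI[of _ "- s"]) (auto intro: DERIV_minus)
  qed
  from abs_continuous_on_increment_le[OF abs_continuous_on_uminus[OF ac] uv(1) N this]
  show "?F u \<le> ?F v" by simp
  have "\<exists>s\<le>L. (?F has_real_derivative s) (at t)" if t: "t \<in> {u<..<v} - N" for t
    using der[OF t] by blast
  from abs_continuous_on_increment_le[OF ac uv(1) N this]
  show "?F v - ?F u \<le> L * (v - u)" .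
qed

lemma L_monotone_top_norm_finite:
  assumes "x \<in> L_monotone r"
  obtains L where "Linf_norm (half_deriv r x) < ereal L"
proof -
  have "Linf_norm (half_deriv r x) < \<infinity>" using assms by (auto simp: L_monotone_def L_space_def Linf_def)
  then show ?thesis by (metis ereal_dense2 that)
qed

lemma L_monotone_mono:
  assumes x: "x \<in> L_monotone r" and r: "r \<ge> 1" and j: "j < r" and uv: "u \<le> v" "v \<le> 0"
  shows "half_deriv j x u \<le> half_deriv j x v"
proof (cases "j = r - 1")
  case True
  obtain L where "Linf_norm (half_deriv r x) < ereal L"
    by (rule L_monotone_top_norm_finite[OF x])
  from L_monotone_slopes(1)[OF x r less_imp_le[OF this] uv] show ?thesis using True by simp
next
  case False
  then have d: "half_deriv j x differentiable_on {..0}"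
    using x j by (auto simp: L_monotone_def L_space_def)
  show ?thesis
  proof (rule DERIV_nonneg_imp_increasing_open[OF uv(1)])
    fix t assume t: "u < t" "t < v"
    have "half_deriv (Suc j) x t \<ge> 0" using x t uv j False by (auto simp: L_monotone_def)
    then show "\<exists>y. (half_deriv j x has_real_derivative y) (at t) \<and> 0 \<le> y"
      using half_deriv_step[OF d, of t] t uv at_within_atMost_interior[of t] by auto
  next
    show "continuous_on {u..v} (half_deriv j x)"
      using differentiable_imp_continuous_on[OF d] by (rule continuous_on_subset) (use uv in auto)
  qed
qed

lemma L_monotone_continuous:
  assumes x: "x \<in> L_monotone r" and r: "r \<ge> 1" and j: "j < r"
  shows "continuous_on {..0} (half_deriv j x)"
proof (cases "j = r - 1")
  case True
  obtain L where "Linf_norm (half_deriv r x) < ereal L"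
    by (rule L_monotone_top_norm_finite[OF x])
  note L = less_imp_le[OF this]
  have *: "\<bar>half_deriv j x v - half_deriv j x u\<bar> \<le> \<bar>L\<bar> * (v - u)" if "u \<le> v" "v \<le> 0" for u v
  proof -
    have "L * (v - u) \<le> \<bar>L\<bar> * (v - u)" using that by (intro mult_right_mono) auto
    then show ?thesis using L_monotone_slopes(1,2)[OF x r L that] True by simp
  qed
  have "\<bar>L\<bar>-lipschitz_on {..0} (half_deriv j x)"
  proof (rule lipschitz_onI)
    fix u v :: real assume "u \<in> {..0}" "v \<in> {..0}"
    then show "dist (half_deriv j x u) (half_deriv j x v) \<le> \<bar>L\<bar> * dist u v"
      using *[of u v] *[of v u] by (cases "u \<le> v") (auto simp: dist_real_def abs_minus_commute)
  qed simp
  then show ?thesis by (rule lipschitz_on_continuous_on)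
next
  case False
  then have d: "half_deriv j x differentiable_on {..0}"
    using x j by (auto simp: L_monotone_def L_space_def)
  then show ?thesis by (rule differentiable_imp_continuous_on)
qed

lemma Linf_norm_monotone:
  assumes cont: "continuous_on {..0} f" and mono: "\<And>u v. u \<le> v \<Longrightarrow> v \<le> 0 \<Longrightarrow> f u \<le> f v"
    and nonneg: "\<And>t. t \<le> 0 \<Longrightarrow> 0 \<le> f t"
  shows "Linf_norm f = ereal (f 0)"
proof (rule antisym)
  have "f \<in> borel_measurable (lebesgue_on {..0})"
    by (rule continuous_imp_measurable_on_sets_lebesgue[OF cont]) auto
  then have m: "(\<lambda>t. ereal \<bar>f t\<bar>) \<in> borel_measurable (lebesgue_on {..0})" by simp
  have "AE t in lebesgue_on {..0}. ereal \<bar>f t\<bar> \<le> ereal (f 0)"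
    by (rule AE_I2) (use mono nonneg in auto)
  then show "Linf_norm f \<le> ereal (f 0)" unfolding Linf_norm_def by (rule esssup_I[OF m])
  show "ereal (f 0) \<le> Linf_norm f"
  proof (rule ccontr)
    assume "\<not> ?thesis"
    then have "Linf_norm f < ereal (f 0)" by (simp only: not_le)
    from ereal_dense2[OF this] obtain c where c: "Linf_norm f < ereal c" "c < f 0" by auto
    have "AE t in lebesgue_on {..0}. ereal \<bar>f t\<bar> \<le> Linf_norm f"
      unfolding Linf_norm_def by (rule esssup_AE)
    then have "AE t in lebesgue_on {..0}. f t \<le> c"
    proof eventually_elim
      case (elim t)
      then have "ereal \<bar>f t\<bar> < ereal c" using c(1) by (rule le_less_trans)
      then show ?case by simp
    qed
    from AE_lebesgue_on_negligible[OF this] have neg: "negligible {t. t \<le> 0 \<and> \<not> f t \<le> c}" .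
    have "isCont (\<lambda>t. f (min 0 t)) 0"
    proof -
      have "continuous_on UNIV (\<lambda>t. f (min 0 t))"
        by (rule continuous_on_compose2[OF cont]) (auto intro!: continuous_intros)
      then show ?thesis by (simp add: continuous_on_eq_continuous_at)
    qed
    then have "\<forall>\<^sub>F t in at 0. c < f (min 0 t)"
      using c(2) by (intro order_tendstoD(1)) (auto simp: isCont_def)
    then obtain d where d: "d > 0" "\<And>t. t \<noteq> 0 \<Longrightarrow> dist t 0 < d \<Longrightarrow> c < f (min 0 t)"
      unfolding eventually_at by blast
    have "{-d<..<0} \<subseteq> {t. t \<le> 0 \<and> \<not> f t \<le> c}"
    proof
      fix t assume t: "t \<in> {-d<..<0}"
      then have "c < f (min 0 t)" by (intro d(2)) (auto simp: dist_real_def)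
      then show "t \<in> {t. t \<le> 0 \<and> \<not> f t \<le> c}" using t by (simp add: not_le)
    qed
    then have "negligible {-d<..<0}" using neg negligible_subset by blast
    moreover have "\<not> negligible {-d<..<0}" using d(1) by (intro open_not_negligible) auto
    ultimately show False by simp
  qed
qed

lemma L_monotone_norm:
  assumes x: "x \<in> L_monotone r" and r: "r \<ge> 1" and j: "j < r"
  shows "Linf_norm (half_deriv j x) = ereal (half_deriv j x 0)"
  by (rule Linf_norm_monotone[OF L_monotone_continuous[OF x r j] L_monotone_mono[OF x r j]])
     (use x j in \<open>auto simp: L_monotone_def\<close>)

text \<open>
  A nonnegative nondecreasing derivative that does not tend to zero at \<open>-\<infinity>\<close>
  would make the derivative of one order less, which is nonnegative and nondecreasing as well,
  tend to \<open>-\<infinity>\<close>. The mean value theorem gives the explicit bound \<open>C /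
  u\<close>. This is false for \<open>j = 0\<close>, where \<open>x\<close> may tend to a positive
  constant.
\<close>

lemma L_monotone_tendsto_0:
  assumes x: "x \<in> L_monotone r" and r: "r \<ge> 1" and j: "1 \<le> j" "j < r"
  shows "((\<lambda>u. half_deriv j x (- u)) \<longlongrightarrow> 0) at_top"
proof -
  let ?C = "half_deriv (j - 1) x 0"
  have d: "half_deriv (j - 1) x differentiable_on {..0}"
    using x j by (auto simp: L_monotone_def L_space_def)
  have nn: "half_deriv i x t \<ge> 0" if "i < r" "t \<le> 0" for i t using x that by (auto simp: L_monotone_def)
  have le: "half_deriv j x (- u) \<le> ?C / u" if u: "u > 0" for u
  proof -
    have "\<exists>z\<in>{- u<..<0}. half_deriv (j - 1) x 0 - half_deriv (j - 1) x (- u) = half_deriv j x z * (0 - (- u))"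
    proof (rule mvt_simple)
      show "- u < 0" using u by simp
    next
      fix t assume "- u \<le> t" "t \<le> 0"
      then show "(half_deriv (j - 1) x has_derivative (*) (half_deriv j x t)) (at t within {- u..0})"
        using half_deriv_step[OF d, of t] j unfolding has_field_derivative_def
        by (auto intro: has_derivative_subset)
    qed
    then obtain z where z: "- u < z" "z < 0"
      "half_deriv (j - 1) x 0 - half_deriv (j - 1) x (- u) = u * half_deriv j x z" by auto
    have "u * half_deriv j x (- u) \<le> u * half_deriv j x z"
      using L_monotone_mono[OF x r j(2), of "- u" z] z u by (intro mult_left_mono) auto
    also have "\<dots> \<le> ?C" using z(3) nn[of "j - 1" "- u"] j u by (simp add: less_imp_diff_less)
    finally show ?thesis using u by (simp add: field_simps)
  qed
  show ?thesis
  proof (rule tendsto_sandwich)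
    show "\<forall>\<^sub>F u in at_top. 0 \<le> half_deriv j x (- u)"
      using eventually_ge_at_top[of 0] by eventually_elim (use nn j in auto)
    show "\<forall>\<^sub>F u in at_top. half_deriv j x (- u) \<le> ?C / u"
      using eventually_gt_at_top[of 0] by eventually_elim (use le in auto)
    show "((\<lambda>u. ?C / u) \<longlongrightarrow> 0) at_top"
      by (rule tendsto_divide_0[OF tendsto_const filterlim_at_top_imp_at_infinity[OF filterlim_ident]])
  qed simp
qed

section \<open>Derivatives at zero as moments of a bounded density\<close>

text \<open>
  The densities live on \<open>[0, \<infinity>)\<close>, the reflection of the half-line; they are
  extended by zero so that integrals can be taken over the whole line.
\<close>

definition bounded_density :: "real \<Rightarrow> (real \<Rightarrow> real) \<Rightarrow> bool" where
  "bounded_density L h \<longleftrightarrow> h \<in> borel_measurable borel \<and> (\<forall>u. 0 \<le> h u \<and> h u \<le> L) \<and> (\<forall>u<0. h u = 0)"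

text \<open>
  The density is minus the almost everywhere derivative of \<open>G\<close>. The difference
  quotients of \<open>G\<close> lie between \<open>0\<close> and \<open>L\<close>, so dominated
  convergence applies to them, and their integrals over \<open>[v, w]\<close> are difference
  quotients of a primitive of \<open>G\<close>, which converge to \<open>G v - G w\<close>.
\<close>

lemma lipschitz_antimono_derivative:
  fixes G :: "real \<Rightarrow> real"
  assumes mono: "\<And>v w. 0 \<le> v \<Longrightarrow> v \<le> w \<Longrightarrow> G w \<le> G v"
    and lip: "\<And>v w. 0 \<le> v \<Longrightarrow> v \<le> w \<Longrightarrow> G v - G w \<le> L * (w - v)"
    and ae: "negligible {u. 0 < u \<and> \<not> G differentiable (at u)}"
  obtains h where "bounded_density L h"
    "\<And>v w. 0 \<le> v \<Longrightarrow> v \<le> w \<Longrightarrow> (\<integral>\<^sup>+u. ennreal (h u) * indicator {v..w} u \<partial>lborel) = ennreal (G v - G w)"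
proof -
  have L: "L \<ge> 0" using mono[of 0 1] lip[of 0 1] by simp
  define G' where "G' u = G (max 0 u)" for u
  have mono': "G' w \<le> G' v" if "v \<le> w" for v w
    using mono[of "max 0 v" "max 0 w"] that by (auto simp: G'_def max_def)
  have lip': "G' v - G' w \<le> L * (w - v)" if "v \<le> w" for v w
  proof -
    have "G' v - G' w \<le> L * (max 0 w - max 0 v)"
      using lip[of "max 0 v" "max 0 w"] that by (auto simp: G'_def max_def)
    also have "\<dots> \<le> L * (w - v)" using L that by (intro mult_left_mono) auto
    finally show ?thesis .
  qed
  have "L-lipschitz_on UNIV G'"
  proof (rule lipschitz_onI)
    fix v w :: real
    show "dist (G' v) (G' w) \<le> L * dist v w"
      using mono'[of v w] lip'[of v w] mono'[of w v] lip'[of w v]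
      by (cases "v \<le> w") (auto simp: dist_real_def abs_minus_commute)
  qed (use L in auto)
  then have contG: "continuous_on UNIV G'" by (rule lipschitz_on_continuous_on)
  then have [measurable]: "G' \<in> borel_measurable borel" by (rule borel_measurable_continuous_onI)
  define e where "e n = 1 / real (Suc n)" for n
  have e: "e n > 0" "e n \<le> 1" for n by (auto simp: e_def)
  have e0: "filterlim e (at 0) sequentially"
  proof (rule filterlim_atI)
    show "e \<longlonglongrightarrow> 0" unfolding e_def using LIMSEQ_inverse_real_of_nat by (simp add: inverse_eq_divide)
    show "\<forall>\<^sub>F n in sequentially. e n \<noteq> 0" using e(1) by (auto simp: less_imp_neq[symmetric])
  qed
  define g where "g n u = (G' u - G' (u + e n)) / e n" for n u
  have g: "0 \<le> g n u" "g n u \<le> L" for n u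
    using mono'[of u "u + e n"] lip'[of u "u + e n"] e(1)[of n] by (auto simp: g_def field_simps)
  have [measurable]: "g n \<in> borel_measurable borel" for n unfolding g_def by measurable
  \<comment> \<open>Clamping the limit makes the bounds hold everywhere, also where the quotients
      diverge.\<close>
  define h where "h u = indicator {0..} u * max 0 (min L (lim (\<lambda>n. g n u)))" for u
  have [measurable]: "h \<in> borel_measurable borel" unfolding h_def by measurable
  have h: "bounded_density L h" using L by (auto simp: bounded_density_def h_def indicator_def)
  have conv: "(\<lambda>n. g n u) \<longlonglongrightarrow> h u" if u: "0 < u" "G differentiable (at u)" for u
  proof -
    obtain D where "(G has_real_derivative D) (at u)" using u(2) real_differentiable_def by blast
    moreover have "\<forall>\<^sub>F t in nhds u. G t = G' t"
    proof -
      have "\<forall>\<^sub>F t in nhds u. t \<in> {0<..}" using u(1) by (intro eventually_nhds_in_open) auto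
      then show ?thesis by eventually_elim (auto simp: G'_def)
    qed
    ultimately have "(G' has_real_derivative D) (at u)" using DERIV_cong_ev[OF refl _ refl] by blast
    then have "(\<lambda>h. (G' (u + h) - G' u) / h) \<midarrow>0\<rightarrow> D" by (simp add: DERIV_def)
    from filterlim_compose[OF this e0] have "(\<lambda>n. - ((G' (u + e n) - G' u) / e n)) \<longlonglongrightarrow> - D"
      by (intro tendsto_minus)
    moreover have "g n u = - ((G' (u + e n) - G' u) / e n)" for n
      unfolding g_def by (metis minus_diff_eq minus_divide_left)
    ultimately have gD: "(\<lambda>n. g n u) \<longlonglongrightarrow> - D" by simp
    have "0 \<le> - D" using g by (intro LIMSEQ_le_const[OF gD]) auto
    moreover have "- D \<le> L" using g by (intro LIMSEQ_le_const2[OF gD]) auto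
    ultimately have "h u = - D" using limI[OF gD] u(1) by (simp add: h_def)
    then show ?thesis using gD by simp
  qed
  have AEc: "AE u in lborel. 0 < u \<longrightarrow> (\<lambda>n. g n u) \<longlonglongrightarrow> h u"
  proof -
    have "AE u in lebesgue. \<not> (0 < u \<and> \<not> G differentiable (at u))"
      using ae AE_not_in[of "{u. 0 < u \<and> \<not> G differentiable (at u)}" lebesgue] by (simp add: negligible_iff_null_sets)
    then have "AE u in lborel. \<not> (0 < u \<and> \<not> G differentiable (at u))"
      unfolding AE_completion_iff .
    then show ?thesis by eventually_elim (use conv in blast)
  qed
  have int: "(\<integral>u. h u * indicator {v..w} u \<partial>lborel) = G v - G w" and intb: "integrable lborel (\<lambda>u. h u * indicator {v..w} u)"
    if vw: "0 \<le> v" "v \<le> w" for v w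
  proof -
    define K where "K s = integral {-1..s} G'" for s
    have K: "(K has_real_derivative G' u) (at u)" if "-1 < u" "u < w + 2" for u
    proof -
      have "(K has_vector_derivative G' u) (at u within {-1..w+2})"
        unfolding K_def using that by (intro integral_has_vector_derivative continuous_on_subset[OF contG]) auto
      moreover have "at u within {-1..w+2} = at u" by (rule at_within_interior) (use that in auto)
      ultimately show ?thesis by (simp add: has_real_derivative_iff_has_vector_derivative)
    qed
    have In: "(\<integral>u. g n u * indicator {v..w} u \<partial>lborel) = (K (v + e n) - K v) / e n - (K (w + e n) - K w) / e n" for n
    proof -
      have "(\<integral>u. g n u * indicator {v..w} u \<partial>lborel) = (K w - K (w + e n)) / e n - (K v - K (v + e n)) / e n"
      proof (rule integral_FTC_Icc_real[OF vw(2)])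
        fix u assume u: "v \<le> u" "u \<le> w"
        show "((\<lambda>u. (K u - K (u + e n)) / e n) has_real_derivative g n u) (at u)"
          unfolding g_def
        proof (intro DERIV_cdivide DERIV_diff)
          show "(K has_real_derivative G' u) (at u)" using u vw by (intro K) auto
          have "(K has_real_derivative G' (u + e n)) (at (u + e n))"
            using u vw e[of n] by (intro K) auto
          then show "((\<lambda>u. K (u + e n)) has_real_derivative G' (u + e n)) (at u)"
            by (simp add: DERIV_shift)
        qed
        have "continuous_on UNIV (g n)" unfolding g_def
          using e(1)[of n] by (intro continuous_intros continuous_on_compose2[OF contG]) auto
        then show "isCont (g n) u" by (simp add: continuous_on_eq_continuous_at)
      qed
      then show ?thesis by (simp add: diff_divide_distrib)
    qed
    have dq: "(\<lambda>n. (K (s + e n) - K s) / e n) \<longlonglongrightarrow> G' s" if "-1 < s" "s < w + 2" for s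
      using filterlim_compose[OF _ e0, of "\<lambda>h. (K (s + h) - K s) / h"] K[OF that] by (simp add: DERIV_def)
    have "(\<lambda>n. (K (v + e n) - K v) / e n - (K (w + e n) - K w) / e n) \<longlonglongrightarrow> G' v - G' w"
      using vw by (intro tendsto_diff dq) auto
    then have lim1: "(\<lambda>n. \<integral>u. g n u * indicator {v..w} u \<partial>lborel) \<longlonglongrightarrow> G' v - G' w" by (simp add: In)
    have "AE u in lborel. (\<lambda>n. g n u * indicator {v..w} u) \<longlonglongrightarrow> h u * indicator {v..w} u"
      using AEc AE_lborel_singleton[of 0]
    proof eventually_elim
      case (elim u)
      then show ?case using vw by (cases "u > 0") (auto intro: tendsto_mult simp: indicator_def)
    qed
    note c1 = this
    have c2: "integrable lborel (\<lambda>u. L * indicator {v..w} u)"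
      by (intro integrable_mult_right integrable_real_indicator) (auto simp: emeasure_lborel_Icc_eq)
    have c3: "AE u in lborel. norm (g n u * indicator {v..w} u) \<le> L * indicator {v..w} u" for n
      by (rule AE_I2) (use g in \<open>auto simp: indicator_def\<close>)
    have m: "(\<lambda>u. h u * indicator {v..w} u) \<in> borel_measurable lborel"
      "\<And>n. (\<lambda>u. g n u * indicator {v..w} u) \<in> borel_measurable lborel" by measurable
    have "(\<lambda>n. \<integral>u. g n u * indicator {v..w} u \<partial>lborel) \<longlonglongrightarrow> (\<integral>u. h u * indicator {v..w} u \<partial>lborel)"
      by (rule integral_dominated_convergence[OF m c2 c1 c3])
    moreover have "integrable lborel (\<lambda>u. h u * indicator {v..w} u)"
      by (rule integrable_dominated_convergence[OF m c2 c1 c3])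
    ultimately show "(\<integral>u. h u * indicator {v..w} u \<partial>lborel) = G v - G w" "integrable lborel (\<lambda>u. h u * indicator {v..w} u)"
      using LIMSEQ_unique[OF lim1] vw by (auto simp: G'_def)
  qed
  show ?thesis
  proof (rule that[OF h])
    fix v w :: real assume vw: "0 \<le> v" "v \<le> w"
    have "(\<integral>\<^sup>+u. ennreal (h u * indicator {v..w} u) \<partial>lborel) = ennreal (G v - G w)"
      using nn_integral_eq_integral[OF intb[OF vw]] int[OF vw] h by (simp add: bounded_density_def)
    moreover have "ennreal (h u * indicator {v..w} u) = ennreal (h u) * indicator {v..w} u" for u
      by (simp add: indicator_def)
    ultimately show "(\<integral>\<^sup>+u. ennreal (h u) * indicator {v..w} u \<partial>lborel) = ennreal (G v - G w)" by simp
  qed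
qed

lemma nn_integral_Icc_to_atLeast:
  fixes f :: "real \<Rightarrow> real"
  assumes [measurable]: "f \<in> borel_measurable borel"
    and A: "\<And>w. v \<le> w \<Longrightarrow> (\<integral>\<^sup>+u. ennreal (f u) * indicator {v..w} u \<partial>lborel) = ennreal (A - B w)"
    and B: "(B \<longlongrightarrow> c) at_top"
  shows "(\<integral>\<^sup>+u. (if v \<le> u then ennreal (f u) else 0) \<partial>lborel) = ennreal (A - c)"
proof -
  have "(\<lambda>n. \<integral>\<^sup>+u. ennreal (f u) * indicator {v..v + real n} u \<partial>lborel) \<longlonglongrightarrow>
      (\<integral>\<^sup>+u. (if v \<le> u then ennreal (f u) else 0) \<partial>lborel)"
  proof (rule nn_integral_LIMSEQ)
    show "incseq (\<lambda>n u. ennreal (f u) * indicator {v..v + real n} u)"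
      by (auto simp: incseq_def le_fun_def indicator_def)
    fix u
    obtain N :: nat where N: "u - v \<le> real N" using real_arch_simple by blast
    have "\<forall>\<^sub>F n in sequentially. ennreal (f u) * indicator {v..v + real n} u = (if v \<le> u then ennreal (f u) else 0)"
      using eventually_ge_at_top[of N] by eventually_elim (use N in \<open>auto simp: indicator_def\<close>)
    then show "(\<lambda>n. ennreal (f u) * indicator {v..v + real n} u) \<longlonglongrightarrow> (if v \<le> u then ennreal (f u) else 0)"
      by (rule tendsto_eventually)
  qed measurable
  moreover have "(\<lambda>n. \<integral>\<^sup>+u. ennreal (f u) * indicator {v..v + real n} u \<partial>lborel) \<longlonglongrightarrow> ennreal (A - c)"
  proof -
    have "filterlim (\<lambda>n. v + real n) at_top sequentially"
      by (intro filterlim_tendsto_add_at_top[OF tendsto_const] filterlim_real_sequentially)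
    from filterlim_compose[OF B this] have "(\<lambda>n. ennreal (A - B (v + real n))) \<longlonglongrightarrow> ennreal (A - c)"
      by (intro tendsto_ennrealI tendsto_diff tendsto_const)
    then show ?thesis by (simp add: A)
  qed
  ultimately show ?thesis by (rule LIMSEQ_unique)
qed

text \<open>
  One more integration raises the order of the kernel by one; this is Tonelli's theorem.
\<close>

lemma iterated_nn_integral_power:
  fixes h :: "real \<Rightarrow> real"
  assumes [measurable]: "h \<in> borel_measurable borel" and h: "\<And>u. h u \<ge> 0"
  shows "(\<integral>\<^sup>+w. (if v \<le> w then (\<integral>\<^sup>+u. (if w \<le> u then ennreal ((u - w) ^ n / fact n * h u) else 0) \<partial>lborel) else 0) \<partial>lborel)
    = (\<integral>\<^sup>+u. (if v \<le> u then ennreal ((u - v) ^ Suc n / fact (Suc n) * h u) else 0) \<partial>lborel)"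
proof -
  let ?f = "\<lambda>w u. if v \<le> w \<and> w \<le> u then ennreal ((u - w) ^ n / fact n * h u) else 0"
  have "(\<integral>\<^sup>+w. (if v \<le> w then (\<integral>\<^sup>+u. (if w \<le> u then ennreal ((u - w) ^ n / fact n * h u) else 0) \<partial>lborel) else 0) \<partial>lborel)
    = (\<integral>\<^sup>+w. (\<integral>\<^sup>+u. ?f w u \<partial>lborel) \<partial>lborel)"
    by (intro nn_integral_cong) auto
  also have "\<dots> = (\<integral>\<^sup>+u. (\<integral>\<^sup>+w. ?f w u \<partial>lborel) \<partial>lborel)"
    by (intro lborel_pair.Fubini'[symmetric]) measurable
  also have "\<dots> = (\<integral>\<^sup>+u. (if v \<le> u then ennreal ((u - v) ^ Suc n / fact (Suc n) * h u) else 0) \<partial>lborel)"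
  proof (intro nn_integral_cong)
    fix u
    show "(\<integral>\<^sup>+w. ?f w u \<partial>lborel) = (if v \<le> u then ennreal ((u - v) ^ Suc n / fact (Suc n) * h u) else 0)"
    proof (cases "v \<le> u")
      case True
      have "(\<integral>\<^sup>+w. ?f w u \<partial>lborel) = (\<integral>\<^sup>+w. ennreal ((u - w) ^ n / fact n * h u) * indicator {v..u} w \<partial>lborel)"
        by (intro nn_integral_cong) (auto simp: indicator_def)
      also have "\<dots> = ennreal ((- ((u - u) ^ Suc n / fact (Suc n)) * h u) - (- ((u - v) ^ Suc n / fact (Suc n)) * h u))"
      proof (rule nn_integral_FTC_Icc)
        fix w assume w: "w \<in> {v..u}"
        have "((\<lambda>w. (u - w) ^ Suc n) has_real_derivative real (Suc n) * ((0 - 1) * (u - w) ^ (Suc n - Suc 0)))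
            (at w)"
          by (intro DERIV_power DERIV_diff DERIV_const DERIV_ident)
        from DERIV_cmult_right[OF DERIV_minus[OF DERIV_cdivide[OF this, of "fact (Suc n)"]], of "h u"]
        have "((\<lambda>w. - ((u - w) ^ Suc n / fact (Suc n)) * h u) has_real_derivative
            - (real (Suc n) * ((0 - 1) * (u - w) ^ (Suc n - Suc 0)) / fact (Suc n)) * h u) (at w)" .
        moreover have "- (real (Suc n) * ((0 - 1) * (u - w) ^ (Suc n - Suc 0)) / fact (Suc n)) * h u = (u - w) ^ n / fact n * h u"
          by (simp add: fact_Suc del: of_nat_Suc)
        ultimately show "((\<lambda>w. - ((u - w) ^ Suc n / fact (Suc n)) * h u) has_real_derivative
            (u - w) ^ n / fact n * h u) (at w)" by simp
        show "0 \<le> (u - w) ^ n / fact n * h u" using w h by simp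
      qed (use True in auto)
      finally show ?thesis using True by simp
    next
      case False
      then have "?f w u = 0" for w by auto
      then show ?thesis using False by simp
    qed
  qed
  finally show ?thesis .
qed

lemma L_monotone_integral_step:
  assumes x: "x \<in> L_monotone r" and r: "r \<ge> 1" and j: "1 \<le> j" "j < r" and v: "v \<ge> 0"
    and c: "((\<lambda>w. half_deriv (j - 1) x (- w)) \<longlongrightarrow> c) at_top"
  shows "(\<integral>\<^sup>+w. (if v \<le> w then ennreal (half_deriv j x (- w)) else 0) \<partial>lborel)
    = ennreal (half_deriv (j - 1) x (- v) - c)"
proof -
  let ?f = "\<lambda>w. half_deriv j x (- max 0 w)"
  have d: "half_deriv (j - 1) x differentiable_on {..0}"
    using x j by (auto simp: L_monotone_def L_space_def)
  have "continuous_on UNIV ?f"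
    by (rule continuous_on_compose2[OF L_monotone_continuous[OF x r j(2)]]) (auto intro!: continuous_intros)
  then have meas: "?f \<in> borel_measurable borel" by (rule borel_measurable_continuous_onI)
  have nn: "?f w \<ge> 0" for w using x j by (auto simp: L_monotone_def)
  have "(\<integral>\<^sup>+u. ennreal (?f u) * indicator {v..w} u \<partial>lborel)
      = ennreal (half_deriv (j - 1) x (- v) - half_deriv (j - 1) x (- w))" if vw: "v \<le> w" for w
  proof -
    have "(?f has_integral (- half_deriv (j - 1) x (- w) - (- half_deriv (j - 1) x (- v)))) {v..w}"
    proof (rule fundamental_theorem_of_calculus[OF vw])
      fix s assume s: "s \<in> {v..w}"
      have "(half_deriv (j - 1) x has_real_derivative half_deriv j x (- s)) (at (- s) within {..0})"
        using half_deriv_step[OF d, of "- s"] j s v by auto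
      then have "(half_deriv (j - 1) x has_vector_derivative half_deriv j x (- s)) (at (- s) within uminus ` {v..w})"
        unfolding has_real_derivative_iff_has_vector_derivative
        by (rule has_vector_derivative_within_subset) (use v in auto)
      moreover have "(uminus has_vector_derivative -1) (at s within {v..w})"
        by (auto intro!: derivative_eq_intros)
      ultimately have "((half_deriv (j - 1) x \<circ> uminus) has_vector_derivative (-1) *\<^sub>R half_deriv j x (- s)) (at s within {v..w})"
        by (intro vector_diff_chain_within) auto
      from has_vector_derivative_minus[OF this]
      show "((\<lambda>s. - half_deriv (j - 1) x (- s)) has_vector_derivative ?f s) (at s within {v..w})"
        using s v by (simp add: o_def)
    qed
    from nn_integral_has_integral_lebesgue[OF nn this]
    have "(\<integral>\<^sup>+u. ennreal (indicator {v..w} u * ?f u) \<partial>lborel) = ennreal (half_deriv (j - 1) x (- v) - half_deriv (j - 1) x (- w))"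
      by simp
    moreover have "ennreal (indicator {v..w} u * ?f u) = ennreal (?f u) * indicator {v..w} u" for u
      by (simp add: indicator_def)
    ultimately show ?thesis by simp
  qed
  from nn_integral_Icc_to_atLeast[OF meas this c]
  have "(\<integral>\<^sup>+u. (if v \<le> u then ennreal (?f u) else 0) \<partial>lborel) = ennreal (half_deriv (j - 1) x (- v) - c)" .
  moreover have "(\<integral>\<^sup>+u. (if v \<le> u then ennreal (?f u) else 0) \<partial>lborel)
      = (\<integral>\<^sup>+w. (if v \<le> w then ennreal (half_deriv j x (- w)) else 0) \<partial>lborel)"
    using v by (intro nn_integral_cong) auto
  ultimately show ?thesis by simp
qed

text \<open>
  Taylor's formula with base point \<open>-\<infinity>\<close>, where all derivatives of positive
  order vanish. Going from the order \<open>r - 1\<close> downwards each derivative is the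
  integral of the next one. Stating it with integrals of nonnegative functions removes every
  question of convergence.
\<close>

lemma L_monotone_tail_integral:
  assumes x: "x \<in> L_monotone r" and r: "r \<ge> 2" and h: "bounded_density L h"
    and base: "\<And>v w. 0 \<le> v \<Longrightarrow> v \<le> w \<Longrightarrow> (\<integral>\<^sup>+u. ennreal (h u) * indicator {v..w} u \<partial>lborel)
       = ennreal (half_deriv (r - 1) x (- v) - half_deriv (r - 1) x (- w))"
  shows "n \<le> r - 2 \<Longrightarrow> v \<ge> 0 \<Longrightarrow>
    (\<integral>\<^sup>+u. (if v \<le> u then ennreal ((u - v) ^ n / fact n * h u) else 0) \<partial>lborel)
      = ennreal (half_deriv (r - 1 - n) x (- v))"
proof (induction n arbitrary: v)
  case 0
  have "(\<integral>\<^sup>+u. (if v \<le> u then ennreal (h u) else 0) \<partial>lborel) = ennreal (half_deriv (r - 1) x (- v) - 0)"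
    using h r by (intro nn_integral_Icc_to_atLeast[OF _ base[OF 0(2)] L_monotone_tendsto_0[OF x]])
      (auto simp: bounded_density_def)
  then show ?case by (simp cong: if_cong)
next
  case (Suc n)
  have hm: "h \<in> borel_measurable borel" "\<And>u. 0 \<le> h u" using h by (auto simp: bounded_density_def)
  have "(\<integral>\<^sup>+u. (if v \<le> u then ennreal ((u - v) ^ Suc n / fact (Suc n) * h u) else 0) \<partial>lborel)
    = (\<integral>\<^sup>+w. (if v \<le> w then ennreal (half_deriv (r - 1 - n) x (- w)) else 0) \<partial>lborel)"
    unfolding iterated_nn_integral_power[OF hm, symmetric]
    using Suc by (intro nn_integral_cong) auto
  also have "\<dots> = ennreal (half_deriv (r - 1 - n - 1) x (- v) - 0)"
    using Suc.prems r by (intro L_monotone_integral_step[OF x] L_monotone_tendsto_0[OF x]) auto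
  finally show ?case by simp
qed

text \<open>
  Only densities that vanish on the negative half-line occur, so these are moments over \<open>[0,
  \<infinity>)\<close>.
\<close>

abbreviation moment :: "(real \<Rightarrow> real) \<Rightarrow> nat \<Rightarrow> real" where
  "moment g i \<equiv> (\<integral>u. u ^ i * g u \<partial>lborel)"

text \<open>
  This turns the class of functions into a class of bounded densities. For \<open>j = 0\<close>
  the two sides differ by the limit of \<open>x\<close> at \<open>-\<infinity>\<close>, a
  nonnegative constant that no derivative sees.
\<close>

theorem L_monotone_moments:
  assumes x: "x \<in> L_monotone r" and r: "r \<ge> 2" and L: "Linf_norm (half_deriv r x) \<le> ereal L"
  obtains h where "bounded_density L h"
    "\<And>j. j < r \<Longrightarrow> integrable lborel (\<lambda>u. u ^ (r - 1 - j) * h u)"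
    "\<And>j. j < r \<Longrightarrow> moment h (r - 1 - j) \<le> fact (r - 1 - j) * half_deriv j x 0"
    "\<And>j. 1 \<le> j \<Longrightarrow> j < r \<Longrightarrow> moment h (r - 1 - j) = fact (r - 1 - j) * half_deriv j x 0"
proof -
  let ?F = "half_deriv (r - 1) x"
  let ?G = "\<lambda>u. ?F (- u)"
  have r1: "r \<ge> 1" using r by simp
  have N: "negligible {u. 0 < u \<and> \<not> ?G differentiable (at u)}"
  proof -
    have "negligible (uminus ` {t \<in> {- real n<..<0}. \<not> ?F differentiable (at t)})" for n
      using L_monotone_slopes(3)[OF x r1 L, of "- real n" 0]
      by (intro negligible_differentiable_image_negligible) (auto intro!: derivative_intros)
    then have "negligible (\<Union>n. uminus ` {t \<in> {- real n<..<0}. \<not> ?F differentiable (at t)})"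
      by (intro negligible_countable_Union) auto
    moreover have "{u. 0 < u \<and> \<not> ?G differentiable (at u)} \<subseteq> (\<Union>n. uminus ` {t \<in> {- real n<..<0}. \<not> ?F differentiable (at t)})"
    proof
      fix u assume u: "u \<in> {u. 0 < u \<and> \<not> ?G differentiable (at u)}"
      have "\<not> ?F differentiable (at (- u))"
      proof
        assume "?F differentiable (at (- u))"
        then obtain D where "(?F has_real_derivative D) (at (- u))" using real_differentiable_def by blast
        from DERIV_chain2[OF this DERIV_minus[OF DERIV_ident]]
        have "?G differentiable (at u)" using real_differentiable_def by blast
        then show False using u by simp
      qed
      moreover obtain n :: nat where "u < real n" using reals_Archimedean2 by blast
      ultimately show "u \<in> (\<Union>n. uminus ` {t \<in> {- real n<..<0}. \<not> ?F differentiable (at t)})"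
        using u by (intro UN_I[of n] image_eqI[of _ _ "- u"]) auto
    qed
    ultimately show ?thesis by (rule negligible_subset)
  qed
  obtain h where h: "bounded_density L h" and base: "\<And>v w. 0 \<le> v \<Longrightarrow> v \<le> w \<Longrightarrow>
      (\<integral>\<^sup>+u. ennreal (h u) * indicator {v..w} u \<partial>lborel) = ennreal (?F (- v) - ?F (- w))"
  proof (rule lipschitz_antimono_derivative[of ?G L])
    fix v w :: real assume "0 \<le> v" "v \<le> w"
    then show "?G w \<le> ?G v" "?G v - ?G w \<le> L * (w - v)"
      using L_monotone_slopes(1,2)[OF x r1 L, of "- w" "- v"] by auto
  qed (use N in auto)
  have hm: "h \<in> borel_measurable borel" "\<And>u. 0 \<le> h u" and h0: "\<And>u. u < 0 \<Longrightarrow> h u = 0"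
    using h by (auto simp: bounded_density_def)
  note tail = L_monotone_tail_integral[OF x r h base]
  have nn: "0 \<le> half_deriv j x t" if "j < r" "t \<le> 0" for j t using x that by (auto simp: L_monotone_def)
  have val: "integrable lborel (\<lambda>u. u ^ n * h u) \<and> moment h n = fact n * c"
    if "(\<integral>\<^sup>+u. (if 0 \<le> u then ennreal ((u - 0) ^ n / fact n * h u) else 0) \<partial>lborel) = ennreal c" "c \<ge> 0" for n c
  proof -
    have pos: "0 \<le> u ^ n / fact n * h u" for u using hm(2)[of u] h0[of u] by (cases "u < 0") auto
    have "(\<integral>\<^sup>+u. ennreal (u ^ n / fact n * h u) \<partial>lborel) = ennreal c"
      unfolding that(1)[symmetric] by (intro nn_integral_cong) (auto simp: h0)
    then have "has_bochner_integral lborel (\<lambda>u. u ^ n / fact n * h u) c"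
      using hm(1) pos that(2) by (intro has_bochner_integral_nn_integral) auto
    from has_bochner_integral_mult_right[OF this, of "fact n"]
    have "has_bochner_integral lborel (\<lambda>u. u ^ n * h u) (fact n * c)" by simp
    then show ?thesis by (simp add: has_bochner_integral_iff)
  qed
  have A: "integrable lborel (\<lambda>u. u ^ (r - 1 - j) * h u) \<and>
      moment h (r - 1 - j) = fact (r - 1 - j) * half_deriv j x 0" if j: "1 \<le> j" "j < r" for j
  proof (rule val)
    have "r - 1 - (r - 1 - j) = j" using j by simp
    then show "(\<integral>\<^sup>+u. (if 0 \<le> u then ennreal ((u - 0) ^ (r - 1 - j) / fact (r - 1 - j) * h u) else 0) \<partial>lborel)
        = ennreal (half_deriv j x 0)"
      using tail[of "r - 1 - j" 0] j by simp
  qed (use nn j in auto)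
  define c where "c = Inf ((\<lambda>w. half_deriv 0 x (- w)) ` {0..})"
  have bdd: "bdd_below ((\<lambda>w. half_deriv 0 x (- w)) ` {0..})" by (rule bdd_belowI[of _ 0]) (use nn r in auto)
  have cle: "c \<le> half_deriv 0 x (- w)" if "w \<ge> 0" for w
    unfolding c_def using that by (intro cInf_lower bdd) auto
  have c0: "c \<ge> 0" unfolding c_def using nn r by (intro cInf_greatest) auto
  have clim: "((\<lambda>w. half_deriv (1 - 1) x (- w)) \<longlongrightarrow> c) at_top"
  proof (rule decreasing_tendsto)
    show "\<forall>\<^sub>F w in at_top. c \<le> half_deriv (1 - 1) x (- w)"
      using eventually_ge_at_top[of 0] by eventually_elim (use cle in simp)
    fix y assume "c < y"
    then have "\<exists>a\<in>(\<lambda>w. half_deriv 0 x (- w)) ` {0..}. a < y"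
      unfolding c_def by (intro cInf_lessD) auto
    then obtain w where w: "w \<ge> 0" "half_deriv 0 x (- w) < y" by auto
    show "\<forall>\<^sub>F u in at_top. half_deriv (1 - 1) x (- u) < y"
      using eventually_ge_at_top[of w]
    proof eventually_elim
      case (elim u)
      then show ?case using L_monotone_mono[OF x r1, of 0 "- u" "- w"] w r by simp
    qed
  qed
  have "(\<integral>\<^sup>+u. (if 0 \<le> u then ennreal ((u - 0) ^ Suc (r - 2) / fact (Suc (r - 2)) * h u) else 0) \<partial>lborel)
    = (\<integral>\<^sup>+w. (if 0 \<le> w then ennreal (half_deriv (r - 1 - (r - 2)) x (- w)) else 0) \<partial>lborel)"
    unfolding iterated_nn_integral_power[OF hm, symmetric]
    using tail[of "r - 2"] by (intro nn_integral_cong) auto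
  also have "r - 1 - (r - 2) = 1" using r by simp
  also have "(\<integral>\<^sup>+w. (if 0 \<le> w then ennreal (half_deriv 1 x (- w)) else 0) \<partial>lborel)
      = ennreal (half_deriv 0 x 0 - c)"
    using L_monotone_integral_step[OF x r1 _ _ _ clim, of 0] r by simp
  finally have B: "integrable lborel (\<lambda>u. u ^ (Suc (r - 2)) * h u) \<and>
      (\<integral>u. u ^ (Suc (r - 2)) * h u \<partial>lborel) = fact (Suc (r - 2)) * (half_deriv 0 x 0 - c)"
    by (rule val) (use cle[of 0] in simp)
  have s: "r - 1 - 0 = Suc (r - 2)" using r by simp
  show ?thesis
  proof (rule that[OF h])
    fix j assume j: "j < r"
    show "integrable lborel (\<lambda>u. u ^ (r - 1 - j) * h u)"
      using A[of j] B j s by (cases "j = 0") auto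
    show "moment h (r - 1 - j) \<le> fact (r - 1 - j) * half_deriv j x 0"
    proof (cases "j = 0")
      case True
      have "fact (Suc (r - 2)) * (half_deriv 0 x 0 - c) \<le> fact (Suc (r - 2)) * half_deriv 0 x 0"
        using c0 by (intro mult_left_mono) auto
      then show ?thesis using B True s by simp
    qed (use A[of j] j in auto)
  qed (use A in blast)
qed

section \<open>Zeros and sign changes of generalized polynomials\<close>

text \<open>
  What matters below is the number of exponents, not the degree, so exponents and coefficients are
  kept apart.
\<close>

definition fewnomial :: "nat set \<Rightarrow> (nat \<Rightarrow> real) \<Rightarrow> real \<Rightarrow> real" where
  "fewnomial N c u = (\<Sum>i\<in>N. c i * u ^ i)"

text \<open>
  The new zeros are strictly between the old ones; that they avoid \<open>Z\<close> is needed to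
  detect double zeros.
\<close>

lemma Rolle_card:
  fixes f :: "real \<Rightarrow> real"
  assumes "finite Z" "Z \<noteq> {}" "Z \<subseteq> {0<..}" "\<And>z. z \<in> Z \<Longrightarrow> f z = 0"
    and f: "\<And>u. u > 0 \<Longrightarrow> (f has_real_derivative f' u) (at u)"
  shows "\<exists>Z'. finite Z' \<and> Z' \<subseteq> {0<..<Max Z} \<and> Z \<inter> Z' = {} \<and> Suc (card Z') = card Z \<and> (\<forall>z\<in>Z'. f' z = 0)"
  using assms(1-4)
proof (induction Z rule: finite_linorder_max_induct)
  case (insert b Z)
  show ?case
  proof (cases "Z = {}")
    case True
    then show ?thesis by (intro exI[of _ "{}"]) auto
  next
    case False
    define m where "m = Max Z"
    have mZ: "m \<in> Z" unfolding m_def using insert.hyps(1) False by (rule Max_in)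
    have m: "m \<in> Z" "m < b" "m > 0" "\<And>z. z \<in> Z \<Longrightarrow> z \<le> m" and fm: "f m = 0" "f b = 0"
      using mZ insert.hyps insert.prems by (auto simp: m_def)
    obtain Z' where Z': "finite Z'" "Z' \<subseteq> {0<..<m}" "Z \<inter> Z' = {}" "Suc (card Z') = card Z" "\<forall>z\<in>Z'. f' z = 0"
      using insert.IH[OF False] insert.prems unfolding m_def by auto
    have "\<exists>z. m < z \<and> z < b \<and> DERIV f z :> 0"
    proof (rule Rolle)
      show "continuous_on {m..b} f"
      proof (rule DERIV_continuous_on)
        fix u assume "u \<in> {m..b}"
        then show "(f has_real_derivative f' u) (at u within {m..b})"
          using f[of u] m(3) by (simp add: has_field_derivative_at_within)
      qed
      show "f differentiable (at z)" if "m < z" "z < b" for z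
        using f[of z] that m(3) real_differentiable_def by auto
    qed (use m fm in auto)
    then obtain z where z: "m < z" "z < b" "DERIV f z :> 0" by blast
    have fz: "f' z = 0" using DERIV_unique[OF f z(3)] z m by auto
    have "Max (insert b Z) = b" using insert.hyps m by (intro Max_eqI) (auto intro: less_imp_le)
    moreover have "z \<notin> Z'" "z \<notin> Z" using Z'(2) z m(4) by force+
    moreover have "b \<notin> Z" "b \<notin> Z'" using insert.hyps Z'(2) m by force+
    ultimately show ?thesis
      using Z' z m insert.hyps fz by (intro exI[of _ "insert z Z'"]) auto
  qed
qed simp

text \<open>
  Dividing by the lowest power turns its term into a constant, which disappears on
  differentiation. So the number of terms drops by one while the positive zeros stay in place.
\<close>

lemma fewnomial_quotient:
  assumes N: "finite N" "N \<noteq> {}"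
  obtains g N' c' where "\<And>u. fewnomial N c u = u ^ Min N * g u" "finite N'" "Suc (card N') = card N"
    "\<And>u. (g has_real_derivative fewnomial N' c' u) (at u)"
    "(\<forall>i\<in>N'. c' i = 0) \<longleftrightarrow> (\<forall>i\<in>N - {Min N}. c i = 0)"
proof -
  define e where "e = Min N"
  have e: "e \<in> N" "\<And>i. i \<in> N \<Longrightarrow> e \<le> i" using N by (auto simp: e_def)
  define \<tau> where "\<tau> i = i - e - 1" for i
  define N' where "N' = \<tau> ` (N - {e})"
  define c' where "c' k = c (k + e + 1) * real (k + 1)" for k
  have gt: "e < i" if "i \<in> N - {e}" for i using e(2)[of i] that by auto
  have inj: "inj_on \<tau> (N - {e})"
  proof (rule inj_onI)
    fix i j assume "i \<in> N - {e}" "j \<in> N - {e}" "\<tau> i = \<tau> j"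
    then show "i = j" using gt[of i] gt[of j] by (simp add: \<tau>_def)
  qed
  have c'\<tau>: "c' (\<tau> i) = c i * real (i - e)" if "i \<in> N - {e}" for i
    using gt[OF that] by (simp add: c'_def \<tau>_def)
  show ?thesis
  proof (rule that[of "\<lambda>u. \<Sum>i\<in>N. c i * u ^ (i - e)" N' c'])
    show "fewnomial N c u = u ^ Min N * (\<Sum>i\<in>N. c i * u ^ (i - e))" for u
      unfolding fewnomial_def sum_distrib_left e_def[symmetric]
    proof (rule sum.cong[OF refl])
      fix i assume "i \<in> N"
      then have "u ^ i = u ^ e * u ^ (i - e)" using e(2) by (simp flip: power_add)
      then show "c i * u ^ i = u ^ e * (c i * u ^ (i - e))" by simp
    qed
    show "finite N'" using N by (simp add: N'_def)
    have "card N' = card (N - {e})" unfolding N'_def by (rule card_image[OF inj])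
    then show "Suc (card N') = card N" using card_Suc_Diff1[OF N(1) e(1)] by simp
    fix u
    have "fewnomial N' c' u = (\<Sum>i\<in>N - {e}. c' (\<tau> i) * u ^ \<tau> i)"
      unfolding fewnomial_def N'_def by (rule sum.reindex_cong[OF inj]) auto
    also have "\<dots> = (\<Sum>i\<in>N - {e}. c i * (real (i - e) * u ^ (i - e - 1)))"
      by (intro sum.cong[OF refl]) (simp add: c'\<tau>, simp add: \<tau>_def)
    also have "\<dots> = (\<Sum>i\<in>N. c i * (real (i - e) * u ^ (i - e - 1)))"
      using N by (intro sum.mono_neutral_left) auto
    finally show "((\<lambda>u. \<Sum>i\<in>N. c i * u ^ (i - e)) has_real_derivative fewnomial N' c' u) (at u)"
      by (auto intro!: derivative_eq_intros sum.cong)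
  next
    show "(\<forall>i\<in>N'. c' i = 0) \<longleftrightarrow> (\<forall>i\<in>N - {Min N}. c i = 0)"
    proof -
      have "c' (\<tau> i) = 0 \<longleftrightarrow> c i = 0" if "i \<in> N - {e}" for i using c'\<tau>[OF that] gt[OF that] by simp
      then show ?thesis unfolding N'_def e_def[symmetric] by blast
    qed
  qed
qed

lemma fewnomial_single_term:
  assumes "finite N" "i \<in> N" "\<forall>j\<in>N - {i}. c j = 0"
  shows "fewnomial N c u = c i * u ^ i"
proof -
  have "fewnomial N c u = (\<Sum>j\<in>{i}. c j * u ^ j)"
    unfolding fewnomial_def using assms by (intro sum.mono_neutral_right) auto
  then show ?thesis by simp
qed

text \<open>
  A weak form of Descartes' rule of signs, by induction on the number of terms with Rolle's
  theorem.
\<close>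

theorem fewnomial_zeros_less_card:
  assumes "finite N" "i \<in> N" "c i \<noteq> 0" "finite Z" "Z \<subseteq> {0<..}" "\<And>z. z \<in> Z \<Longrightarrow> fewnomial N c z = 0"
  shows "card Z < card N"
  using assms
proof (induction "card N" arbitrary: N c i Z)
  case 0
  then show ?case by auto
next
  case (Suc n)
  have ne: "N \<noteq> {}" using Suc.prems by blast
  obtain g N' c' where g: "\<And>u. fewnomial N c u = u ^ Min N * g u" "finite N'" "Suc (card N') = card N"
    "\<And>u. (g has_real_derivative fewnomial N' c' u) (at u)"
    "(\<forall>i\<in>N'. c' i = 0) \<longleftrightarrow> (\<forall>i\<in>N - {Min N}. c i = 0)"
    using fewnomial_quotient[OF Suc.prems(1) ne, of c] by blast
  show ?case
  proof (cases "Z = {}")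
    case True
    then show ?thesis using g(3) by simp
  next
    case False
    have gz: "g z = 0" if "z \<in> Z" for z
      using Suc.prems(6)[OF that] Suc.prems(5) that g(1)[of z] by auto
    from Rolle_card[OF Suc.prems(4) False Suc.prems(5) gz g(4)]
    obtain Z' where Z': "finite Z'" "Z' \<subseteq> {0<..<Max Z}" "Suc (card Z') = card Z" "\<forall>z\<in>Z'. fewnomial N' c' z = 0"
      by blast
    show ?thesis
    proof (cases "\<forall>i\<in>N - {Min N}. c i = 0")
      case False
      then obtain k where k: "k \<in> N'" "c' k \<noteq> 0" using g(5) by blast
      have "card Z' < card N'"
      proof (rule Suc.hyps(1)[of N' k c' Z'])
        show "n = card N'" using Suc.hyps(2) g(3) by simp
        show "Z' \<subseteq> {0<..}" using Z'(2) by auto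
      qed (use g(2) k Z' in auto)
      then show ?thesis using Z'(3) g(3) by simp
    next
      case True
      then have "i = Min N" using Suc.prems(2,3) by blast
      have "fewnomial N c u = c i * u ^ i" for u
        using Suc.prems(1,2) True \<open>i = Min N\<close> by (intro fewnomial_single_term) auto
      moreover obtain z where "z \<in> Z" using \<open>Z \<noteq> {}\<close> by blast
      ultimately show ?thesis using Suc.prems(3,5,6) by force
    qed
  qed
qed

text \<open>
  If the number of zeros is the largest possible, a double zero \<open>a\<close> would be an
  additional zero of the derivative in \<open>fewnomial_quotient\<close>, besides those given by
  Rolle's theorem, and that derivative would have too many zeros.
\<close>

lemma fewnomial_zero_simple:
  assumes "finite N" "i \<in> N" "c i \<noteq> 0" "finite Z" "Z \<subseteq> {0<..}" "\<And>z. z \<in> Z \<Longrightarrow> fewnomial N c z = 0"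
    and Z: "Suc (card Z) = card N" "a \<in> Z"
  shows "\<not> (fewnomial N c has_real_derivative 0) (at a)"
proof
  assume D: "(fewnomial N c has_real_derivative 0) (at a)"
  have ne: "N \<noteq> {}" using assms by blast
  have a: "a > 0" using Z assms(5) by auto
  obtain g N' c' where g: "\<And>u. fewnomial N c u = u ^ Min N * g u" "finite N'" "Suc (card N') = card N"
    "\<And>u. (g has_real_derivative fewnomial N' c' u) (at u)"
    "(\<forall>i\<in>N'. c' i = 0) \<longleftrightarrow> (\<forall>i\<in>N - {Min N}. c i = 0)"
    using fewnomial_quotient[OF assms(1) ne, of c] by blast
  have gz: "g z = 0" if "z \<in> Z" for z
    using assms(6)[OF that] assms(5) that g(1)[of z] by auto
  have fc: "fewnomial N c = (\<lambda>u. u ^ Min N * g u)" using g(1) by auto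
  have "((\<lambda>u. u ^ Min N * g u) has_real_derivative
      (real (Min N) * a ^ (Min N - 1)) * g a + fewnomial N' c' a * a ^ Min N) (at a)"
    by (rule DERIV_mult[OF _ g(4)]) (auto intro!: derivative_eq_intros)
  then have "(real (Min N) * a ^ (Min N - 1)) * g a + fewnomial N' c' a * a ^ Min N = 0"
    using DERIV_unique[OF _ D] unfolding fc by blast
  then have fa: "fewnomial N' c' a = 0" using gz[OF Z(2)] a by simp
  have Zne: "Z \<noteq> {}" using Z by blast
  from Rolle_card[OF assms(4) Zne assms(5) gz g(4)]
  obtain Z' where Z': "finite Z'" "Z' \<subseteq> {0<..<Max Z}" "Z \<inter> Z' = {}" "Suc (card Z') = card Z" "\<forall>z\<in>Z'. fewnomial N' c' z = 0"
    by blast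
  have "\<exists>k\<in>N'. c' k \<noteq> 0"
  proof (rule ccontr)
    assume "\<not> ?thesis"
    then have 0: "\<forall>i\<in>N - {Min N}. c i = 0" using g(5) by blast
    then have "i = Min N" using assms by blast
    have "fewnomial N c a = c i * a ^ i"
      using assms(1,2) 0 \<open>i = Min N\<close> by (intro fewnomial_single_term) auto
    then show False using assms(3) assms(6)[OF Z(2)] a by simp
  qed
  then obtain k where "k \<in> N'" "c' k \<noteq> 0" by blast
  then have "card (insert a Z') < card N'"
    using g(2) Z' fa a by (intro fewnomial_zeros_less_card[of N' k c']) auto
  moreover have "a \<notin> Z'" using Z'(3) Z(2) by blast
  ultimately show False using Z'(1,4) Z(1) g(3) by simp
qed

text \<open>
  Prescribing one zero more: take two solutions for the other zeros, one without the exponent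
  \<open>e'\<close> and one led by it. The latter cannot vanish at the new point by
  \<open>fewnomial_zeros_less_card\<close>, so a suitable combination does.
\<close>

lemma fewnomial_interpolation:
  assumes "finite Z" "Z \<subseteq> {0<..}" "finite E" "card E = card Z" "\<And>i. i \<in> E \<Longrightarrow> i < e"
  shows "\<exists>c. c e = 1 \<and> (\<forall>z\<in>Z. fewnomial (insert e E) c z = 0)"
  using assms
proof (induction Z arbitrary: E e rule: finite_induct)
  case empty
  show ?case by (rule exI[of _ "\<lambda>_. 1"]) simp
next
  case (insert z Z)
  define e' where "e' = Max E"
  have Ene: "E \<noteq> {}" using insert.prems(3) insert.hyps by auto
  have e': "e' \<in> E" "\<And>i. i \<in> E \<Longrightarrow> i \<le> e'" using insert.prems(2) Ene by (auto simp: e'_def)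
  define E' where "E' = E - {e'}"
  have E': "finite E'" "card E' = card Z" "E = insert e' E'" "e' \<notin> E'" "e \<notin> E" "\<And>i. i \<in> E' \<Longrightarrow> i < e'"
    using insert.prems insert.hyps e' by (auto simp: E'_def le_neq_implies_less)
  obtain c1 where c1: "c1 e = 1" "\<forall>z\<in>Z. fewnomial (insert e E') c1 z = 0"
    using insert.IH[of E' e] insert.prems E' by auto
  obtain c2 where c2: "c2 e' = 1" "\<forall>z\<in>Z. fewnomial (insert e' E') c2 z = 0"
    using insert.IH[of E' e'] insert.prems E' by auto
  have nz: "fewnomial E c2 z \<noteq> 0"
  proof
    assume "fewnomial E c2 z = 0"
    then have "card (insert z Z) < card E"
      using c2 E' insert.prems insert.hyps by (intro fewnomial_zeros_less_card[of E e' c2]) auto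
    then show False using insert.prems(3) by simp
  qed
  define t where "t = fewnomial (insert e E') c1 z / fewnomial E c2 z"
  define c where "c i = (if i \<in> insert e E' then c1 i else 0) - t * (if i \<in> E then c2 i else 0)" for i
  have fc: "fewnomial (insert e E) c u = fewnomial (insert e E') c1 u - t * fewnomial E c2 u" for u
  proof -
    have fin: "finite (insert e E)" using insert.prems(2) by simp
    have "fewnomial (insert e E) c u = (\<Sum>i\<in>insert e E. (if i \<in> insert e E' then c1 i * u ^ i else 0))
        - t * (\<Sum>i\<in>insert e E. (if i \<in> E then c2 i * u ^ i else 0))"
      unfolding fewnomial_def sum_distrib_left sum_subtractf[symmetric]
      by (intro sum.cong[OF refl]) (auto simp: c_def algebra_simps)
    also have "(\<Sum>i\<in>insert e E. (if i \<in> insert e E' then c1 i * u ^ i else 0)) = fewnomial (insert e E') c1 u"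
      unfolding fewnomial_def using fin E'(3) by (subst sum.inter_restrict[symmetric]) (auto intro!: sum.cong)
    also have "(\<Sum>i\<in>insert e E. (if i \<in> E then c2 i * u ^ i else 0)) = fewnomial E c2 u"
      unfolding fewnomial_def using fin by (subst sum.inter_restrict[symmetric]) (auto intro!: sum.cong)
    finally show ?thesis .
  qed
  show ?case
  proof (intro exI conjI ballI)
    show "c e = 1" using E'(5) c1 by (simp add: c_def)
    fix y assume "y \<in> insert z Z"
    then show "fewnomial (insert e E) c y = 0"
      using c1(2) c2(2) nz unfolding fc E'(3)[symmetric] by (auto simp: t_def)
  qed
qed

text \<open>
  The set \<open>Z\<close> consists of the positive zeros of odd multiplicity: dividing out a zero
  twice moves it to the factor \<open>V\<close>.
\<close>

lemma poly_sign_factor: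
  fixes p :: "real poly"
  assumes "\<forall>\<^sub>F u in at_top. poly p u > 0"
  shows "\<exists>Z V. finite Z \<and> Z \<subseteq> {u. u > 0 \<and> poly p u = 0} \<and> p = (\<Prod>a\<in>Z. [:- a, 1:]) * V \<and> (\<forall>u>0. poly V u \<ge> 0)"
  using assms
proof (induction "degree p" arbitrary: p rule: less_induct)
  case less
  have p0: "p \<noteq> 0" using less.prems eventually_happens by force
  show ?case
  proof (cases "\<exists>a>0. poly p a = 0")
    case False
    have "poly p u \<ge> 0" if u: "u > 0" for u
    proof (rule ccontr)
      assume "\<not> poly p u \<ge> 0"
      moreover obtain b where b: "b > u" "poly p b > 0"
        using eventually_happens[OF eventually_conj[OF less.prems eventually_gt_at_top[of u]]] by auto
      ultimately obtain x where "x > u" "poly p x = 0"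
        using poly_IVT_pos[of u b p] by auto
      then show False using False u by auto
    qed
    then show ?thesis by (intro exI[of _ "{}"] exI[of _ p]) auto
  next
    case True
    then obtain a where a: "a > 0" "poly p a = 0" by blast
    then obtain q where q: "p = [:- a, 1:] * q" using poly_eq_0_iff_dvd by (metis dvdE)
    have pq: "poly p u = (u - a) * poly q u" for u by (simp add: q algebra_simps)
    have q0: "q \<noteq> 0" using p0 q by auto
    have "degree p = Suc (degree q)" unfolding q using q0 by (subst degree_mult_eq) auto
    moreover have "\<forall>\<^sub>F u in at_top. poly q u > 0"
      using less.prems eventually_gt_at_top[of a]
    proof eventually_elim
      case (elim u)
      then have "0 < (u - a) * poly q u" using q by (simp add: algebra_simps)
      then show ?case using elim(2) by (simp add: zero_less_mult_iff)
    qed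
    ultimately obtain Z V where ZV: "finite Z" "Z \<subseteq> {u. u > 0 \<and> poly q u = 0}"
        "q = (\<Prod>a\<in>Z. [:- a, 1:]) * V" "\<forall>u>0. poly V u \<ge> 0"
      using less.hyps[of q] by auto
    show ?thesis
    proof (cases "a \<in> Z")
      case False
      have "p = (\<Prod>a\<in>insert a Z. [:- a, 1:]) * V"
        unfolding q ZV(3)[symmetric] prod.insert[OF ZV(1) False] mult.assoc ..
      moreover have "insert a Z \<subseteq> {u. u > 0 \<and> poly p u = 0}" using ZV(2) a(1) pq by auto
      ultimately show ?thesis using ZV(1,4) by blast
    next
      case True
      have "(\<Prod>a\<in>Z. [:- a, 1:]) = [:- a, 1:] * (\<Prod>a\<in>Z - {a}. [:- a, 1:])"
        using ZV(1) True by (rule prod.remove)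
      then have "p = (\<Prod>a\<in>Z - {a}. [:- a, 1:]) * ([:- a, 1:] * [:- a, 1:] * V)"
        using ZV(3) q by (simp only: ac_simps)
      moreover have "\<forall>u>0. poly ([:- a, 1:] * [:- a, 1:] * V) u \<ge> 0"
      proof (intro allI impI)
        fix u :: real assume "u > 0"
        then have "(u - a) * (u - a) * poly V u \<ge> 0" using ZV(4)
          by (intro mult_nonneg_nonneg[OF zero_le_square]) auto
        then show "poly ([:- a, 1:] * [:- a, 1:] * V) u \<ge> 0" by (simp add: algebra_simps)
      qed
      moreover have "Z - {a} \<subseteq> {u. u > 0 \<and> poly p u = 0}" using ZV(2) pq by auto
      ultimately show ?thesis using ZV(1) by blast
    qed
  qed
qed

definition few_poly :: "nat set \<Rightarrow> (nat \<Rightarrow> real) \<Rightarrow> real poly" where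
  "few_poly N c = (\<Sum>i\<in>N. monom (c i) i)"

lemma poly_few_poly [simp]: "poly (few_poly N c) u = fewnomial N c u"
  by (simp add: few_poly_def fewnomial_def poly_sum poly_monom)

lemma fewnomial_eventually_pos:
  assumes "finite E" "\<And>i. i \<in> E \<Longrightarrow> i < e" "c e > 0"
  shows "\<forall>\<^sub>F u in at_top. fewnomial (insert e E) c u > 0"
proof -
  let ?p = "few_poly (insert e E) c"
  have co: "coeff ?p k = (if k \<in> insert e E then c k else 0)" for k
    using assms(1) by (auto simp: few_poly_def coeff_sum coeff_monom)
  have "coeff ?p e = c e" by (simp add: co)
  moreover have "degree ?p = e"
  proof (rule antisym)
    show "degree ?p \<le> e" by (rule degree_le) (use assms(2) in \<open>force simp: co\<close>)
    show "e \<le> degree ?p" using assms(3) by (intro le_degree) (simp add: co)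
  qed
  ultimately have "lead_coeff ?p > 0" using assms(3) by simp
  from poly_pinfty_gt_lc[OF this] obtain n where "\<forall>x\<ge>n. lead_coeff ?p \<le> poly ?p x" by blast
  then show ?thesis unfolding eventually_at_top_linorder
    using \<open>lead_coeff ?p > 0\<close> by (metis less_le_trans poly_few_poly)
qed

text \<open>
  The polynomial interpolating zero on \<open>Z\<close> has no positive zeros outside
  \<open>Z\<close>, and all of them are simple. Hence it changes sign exactly on \<open>Z\<close>.
  This is the test polynomial for which the spline with knots \<open>Z\<close> is extremal.
\<close>

theorem fewnomial_prescribed_signs:
  assumes Z: "finite Z" "Z \<subseteq> {0<..}" and E: "finite E" "card E = card Z" "\<And>i. i \<in> E \<Longrightarrow> i < e"
  obtains c V where "c e = 1" "\<And>u. fewnomial (insert e E) c u = (\<Prod>a\<in>Z. u - a) * poly V u"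
    "V \<noteq> 0" "\<And>u. u > 0 \<Longrightarrow> poly V u \<ge> 0"
proof -
  let ?N = "insert e E"
  have eE: "e \<notin> E" using E(3) by blast
  have cardN: "card ?N = Suc (card Z)" using E eE by simp
  obtain c where c: "c e = 1" "\<forall>z\<in>Z. fewnomial ?N c z = 0"
    using fewnomial_interpolation[OF Z E] by blast
  have pos: "\<forall>\<^sub>F u in at_top. poly (few_poly ?N c) u > 0"
    using fewnomial_eventually_pos[OF E(1,3), of c] c(1) by simp
  obtain Y V where Y: "finite Y" "Y \<subseteq> {u. u > 0 \<and> poly (few_poly ?N c) u = 0}"
      "few_poly ?N c = (\<Prod>a\<in>Y. [:- a, 1:]) * V" "\<forall>u>0. poly V u \<ge> 0"
    using poly_sign_factor[OF pos] by blast
  have f: "fewnomial ?N c u = (\<Prod>a\<in>Y. u - a) * poly V u" for u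
  proof -
    have "poly (few_poly ?N c) u = poly ((\<Prod>a\<in>Y. [:- a, 1:]) * V) u" using Y(3) by simp
    then show ?thesis by (simp add: poly_prod)
  qed
  have "Y \<subseteq> Z"
  proof (rule ccontr)
    assume "\<not> Y \<subseteq> Z"
    then obtain y where y: "y \<in> Y" "y \<notin> Z" by blast
    have "card (insert y Z) < card ?N"
      using y Y(2) Z E c by (intro fewnomial_zeros_less_card[of ?N e c]) auto
    then show False using y Z cardN by simp
  qed
  moreover have "Z \<subseteq> Y"
  proof
    fix a assume a: "a \<in> Z"
    show "a \<in> Y"
    proof (rule ccontr)
      assume "a \<notin> Y"
      have a0: "a > 0" using a Z by auto
      have "(\<Prod>b\<in>Y. a - b) \<noteq> 0" using \<open>a \<notin> Y\<close> Y(1) by auto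
      \<comment> \<open>A zero of the nonnegative factor is a local minimum of it, hence a double
          zero.\<close>
      then have Va: "poly V a = 0" using f[of a] c(2) a by simp
      have "poly (pderiv V) a = 0"
      proof (rule DERIV_local_min[OF poly_DERIV a0])
        show "\<forall>y. \<bar>a - y\<bar> < a \<longrightarrow> poly V a \<le> poly V y" using Va Y(4) by auto
      qed
      then have dV: "(poly V has_real_derivative 0) (at a)" using poly_DERIV[of V a] by simp
      let ?P = "\<Prod>a\<in>Y. [:- a, 1:]"
      have "((\<lambda>u. poly ?P u * poly V u) has_real_derivative (poly (pderiv ?P) a * poly V a + 0 * poly ?P a)) (at a)"
        by (rule DERIV_mult[OF poly_DERIV dV])
      moreover have "(\<lambda>u. poly ?P u * poly V u) = fewnomial ?N c" using f by (auto simp: poly_prod)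
      ultimately have "(fewnomial ?N c has_real_derivative 0) (at a)" using Va by simp
      then show False
        using fewnomial_zero_simple[of ?N e c Z a] c E Z a cardN by auto
    qed
  qed
  ultimately have "Y = Z" by blast
  show ?thesis
  proof (rule that[of c V])
    show "V \<noteq> 0"
    proof
      assume "V = 0"
      then show False using pos Y(3) by simp
    qed
  qed (use c f Y \<open>Y = Z\<close> in auto)
qed

section \<open>Moment problems solved by two-valued densities\<close>

lemma fewnomial_finite_zeros:
  assumes "finite N" "i \<in> N" "c i \<noteq> 0"
  shows "finite {u. u > 0 \<and> fewnomial N c u = 0}"
proof (rule ccontr)
  assume "infinite {u. u > 0 \<and> fewnomial N c u = 0}"
  then obtain Z where Z: "Z \<subseteq> {u. u > 0 \<and> fewnomial N c u = 0}" "finite Z" "card Z = card N"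
    using infinite_arbitrarily_large by blast
  have "card Z < card N" using Z assms by (intro fewnomial_zeros_less_card[of N i c]) auto
  then show False using Z(3) by simp
qed

definition l1_norm :: "nat set \<Rightarrow> (nat \<Rightarrow> real) \<Rightarrow> real" where
  "l1_norm N c = (\<Sum>i\<in>N. \<bar>c i\<bar>)"

lemma continuous_on_coordinate [continuous_intros]:
  "continuous_on S (\<lambda>c. c i :: real)"
  by (rule continuous_on_subset[OF continuous_on_product_coordinates]) simp

lemma continuous_on_l1_norm: "continuous_on S (l1_norm N)"
  unfolding l1_norm_def[abs_def] by (intro continuous_intros)

lemma compact_l1_ball:
  assumes "finite N"
  shows "compact {c. (\<forall>i. i \<notin> N \<longrightarrow> c i = 0) \<and> l1_norm N c \<le> B}"
proof -
  define X where "X i = (if i \<in> N then {-B..B} else {0::real})" for i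
  have "compactin (product_topology (\<lambda>i. euclidean) UNIV) (PiE UNIV X)"
    unfolding compactin_PiE by (auto simp: X_def)
  then have "compact (PiE UNIV X)" by (simp add: euclidean_product_topology)
  moreover have "closed {c. l1_norm N c \<le> B}"
    by (intro closed_Collect_le continuous_on_l1_norm continuous_on_const)
  ultimately have "compact (PiE UNIV X \<inter> {c. l1_norm N c \<le> B})" by (rule compact_Int_closed)
  also have "PiE UNIV X \<inter> {c. l1_norm N c \<le> B} = {c. (\<forall>i. i \<notin> N \<longrightarrow> c i = 0) \<and> l1_norm N c \<le> B}"
  proof (intro set_eqI iffI; clarsimp)
    fix c i assume "c \<in> PiE UNIV X" "i \<notin> N"
    then have "c i \<in> X i" by blast
    then show "c i = 0" using \<open>i \<notin> N\<close> by (simp add: X_def)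
  next
    fix c assume c: "\<forall>i. i \<notin> N \<longrightarrow> c i = 0" "l1_norm N c \<le> B"
    have "\<bar>c i\<bar> \<le> B" if "i \<in> N" for i
    proof -
      have "\<bar>c i\<bar> \<le> l1_norm N c" unfolding l1_norm_def using assms that by (intro member_le_sum) auto
      then show ?thesis using c(2) by simp
    qed
    then show "c \<in> PiE UNIV X" using c(1) by (auto simp: X_def abs_le_iff minus_le_iff)
  qed
  finally show ?thesis .
qed

lemma compact_l1_sphere:
  assumes "finite N"
  shows "compact {c. (\<forall>i. i \<notin> N \<longrightarrow> c i = 0) \<and> l1_norm N c = B}"
proof -
  have "closed {c. l1_norm N c \<ge> B}"
    by (intro closed_Collect_le continuous_on_l1_norm continuous_on_const)
  with compact_l1_ball[OF assms] have
    "compact ({c. (\<forall>i. i \<notin> N \<longrightarrow> c i = 0) \<and> l1_norm N c \<le> B} \<inter> {c. l1_norm N c \<ge> B})"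
    by (rule compact_Int_closed)
  also have "\<dots> = {c. (\<forall>i. i \<notin> N \<longrightarrow> c i = 0) \<and> l1_norm N c = B}" by auto
  finally show ?thesis .
qed

text \<open>
  The sets where \<open>F n\<close> is positive form an increasing open cover.
\<close>

lemma directed_positive_on_compact:
  fixes F :: "nat \<Rightarrow> 'a::topological_space \<Rightarrow> real"
  assumes S: "compact S" and cont: "\<And>n. continuous_on UNIV (F n)"
    and mono: "\<And>m n x. m \<le> n \<Longrightarrow> F m x \<le> F n x" and pos: "\<And>x. x \<in> S \<Longrightarrow> \<exists>n. F n x > 0"
  shows "\<exists>n. \<forall>x\<in>S. F n x > 0"
proof -
  have op: "open {x. F n x > 0}" for n by (intro open_Collect_less cont continuous_on_const)
  have sub: "S \<subseteq> (\<Union>n\<in>UNIV. {x. F n x > 0})" using pos by auto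
  obtain C where C: "C \<subseteq> UNIV" "finite C" "S \<subseteq> (\<Union>n\<in>C. {x. F n x > 0})"
    by (rule compactE_image[OF S _ sub]) (use op in auto)
  show ?thesis
  proof (intro exI ballI)
    fix x assume "x \<in> S"
    then obtain n where n: "n \<in> C" "F n x > 0" using C(3) by blast
    then show "F (Max C) x > 0" using mono[of n "Max C" x] C(2) by simp
  qed
qed

lemma set_integral_nonneg:
  fixes f :: "'a \<Rightarrow> real"
  assumes "\<And>u. u \<in> A \<Longrightarrow> 0 \<le> f u"
  shows "0 \<le> (LINT u:A|M. f u)"
  unfolding set_lebesgue_integral_def
  by (intro Bochner_Integration.integral_nonneg) (auto simp: indicator_def assms)

lemma continuous_on_fewnomial: "continuous_on S (fewnomial N c)"
  unfolding fewnomial_def[abs_def] by (intro continuous_intros)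

lemma set_integrable_continuous_Icc:
  assumes "continuous_on UNIV f" shows "set_integrable lborel {a..b} (f :: real \<Rightarrow> real)"
  by (rule borel_integrable_atLeastAtMost'[OF continuous_on_subset[OF assms subset_UNIV]])

lemma continuous_on_fewnomial_integral:
  assumes g: "continuous_on UNIV g"
  shows "continuous_on UNIV (\<lambda>c. LINT u:{0..R}|lborel. max 0 (fewnomial N c u - g u :: real))"
proof -
  have "continuous_on UNIV (\<lambda>(c, u). max 0 (fewnomial N c u - g u))"
    unfolding fewnomial_def case_prod_unfold
    by (intro continuous_intros continuous_on_compose2[OF g]
      continuous_on_compose2[OF continuous_on_product_coordinates continuous_on_fst[OF continuous_on_id]]) auto
  then have "continuous_on UNIV (\<lambda>c. integral (cbox 0 R) (\<lambda>u. max 0 (fewnomial N c u - g u)))"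
    by (intro integral_continuous_on_param) (rule continuous_on_subset[OF _ subset_UNIV])
  moreover have "(LINT u:{0..R}|lborel. max 0 (fewnomial N c u - g u)) = integral (cbox 0 R) (\<lambda>u. max 0 (fewnomial N c u - g u))" for c
    unfolding box_real
    by (intro set_borel_integral_eq_integral set_integrable_continuous_Icc continuous_intros continuous_on_fewnomial g)
  ultimately show ?thesis by simp
qed

text \<open>
  The integral of the positive part of a generalized polynomial over \<open>[0, R]\<close>; as a function of
  the coefficients it is the support function of the set of moment vectors of the densities
  \<open>0 \<le> g \<le> 1\<close> on \<open>[0, R]\<close>.
\<close>

abbreviation pos_mass :: "nat set \<Rightarrow> real \<Rightarrow> (nat \<Rightarrow> real) \<Rightarrow> real" where
  "pos_mass N R c \<equiv> (LINT u:{0..R}|lborel. max 0 (fewnomial N c u))"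

lemma pos_mass_integrable: "set_integrable lborel {a..b} (\<lambda>u. max 0 (fewnomial N c u))"
  by (intro set_integrable_continuous_Icc continuous_intros continuous_on_fewnomial)

lemma pos_mass_nonneg: "0 \<le> pos_mass N R c"
  by (rule set_integral_nonneg) simp

lemma pos_mass_mono: "R \<le> R' \<Longrightarrow> pos_mass N R c \<le> pos_mass N R' c"
  using pos_mass_integrable[of 0 R N c] pos_mass_integrable[of 0 R' N c]
  unfolding set_lebesgue_integral_def set_integrable_def
  by (intro integral_mono) (auto simp: indicator_def)

lemma fewnomial_scale: "fewnomial N (\<lambda>i. t * c i) u = t * fewnomial N c u"
  by (simp add: fewnomial_def sum_distrib_left mult.assoc)

lemma fewnomial_update:
  assumes "finite N" "i \<in> N"
  shows "fewnomial N (c(i := c i + t)) u = fewnomial N c u + t * u ^ i"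
proof -
  have "fewnomial N (c(i := c i + t)) u = (\<Sum>j\<in>N. c j * u ^ j + (if j = i then t * u ^ i else 0))"
    unfolding fewnomial_def by (intro sum.cong) (auto simp: algebra_simps)
  then show ?thesis using assms by (simp add: sum.distrib fewnomial_def)
qed

text \<open>
  Minimise the convex function \<open>J c = l \<integral> (Q\<^sub>c - u\<^sup>q)\<^sub>+ - \<Sum>
  c\<^sub>i m\<^sub>i\<close> of the coefficients \<open>c\<close> of a generalized polynomial
  \<open>Q\<^sub>c\<close>. The derivative of the integral in direction \<open>u\<^sup>i\<close>
  is the moment of order \<open>i\<close> of the indicator function of \<open>Q\<^sub>c >
  u\<^sup>q\<close>, because \<open>Q\<^sub>c - u\<^sup>q\<close> has finitely many zeros; for
  this the power \<open>u\<^sup>q\<close> has to be different from those in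
  \<open>Q\<^sub>c\<close>. So at a minimum the two-valued density \<open>l 1\<close> on
  \<open>Q\<^sub>c > u\<^sup>q\<close> has the prescribed moments. The hypothesis on
  \<open>m\<close> says that \<open>J\<close> grows in every direction: it is the condition, in
  dual form, that \<open>m\<close> is an interior moment vector for some bound \<open>L n\<close>
  and some interval \<open>[0, n]\<close>. These may depend on the direction, and compactness of
  the unit sphere makes one choice work for all.
\<close>

theorem bang_bang_moments:
  fixes L :: "nat \<Rightarrow> real"
  assumes N: "finite N" and q: "q \<notin> N" and L: "\<And>n. L n \<ge> 0" "mono L"
    and coercive: "\<And>c. \<exists>i\<in>N. c i \<noteq> 0 \<Longrightarrow>
      \<exists>n. (\<Sum>i\<in>N. c i * m i) < L n * pos_mass N (real n) c"
  shows "\<exists>n c. \<forall>i\<in>N. m i = L n * (LINT u:{0..real n}|lborel. u ^ i * indicator {u. fewnomial N c u > u ^ q} u)"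
proof -
  define F where "F n c = L n * pos_mass N (real n) c - (\<Sum>i\<in>N. c i * m i)" for n c
  have sint: "set_integrable lborel {a..b} (\<lambda>u. max 0 (fewnomial N c u - t * u ^ q))" for a b t c
    by (intro set_integrable_continuous_Icc continuous_intros continuous_on_fewnomial)
  note sint0 = pos_mass_integrable[where N = N]
  have contF: "continuous_on UNIV (F n)" for n
    unfolding F_def[abs_def] using continuous_on_fewnomial_integral[OF continuous_on_const[of _ 0], of "real n" N]
    by (intro continuous_intros) simp
  have Fmono: "F k c \<le> F n c" if "k \<le> n" for k n c
    unfolding F_def using that by (intro diff_mono mult_mono pos_mass_mono pos_mass_nonneg L(1) monoD[OF L(2)]) auto
  define S where "S = {c. (\<forall>i. i \<notin> N \<longrightarrow> c i = 0) \<and> l1_norm N c = 1}"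
  have S: "compact S" unfolding S_def by (rule compact_l1_sphere[OF N])
  have Spos: "\<exists>n. F n c > 0" if "c \<in> S" for c
  proof -
    have "\<exists>i\<in>N. c i \<noteq> 0"
    proof (rule ccontr)
      assume "\<not> ?thesis"
      then have "l1_norm N c = 0" by (simp add: l1_norm_def)
      then show False using that by (simp add: S_def)
    qed
    then show ?thesis using coercive[of c] by (simp add: F_def)
  qed
  obtain n where n: "\<forall>c\<in>S. F n c > 0"
    using directed_positive_on_compact[OF S contF Fmono Spos] by blast
  define l where "l = L n"
  define R where "R = real n"
  have l0: "l \<ge> 0" using L by (simp add: l_def)
  have "\<exists>\<kappa>>0. \<forall>c\<in>S. F n c \<ge> \<kappa>"
  proof (cases "S = {}")
    case True
    then show ?thesis by (intro exI[of _ 1]) auto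
  next
    case False
    obtain c0 where "c0 \<in> S" "\<forall>c\<in>S. F n c0 \<le> F n c"
      using continuous_attains_inf[OF S False continuous_on_subset[OF contF subset_UNIV]] by blast
    then show ?thesis using n by blast
  qed
  then obtain \<kappa> where \<kappa>: "\<kappa> > 0" "\<And>c. c \<in> S \<Longrightarrow> F n c \<ge> \<kappa>" by blast
  define J where "J c = l * (LINT u:{0..R}|lborel. max 0 (fewnomial N c u - u ^ q)) - (\<Sum>i\<in>N. c i * m i)" for c
  define C where "C = l * (LINT u:{0..R}|lborel. u ^ q)"
  have C0: "C \<ge> 0" unfolding C_def using l0
    by (intro mult_nonneg_nonneg set_integral_nonneg) auto
  define B where "B = (C + 1) / \<kappa>"
  have B: "B > 0" "\<kappa> * B = C + 1" using C0 \<kappa>(1) by (auto simp: B_def)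
  have qint: "set_integrable lborel {0..R} (\<lambda>u. u ^ q)"
    by (intro set_integrable_continuous_Icc continuous_intros)
  \<comment> \<open>Subtracting \<open>u\<^sup>q\<close> costs only a constant, so \<open>J\<close>
      is as coercive as the homogeneous function \<open>F n\<close>.\<close>
  have JF: "J c \<ge> F n c - C" for c
  proof -
    have "pos_mass N R c - (LINT u:{0..R}|lborel. u ^ q)
        = (LINT u:{0..R}|lborel. max 0 (fewnomial N c u) - u ^ q)"
      by (rule set_integral_diff(2)[symmetric, OF sint0 qint])
    also have "\<dots> \<le> (LINT u:{0..R}|lborel. max 0 (fewnomial N c u - u ^ q))"
    proof (rule set_integral_mono[OF set_integral_diff(1)[OF sint0 qint]])
      show "set_integrable lborel {0..R} (\<lambda>u. max 0 (fewnomial N c u - u ^ q))" using sint[of 0 R c 1] by simp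
      fix u assume "u \<in> {0..R}"
      then have "u ^ q \<ge> 0" by simp
      then show "max 0 (fewnomial N c u) - u ^ q \<le> max 0 (fewnomial N c u - u ^ q)" by linarith
    qed
    finally have "l * (pos_mass N R c - (LINT u:{0..R}|lborel. u ^ q))
        \<le> l * (LINT u:{0..R}|lborel. max 0 (fewnomial N c u - u ^ q))"
      using l0 by (rule mult_left_mono)
    then show ?thesis unfolding J_def F_def C_def l_def R_def by (simp add: algebra_simps)
  qed
  have Fscale: "F n (\<lambda>i. t * c i) = t * F n c" if "t \<ge> 0" for t c
  proof -
    have "max 0 (t * y) = t * max 0 y" for y using that by (simp add: max_def mult_le_0_iff zero_le_mult_iff)
    then have "(pos_mass N (real n) (\<lambda>i. t * c i)) = t * pos_mass N (real n) c"
      by (simp add: fewnomial_scale)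
    then show ?thesis unfolding F_def by (simp add: algebra_simps sum_distrib_left)
  qed
  have Jsphere: "J c > 0" if c: "\<forall>i. i \<notin> N \<longrightarrow> c i = 0" "l1_norm N c = B" for c
  proof -
    let ?c = "\<lambda>i. c i / B"
    have "l1_norm N ?c = 1" using c(2) B by (simp add: l1_norm_def abs_divide flip: sum_divide_distrib)
    then have "?c \<in> S" using c by (simp add: S_def)
    from \<kappa>(2)[OF this] have "B * \<kappa> \<le> B * F n ?c" using B by (intro mult_left_mono) auto
    also have "\<dots> = F n (\<lambda>i. B * (c i / B))" using Fscale[of B ?c] B by simp
    also have "(\<lambda>i. B * (c i / B)) = c" using B by auto
    finally show ?thesis using JF[of c] B by (simp add: mult.commute)
  qed
  define K where "K = {c. (\<forall>i. i \<notin> N \<longrightarrow> c i = 0) \<and> l1_norm N c \<le> B}"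
  have zeroK: "(\<lambda>_. 0) \<in> K" using B by (simp add: K_def l1_norm_def)
  have contJ: "continuous_on UNIV J"
    unfolding J_def[abs_def]
    by (intro continuous_intros continuous_on_fewnomial_integral)
  have "compact K" unfolding K_def by (rule compact_l1_ball[OF N])
  then obtain c where c: "c \<in> K" "\<And>c'. c' \<in> K \<Longrightarrow> J c \<le> J c'"
    using continuous_attains_inf[OF _ _ continuous_on_subset[OF contJ subset_UNIV], of K] zeroK by blast
  have "J (\<lambda>_. 0) = 0"
  proof -
    have "(LINT u:{0..R}|lborel. max 0 (fewnomial N (\<lambda>_. 0) u - u ^ q)) = (LINT u:{0..R}|lborel. 0 :: real)"
      by (intro set_lebesgue_integral_cong) (auto simp: fewnomial_def)
    then show ?thesis by (simp add: J_def)
  qed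
  then have "J c \<le> 0" using c(2)[OF zeroK] by simp
  \<comment> \<open>The minimum lies inside the ball, so every coordinate may be varied in both
      directions.\<close>
  then have cB: "l1_norm N c < B" using Jsphere[of c] c(1) by (force simp: K_def)
  define P where "P u = fewnomial N c u - u ^ q" for u
  have contP: "continuous_on S' P" for S' unfolding P_def[abs_def] by (intro continuous_intros continuous_on_fewnomial)
  have [measurable]: "P \<in> borel_measurable borel" by (rule borel_measurable_continuous_onI[OF contP])
  have zeros: "finite {u. u > 0 \<and> P u = 0}"
  proof -
    have "fewnomial (insert q N) (c(q := -1)) u = P u" for u
      using N q unfolding fewnomial_def P_def by (auto intro!: sum.cong)
    then show ?thesis using fewnomial_finite_zeros[of "insert q N" q "c(q := -1)"] N by simp
  qed
  have stat: "m i = l * (LINT u:{0..R}|lborel. u ^ i * indicator {u. P u > 0} u)" if i: "i \<in> N" for i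
  proof -
    define I where "I t = (LINT u:{0..R}|lborel. u ^ i * indicator {u. P u + t * u ^ i > 0} u)" for t
    have iint: "set_integrable lborel {0..R} (\<lambda>u. u ^ i * indicator {u. P u + t * u ^ i > 0} u)" for t
    proof (rule set_integrable_bound[OF _ _ AE_I2])
      show "set_integrable lborel {0..R} (\<lambda>u. u ^ i)"
        by (intro set_integrable_continuous_Icc continuous_intros)
      show "set_borel_measurable lborel {0..R} (\<lambda>u. u ^ i * indicator {u. 0 < P u + t * u ^ i} u)"
        unfolding set_borel_measurable_def by measurable
    qed (auto simp: indicator_def)
    \<comment> \<open>The subgradient inequality at the shifted point; using it for small
        \<open>t\<close> of both signs gives both inequalities.\<close>
    have step: "t * m i \<le> l * (t * I t)" if t: "\<bar>t\<bar> \<le> B - l1_norm N c" for t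
    proof -
      let ?c = "c(i := c i + t)"
      have "l1_norm N ?c \<le> l1_norm N c + \<bar>t\<bar>"
      proof -
        have "l1_norm N ?c \<le> (\<Sum>j\<in>N. \<bar>c j\<bar> + (if j = i then \<bar>t\<bar> else 0))"
          unfolding l1_norm_def by (intro sum_mono) (auto intro: abs_triangle_ineq)
        then show ?thesis using N i by (simp add: sum.distrib l1_norm_def)
      qed
      then have "?c \<in> K" using c(1) t i by (auto simp: K_def)
      from c(2)[OF this] have J: "J c \<le> J ?c" .
      have s: "(\<Sum>j\<in>N. ?c j * m j) = (\<Sum>j\<in>N. c j * m j) + t * m i"
      proof -
        have "(\<Sum>j\<in>N. ?c j * m j) = (\<Sum>j\<in>N. c j * m j + (if j = i then t * m i else 0))"
          by (intro sum.cong) (auto simp: algebra_simps)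
        then show ?thesis using N i by (simp add: sum.distrib)
      qed
      have p: "fewnomial N ?c u - u ^ q = P u + t * u ^ i" for u
        using fewnomial_update[OF N i, of c t u] by (simp add: P_def)
      have cint: "set_integrable lborel {0..R} (\<lambda>u. max 0 (P u + t * u ^ i))" for t
        by (intro set_integrable_continuous_Icc continuous_intros contP)
      have cint0: "set_integrable lborel {0..R} (\<lambda>u. max 0 (P u))" using cint[of 0] by simp
      have "(LINT u:{0..R}|lborel. max 0 (P u + t * u ^ i)) - (LINT u:{0..R}|lborel. max 0 (P u))
          = (LINT u:{0..R}|lborel. max 0 (P u + t * u ^ i) - max 0 (P u))"
        by (rule set_integral_diff(2)[symmetric, OF cint cint0])
      also have "\<dots> \<le> (LINT u:{0..R}|lborel. t * (u ^ i * indicator {u. P u + t * u ^ i > 0} u))"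
        using iint[of t]
        by (intro set_integral_mono set_integral_diff(1)[OF cint cint0] set_integrable_mult_right)
          (auto simp: indicator_def max_def)
      also have "\<dots> = t * I t" unfolding I_def by simp
      finally have "l * ((LINT u:{0..R}|lborel. max 0 (P u + t * u ^ i)) - (LINT u:{0..R}|lborel. max 0 (P u))) \<le> l * (t * I t)"
        using l0 by (rule mult_left_mono)
      then show ?thesis using J unfolding J_def p s P_def[symmetric] by (simp add: algebra_simps)
    qed
    have limI: "(\<lambda>k. I (\<tau> k)) \<longlonglongrightarrow> I 0" if \<tau>: "\<tau> \<longlonglongrightarrow> 0" for \<tau> :: "nat \<Rightarrow> real"
      unfolding I_def set_lebesgue_integral_def
    proof (rule integral_dominated_convergence)
      have "integrable lborel (\<lambda>u. indicator {0..R} u *\<^sub>R (u ^ i))"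
        unfolding set_integrable_def[symmetric]
        by (intro set_integrable_continuous_Icc continuous_intros)
      then show "integrable lborel (\<lambda>u. indicator {0..R} u *\<^sub>R (u ^ i))" .
      have "AE u in lborel. u \<notin> insert 0 {u. u > 0 \<and> P u = 0}"
        using zeros by (intro AE_not_in finite_imp_null_set_lborel) auto
      then show "AE u in lborel. (\<lambda>k. indicator {0..R} u *\<^sub>R (u ^ i * indicator {u. 0 < P u + \<tau> k * u ^ i} u))
          \<longlonglongrightarrow> indicator {0..R} u *\<^sub>R (u ^ i * indicator {u. 0 < P u + 0 * u ^ i} u)"
      proof eventually_elim
        case (elim u)
        show ?case
        proof (cases "u \<in> {0..R}")
          case True
          then have nz: "P u \<noteq> 0" using elim by auto
          have lim: "(\<lambda>k. P u + \<tau> k * u ^ i) \<longlonglongrightarrow> P u + 0 * u ^ i"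
            by (intro tendsto_intros \<tau>)
          have "\<forall>\<^sub>F k in sequentially. (0 < P u + \<tau> k * u ^ i) = (0 < P u)"
          proof (cases "P u > 0")
            case True
            have "\<forall>\<^sub>F k in sequentially. 0 < P u + \<tau> k * u ^ i" by (rule order_tendstoD(1)[OF lim]) (use True in simp)
            then show ?thesis by eventually_elim (use True in simp)
          next
            case False
            have "\<forall>\<^sub>F k in sequentially. P u + \<tau> k * u ^ i < 0" by (rule order_tendstoD(2)[OF lim]) (use False nz in simp)
            then show ?thesis by eventually_elim (use False in simp)
          qed
          then have "\<forall>\<^sub>F k in sequentially. indicator {0..R} u *\<^sub>R (u ^ i * indicator {u. 0 < P u + \<tau> k * u ^ i} u)
            = indicator {0..R} u *\<^sub>R (u ^ i * indicator {u. 0 < P u + 0 * u ^ i} u)"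
            by eventually_elim (simp add: indicator_def)
          then show ?thesis by (rule tendsto_eventually)
        qed simp
      qed
    qed (measurable, auto simp: indicator_def)
    define \<tau> where "\<tau> k = (B - l1_norm N c) / real (Suc k)" for k
    have \<tau>: "0 < \<tau> k" "\<tau> k \<le> B - l1_norm N c" for k
    proof -
      have "(B - l1_norm N c) / real (Suc k) \<le> (B - l1_norm N c) / 1"
        using cB by (intro divide_left_mono) auto
      then show "\<tau> k \<le> B - l1_norm N c" by (simp add: \<tau>_def)
    qed (use cB in \<open>simp add: \<tau>_def\<close>)
    have \<tau>0: "\<tau> \<longlonglongrightarrow> 0"
      unfolding \<tau>_def using tendsto_mult[OF tendsto_const LIMSEQ_inverse_real_of_nat] by (simp add: divide_inverse)
    have "m i \<le> l * I (\<tau> k)" for k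
    proof -
      have "\<tau> k * m i \<le> \<tau> k * (l * I (\<tau> k))" using step[of "\<tau> k"] \<tau>[of k] by (simp add: ac_simps)
      then show ?thesis using \<tau>(1)[of k] by simp
    qed
    then have 1: "m i \<le> l * I 0"
      using LIMSEQ_le_const[OF tendsto_mult[OF tendsto_const limI[OF \<tau>0]]] by blast
    have "l * I (- \<tau> k) \<le> m i" for k
    proof -
      have "\<tau> k * (l * I (- \<tau> k)) \<le> \<tau> k * m i" using step[of "- \<tau> k"] \<tau>[of k] by (simp add: ac_simps)
      then show ?thesis using \<tau>(1)[of k] by simp
    qed
    moreover have "(\<lambda>k. - \<tau> k) \<longlonglongrightarrow> 0" using tendsto_minus[OF \<tau>0] by simp
    ultimately have 2: "l * I 0 \<le> m i"
      using LIMSEQ_le_const2[OF tendsto_mult[OF tendsto_const limI]] by blast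
    from 1 2 show ?thesis by (simp add: I_def)
  qed
  show ?thesis
  proof (intro exI ballI)
    fix i assume "i \<in> N"
    from stat[OF this] show "m i = L n * (LINT u:{0..real n}|lborel. u ^ i * indicator {u. fewnomial N c u > u ^ q} u)"
      by (simp add: P_def l_def R_def)
  qed
qed

section \<open>Splines with alternating top derivative\<close>

text \<open>
  Going down from large \<open>u\<close>, the value switches between 0 and 1 at every point of
  \<open>Z\<close>, starting from 0. Up to a factor this is the reflected top derivative of a
  spline with knots \<open>- Z\<close>.
\<close>

definition alternating :: "real set \<Rightarrow> real \<Rightarrow> real" where
  "alternating Z u = (if 0 \<le> u \<and> odd (card {a \<in> Z. u < a}) then 1 else 0)"

lemma alternating_range: "0 \<le> alternating Z u" "alternating Z u \<le> 1"
  by (auto simp: alternating_def)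

lemma alternating_measurable:
  assumes "finite Z" shows "alternating Z \<in> borel_measurable borel"
proof -
  have "card {b \<in> Z. u < b} = (\<Sum>b\<in>Z. if u < b then 1 else 0)" for u
    using assms by (simp add: sum.If_cases Int_def)
  then have "alternating Z = (\<lambda>u. if 0 \<le> u \<and> odd (\<Sum>b\<in>Z. if u < b then 1 else (0::nat)) then 1 else 0)"
    by (auto simp: alternating_def[abs_def])
  also have "\<dots> \<in> borel_measurable borel" by measurable
  finally show ?thesis .
qed

text \<open>
  As the \<open>a j\<close> decrease, the ones above \<open>u\<close> come first, and the
  alternating sum of \<open>k\<close> ones is the parity of \<open>k\<close>.
\<close>

lemma alternating_sum:
  assumes a: "\<forall>i\<in>{1..s}. \<forall>j\<in>{1..s}. i < j \<longrightarrow> a i > (a j :: real)" and u: "u \<ge> 0"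
  shows "(\<Sum>j=1..s. (-1) ^ (j + 1) * indicator {..<a j} u) = alternating (a ` {1..s}) u"
proof -
  have inj: "inj_on a {1..s}"
    by (rule linorder_inj_onI') (use a in fastforce)
  have "\<exists>k\<le>s. {j \<in> {1..s}. u < a j} = {1..k}"
  proof (cases "{j \<in> {1..s}. u < a j} = {}")
    case True
    then show ?thesis by (intro exI[of _ 0]) simp
  next
    case False
    define k where "k = Max {j \<in> {1..s}. u < a j}"
    have k: "k \<in> {j \<in> {1..s}. u < a j}" unfolding k_def using False by (intro Max_in) auto
    have "j \<le> k" if "j \<in> {j \<in> {1..s}. u < a j}" for j unfolding k_def using that by (intro Max_ge) auto
    moreover have "u < a j" if "j \<in> {1..k}" for j
    proof (cases "j = k")
      case False
      then have "a j > a k" using a that k by auto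
      then show ?thesis using k by auto
    qed (use k in auto)
    ultimately show ?thesis using k by (intro exI[of _ k]) auto
  qed
  then obtain k where k: "k \<le> s" "{j \<in> {1..s}. u < a j} = {1..k}" by blast
  have "{b \<in> a ` {1..s}. u < b} = a ` {j \<in> {1..s}. u < a j}" by auto
  moreover have "card (a ` {j \<in> {1..s}. u < a j}) = k"
  proof -
    have "inj_on a {j \<in> {1..s}. u < a j}" by (rule inj_on_subset[OF inj]) blast
    then have "card (a ` {j \<in> {1..s}. u < a j}) = card {j \<in> {1..s}. u < a j}" by (rule card_image)
    then show ?thesis unfolding k(2) by simp
  qed
  ultimately have b: "alternating (a ` {1..s}) u = (if odd k then 1 else 0)" using u by (simp add: alternating_def)
  have "(\<Sum>j=1..s. (-1) ^ (j + 1) * indicator {..<a j} u) = (\<Sum>j\<in>{j \<in> {1..s}. u < a j}. (-1 :: real) ^ (j + 1))"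
    by (rule sum.mono_neutral_cong_right) (auto simp: indicator_def)
  also have "\<dots> = (\<Sum>j=1..k. (-1) ^ (j + 1))" by (simp only: k(2))
  also have "\<dots> = (if odd k then 1 else 0)" by (induction k) auto
  finally show ?thesis using b by simp
qed

lemma has_integral_shifted_power:
  fixes t a :: real
  assumes "t \<le> 0" "a > 0"
  shows "has_bochner_integral lborel (\<lambda>u. if - t \<le> u then (t + u) ^ m / fact m * indicator {..<a} u else 0)
    ((max 0 (t + a)) ^ Suc m / fact (Suc m))"
proof (cases "- t \<le> a")
  case False
  then have "(\<lambda>u. if - t \<le> u then (t + u) ^ m / fact m * indicator {..<a} u else 0) = (\<lambda>u. 0)"
    by (auto simp: indicator_def)
  moreover have "max 0 (t + a) = 0" using False by simp
  ultimately show ?thesis by (simp add: has_bochner_integral_zero)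
next
  case True
  have "has_bochner_integral lborel (\<lambda>u. (t + u) ^ m / fact m * indicator {-t..a} u)
      ((t + a) ^ Suc m / fact (Suc m) - (t + (- t)) ^ Suc m / fact (Suc m))"
  proof (rule has_bochner_integral_FTC_Icc_nonneg)
    fix u assume u: "u \<in> {-t..a}"
    have "((\<lambda>u. (t + u) ^ Suc m) has_real_derivative real (Suc m) * ((0 + 1) * (t + u) ^ (Suc m - Suc 0))) (at u)"
      by (intro DERIV_power DERIV_add DERIV_const DERIV_ident)
    from DERIV_cdivide[OF this, of "fact (Suc m)"]
    show "((\<lambda>u. (t + u) ^ Suc m / fact (Suc m)) has_real_derivative (t + u) ^ m / fact m) (at u)"
      by (simp add: fact_Suc del: of_nat_Suc power_Suc)
    show "0 \<le> (t + u) ^ m / fact m" using u by simp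
  qed (use True in auto)
  then have "has_bochner_integral lborel (\<lambda>u. (t + u) ^ m / fact m * indicator {-t..a} u)
      ((max 0 (t + a)) ^ Suc m / fact (Suc m))" using True by simp
  then show ?thesis
  proof (rule has_bochner_integral_discrete_difference[THEN iffD1, rotated -1])
    show "countable {a}" by simp
  qed (auto simp: indicator_def)
qed

text \<open>
  The integral form makes the nonnegativity of all derivatives evident and, at \<open>t =
  0\<close>, shows them to be moments.
\<close>

lemma spline_eq_integral:
  assumes a: "\<forall>i\<in>{1..s}. \<forall>j\<in>{1..s}. i < j \<longrightarrow> a i > a j" "\<forall>i\<in>{1..s}. a i > 0" and t: "t \<le> 0"
  shows "has_bochner_integral lborel (\<lambda>u. if - t \<le> u then (t + u) ^ m / fact m * (l * alternating (a ` {1..s}) u) else 0)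
    (spline (Suc m) s a l t)"
proof -
  have "has_bochner_integral lborel (\<lambda>u. l * (\<Sum>j=1..s. (-1) ^ (j + 1) * (if - t \<le> u then (t + u) ^ m / fact m * indicator {..<a j} u else 0)))
    (l * (\<Sum>j=1..s. (-1) ^ (j + 1) * ((max 0 (t + a j)) ^ Suc m / fact (Suc m))))"
    by (intro has_bochner_integral_mult_right has_bochner_integral_sum has_integral_shifted_power t) (use a in auto)
  moreover have "l * (\<Sum>j=1..s. (-1) ^ (j + 1) * ((max 0 (t + a j)) ^ Suc m / fact (Suc m))) = spline (Suc m) s a l t"
    unfolding spline_def by (simp add: sum_distrib_left sum_divide_distrib)
  moreover have "l * (\<Sum>j=1..s. (-1) ^ (j + 1) * (if - t \<le> u then (t + u) ^ m / fact m * indicator {..<a j} u else 0))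
      = (if - t \<le> u then (t + u) ^ m / fact m * (l * alternating (a ` {1..s}) u) else 0)" for u
  proof (cases "- t \<le> u")
    case True
    have "(\<Sum>j=1..s. (-1) ^ (j + 1) * ((t + u) ^ m / fact m * indicator {..<a j} u))
      = (t + u) ^ m / fact m * (\<Sum>j=1..s. (-1) ^ (j + 1) * indicator {..<a j} u)"
      unfolding sum_distrib_left by (intro sum.cong) (auto simp: ac_simps)
    also have "\<dots> = (t + u) ^ m / fact m * alternating (a ` {1..s}) u"
      using alternating_sum[OF a(1), of u] True t by simp
    finally show ?thesis using True by simp
  qed simp
  ultimately show ?thesis by simp
qed

lemma max_power_has_derivative:
  "((\<lambda>t. (max 0 (t + a)) ^ Suc (Suc m)) has_real_derivative real (Suc (Suc m)) * (max 0 (t + a)) ^ Suc m) (at t)"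
proof -
  consider "t + a > 0" | "t + a < 0" | "t + a = 0" by linarith
  then show ?thesis
  proof cases
    case 1
    have "\<forall>\<^sub>F y in nhds t. y \<in> {-a<..}" using 1 by (intro eventually_nhds_in_open) auto
    then have ev: "\<forall>\<^sub>F y in nhds t. (max 0 (y + a)) ^ Suc (Suc m) = (y + a) ^ Suc (Suc m)"
      by eventually_elim simp
    have "((\<lambda>y. (y + a) ^ Suc (Suc m)) has_real_derivative
        real (Suc (Suc m)) * ((1 + 0) * (t + a) ^ (Suc (Suc m) - Suc 0))) (at t)"
      by (intro DERIV_power DERIV_add DERIV_const DERIV_ident)
    then have "((\<lambda>y. (y + a) ^ Suc (Suc m)) has_real_derivative real (Suc (Suc m)) * (max 0 (t + a)) ^ Suc m) (at t)"
      using 1 by (simp del: power_Suc of_nat_Suc)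
    then show ?thesis using DERIV_cong_ev[OF refl ev refl] by blast
  next
    case 2
    have "\<forall>\<^sub>F y in nhds t. y \<in> {..<-a}" using 2 by (intro eventually_nhds_in_open) auto
    then have ev: "\<forall>\<^sub>F y in nhds t. (max 0 (y + a)) ^ Suc (Suc m) = 0"
      by eventually_elim simp
    have "((\<lambda>y. 0) has_real_derivative real (Suc (Suc m)) * (max 0 (t + a)) ^ Suc m) (at t)"
      using 2 by simp
    then show ?thesis using DERIV_cong_ev[OF refl ev refl] by blast
  next
    case 3
    then have ta: "t + h + a = h" for h by simp
    have "(\<lambda>h::real. (max 0 h) ^ Suc (Suc m) / h) \<midarrow>0\<rightarrow> 0"
    proof (rule Lim_null_comparison)
      show "\<forall>\<^sub>F h in at 0. norm ((max 0 h) ^ Suc (Suc m) / h) \<le> \<bar>h\<bar> ^ Suc m"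
      proof (rule always_eventually, rule allI)
        fix h :: real
        show "norm ((max 0 h) ^ Suc (Suc m) / h) \<le> \<bar>h\<bar> ^ Suc m"
        proof (cases "h > 0")
          case False
          then have "max 0 h = 0" by simp
          then have 0: "norm ((max 0 h) ^ Suc (Suc m) / h) = 0" by simp
          show ?thesis unfolding 0 by (rule zero_le_power) simp
        next
          case True
          then have "max 0 h = h" by simp
          moreover have "h ^ Suc (Suc m) / h = h ^ Suc m" using True by simp
          ultimately show ?thesis using True by (simp del: power_Suc)
        qed
      qed
      show "(\<lambda>h::real. \<bar>h\<bar> ^ Suc m) \<midarrow>0\<rightarrow> 0" by (rule tendsto_eq_intros | simp)+
    qed
    then show ?thesis unfolding DERIV_def by (simp add: ta 3 del: power_Suc)
  qed
qed

text \<open>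
  Differentiating a spline lowers the order and keeps the knots and the factor \<open>l\<close>.
\<close>

lemma spline_has_derivative:
  assumes "m \<ge> 2"
  shows "(spline m s a l has_real_derivative spline (m - 1) s a l t) (at t)"
proof -
  obtain k where k: "m = Suc (Suc k)" using assms by (metis add_2_eq_Suc le_Suc_ex)
  have "((\<lambda>t. l / fact m * (\<Sum>j=1..s. (-1) ^ (j + 1) * (max 0 (t + a j)) ^ m)) has_real_derivative
     l / fact m * (\<Sum>j=1..s. (-1) ^ (j + 1) * (real m * (max 0 (t + a j)) ^ (m - 1)))) (at t)"
    unfolding k using max_power_has_derivative
    by (intro DERIV_cmult DERIV_sum) simp
  moreover have "l / fact m * (\<Sum>j=1..s. (-1) ^ (j + 1) * (real m * (max 0 (t + a j)) ^ (m - 1))) = spline (m - 1) s a l t"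
  proof -
    have "(\<Sum>j=1..s. (-1) ^ (j + 1) * (real m * (max 0 (t + a j)) ^ (m - 1)))
       = real m * (\<Sum>j=1..s. (-1) ^ (j + 1) * (max 0 (t + a j)) ^ (m - 1))"
      unfolding sum_distrib_left by (intro sum.cong) (auto simp: ac_simps)
    moreover have "fact m = real m * fact (m - 1)" using assms by (simp add: fact_reduce)
    ultimately show ?thesis using assms by (simp add: spline_def)
  qed
  ultimately show ?thesis by (simp add: spline_def[abs_def])
qed

lemma spline_has_vector_derivative_within:
  assumes "m \<ge> 2"
  shows "(spline m s a l has_vector_derivative spline (m - 1) s a l t) (at t within S)"
  by (rule has_vector_derivative_at_within)
    (use spline_has_derivative[OF assms] in \<open>simp add: has_real_derivative_iff_has_vector_derivative\<close>)

lemma spline_1_has_derivative: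
  assumes "\<forall>i\<in>{1..s}. \<forall>j\<in>{1..s}. i < j \<longrightarrow> a i > a j" "t < 0" "- t \<notin> a ` {1..s}"
  shows "(spline 1 s a l has_real_derivative l * alternating (a ` {1..s}) (- t)) (at t)"
proof -
  have 1: "((\<lambda>t. max 0 (t + a j)) has_real_derivative indicator {..<a j} (- t)) (at t)" if j: "j \<in> {1..s}" for j
  proof (cases "t + a j > 0")
    case True
    have "\<forall>\<^sub>F y in nhds t. y \<in> {- a j<..}" using True by (intro eventually_nhds_in_open) auto
    then have ev: "\<forall>\<^sub>F y in nhds t. max 0 (y + a j) = y + a j" by eventually_elim simp
    have "((\<lambda>y. y + a j) has_real_derivative indicator {..<a j} (- t)) (at t)"
      using True by (auto intro!: derivative_eq_intros simp: indicator_def)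
    then show ?thesis using DERIV_cong_ev[OF refl ev refl] by blast
  next
    case False
    then have lt: "t + a j < 0" using assms(3) j by (force simp: image_iff)
    have "\<forall>\<^sub>F y in nhds t. y \<in> {..< - a j}" using lt by (intro eventually_nhds_in_open) auto
    then have ev: "\<forall>\<^sub>F y in nhds t. max 0 (y + a j) = 0" by eventually_elim simp
    have "((\<lambda>y. 0) has_real_derivative indicator {..<a j} (- t)) (at t)"
      using lt by (auto simp: indicator_def)
    then show ?thesis using DERIV_cong_ev[OF refl ev refl] by blast
  qed
  have "((\<lambda>t. l * (\<Sum>j=1..s. (-1) ^ (j + 1) * max 0 (t + a j))) has_real_derivative
     l * (\<Sum>j=1..s. (-1) ^ (j + 1) * indicator {..<a j} (- t))) (at t)"
    by (intro DERIV_cmult DERIV_sum 1)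
  then show ?thesis using alternating_sum[OF assms(1), of "- t"] assms(2) by (simp add: spline_def[abs_def])
qed

lemma at_within_atMost_neq_bot: "t \<le> 0 \<Longrightarrow> at t within {..0::real} \<noteq> bot"
proof -
  assume "t \<le> 0"
  then have "at_left t \<le> at t within {..0}" by (intro at_le) auto
  then show ?thesis using trivial_limit_at_left_real[of t] by (metis bot.extremum_uniqueI)
qed

lemma half_deriv_spline:
  assumes "j < r" "t \<le> 0"
  shows "half_deriv j (spline r s a l) t = spline (r - j) s a l t"
  using assms
proof (induction j arbitrary: t)
  case 0
  then show ?case by (simp add: half_deriv_def)
next
  case (Suc j)
  have "(spline (r - j) s a l has_vector_derivative spline (r - j - 1) s a l t) (at t within {..0})"
    using Suc.prems by (intro spline_has_vector_derivative_within) auto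
  then have "(half_deriv j (spline r s a l) has_vector_derivative spline (r - j - 1) s a l t) (at t within {..0})"
    by (rule has_vector_derivative_transform[rotated -1]) (use Suc in auto)
  from vector_derivative_within[OF at_within_atMost_neq_bot[OF Suc.prems(2)] this]
  show ?case by (simp add: half_deriv_Suc)
qed

lemma half_deriv_spline_top:
  assumes "r \<ge> 1" "\<forall>i\<in>{1..s}. \<forall>j\<in>{1..s}. i < j \<longrightarrow> a i > a j" "t < 0" "- t \<notin> a ` {1..s}"
  shows "half_deriv r (spline r s a l) t = l * alternating (a ` {1..s}) (- t)"
proof -
  have "(spline 1 s a l has_vector_derivative l * alternating (a ` {1..s}) (- t)) (at t within {..0})"
    by (rule has_vector_derivative_at_within)
      (use spline_1_has_derivative[OF assms(2-4), of l] in \<open>simp add: has_real_derivative_iff_has_vector_derivative\<close>)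
  then have "(half_deriv (r - 1) (spline r s a l) has_vector_derivative l * alternating (a ` {1..s}) (- t)) (at t within {..0})"
    by (rule has_vector_derivative_transform[rotated -1])
      (use assms half_deriv_spline[of "r - 1" r _ s a l] in auto)
  moreover have "t \<le> 0" using assms by simp
  ultimately show ?thesis
    using vector_derivative_within[OF at_within_atMost_neq_bot] half_deriv_Suc[of "r - 1" "spline r s a l" t] assms(1) by simp
qed

lemma LinfI:
  assumes "f \<in> borel_measurable (lebesgue_on {..0})" "AE t in lebesgue_on {..0}. \<bar>f t\<bar> \<le> C"
  shows "f \<in> Linf" "Linf_norm f \<le> ereal C"
proof -
  have m: "(\<lambda>t. ereal \<bar>f t\<bar>) \<in> borel_measurable (lebesgue_on {..0})" using assms(1) by simp
  have "AE t in lebesgue_on {..0}. ereal \<bar>f t\<bar> \<le> ereal C" using assms(2) by simp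
  then show le: "Linf_norm f \<le> ereal C" unfolding Linf_norm_def by (rule esssup_I[OF m])
  then show "f \<in> Linf" using assms(1) by (auto simp: Linf_def intro: le_less_trans)
qed

lemma lipschitz_abs_continuous_on:
  assumes C: "C \<ge> 0" and lip: "\<And>u v. a \<le> u \<Longrightarrow> u \<le> v \<Longrightarrow> v \<le> b \<Longrightarrow> \<bar>f v - f u\<bar> \<le> C * (v - u)"
  shows "abs_continuous_on a b f"
  unfolding abs_continuous_on_def
proof (intro allI impI)
  fix \<epsilon> :: real assume \<epsilon>: "\<epsilon> > 0"
  show "\<exists>\<delta>>0. \<forall>(n::nat) u v.
        (\<forall>i<n. a \<le> u i \<and> u i \<le> v i \<and> v i \<le> b) \<longrightarrow>
        (\<forall>i<n. \<forall>j<n. i \<noteq> j \<longrightarrow> {u i<..<v i} \<inter> {u j<..<v j} = {}) \<longrightarrow>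
        (\<Sum>i<n. v i - u i) < \<delta> \<longrightarrow>
        (\<Sum>i<n. \<bar>f (v i) - f (u i)\<bar>) < \<epsilon>"
  proof (intro exI[of _ "\<epsilon> / (C + 1)"] conjI allI impI)
    show "\<epsilon> / (C + 1) > 0" using \<epsilon> C by simp
    fix n :: nat and u v :: "nat \<Rightarrow> real"
    assume uv: "\<forall>i<n. a \<le> u i \<and> u i \<le> v i \<and> v i \<le> b" and s: "(\<Sum>i<n. v i - u i) < \<epsilon> / (C + 1)"
    have s0: "(\<Sum>i<n. v i - u i) \<ge> 0" using uv by (intro sum_nonneg) auto
    have "(\<Sum>i<n. \<bar>f (v i) - f (u i)\<bar>) \<le> (\<Sum>i<n. C * (v i - u i))"
      using uv by (intro sum_mono lip) auto
    also have "\<dots> = C * (\<Sum>i<n. v i - u i)" by (simp add: sum_distrib_left)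
    also have "\<dots> \<le> (C + 1) * (\<Sum>i<n. v i - u i)" using s0 by (intro mult_right_mono) auto
    also have "\<dots> < \<epsilon>" using s C by (simp add: field_simps)
    finally show "(\<Sum>i<n. \<bar>f (v i) - f (u i)\<bar>) < \<epsilon>" .
  qed
qed

text \<open>
  The value is 1 between the largest point of \<open>Z\<close> and the next one, or 0 if there is
  none.
\<close>

lemma alternating_one_interval:
  assumes "finite Z" "Z \<noteq> {}" "Z \<subseteq> {0<..}"
  obtains b c where "0 \<le> b" "b < c" "\<And>u. u \<in> {b<..<c} \<Longrightarrow> alternating Z u = 1"
proof -
  define c where "c = Max Z"
  have "c \<in> Z" unfolding c_def by (rule Max_in[OF assms(1,2)])
  moreover have "c > 0" using \<open>c \<in> Z\<close> assms(3) by auto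
  moreover have "z \<le> c" if "z \<in> Z" for z unfolding c_def by (rule Max_ge[OF assms(1) that])
  ultimately have c: "c \<in> Z" "c > 0" "\<And>z. z \<in> Z \<Longrightarrow> z \<le> c" by auto
  define b where "b = Max (insert 0 (Z - {c}))"
  have b1: "b \<in> insert 0 (Z - {c})" unfolding b_def by (rule Max_in) (use assms(1) in auto)
  have b2: "z \<le> b" if "z \<in> insert 0 (Z - {c})" for z
    unfolding b_def by (rule Max_ge[OF _ that]) (use assms(1) in simp)
  note b = b1 b2
  have bc: "b < c" using b1 c(2) c(3)[of b] by (auto simp: less_le)
  show ?thesis
  proof (rule that[of b c])
    show "0 \<le> b" using b(2) by simp
    then show "alternating Z u = 1" if "u \<in> {b<..<c}" for u
    proof -
      have "{a \<in> Z. u < a} = {c}" using that c b(2) by force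
      then show ?thesis using that \<open>0 \<le> b\<close> by (auto simp: alternating_def)
    qed
  qed (rule bc)
qed

theorem spline_properties:
  assumes r: "r \<ge> 1" and s: "s \<ge> 1" and a: "\<forall>i\<in>{1..s}. \<forall>j\<in>{1..s}. i < j \<longrightarrow> a i > a j" "\<forall>i\<in>{1..s}. a i > 0"
    and l: "l > 0"
  defines "Z \<equiv> a ` {1..s}"
  shows "spline r s a l \<in> L_monotone r"
    and "Linf_norm (half_deriv r (spline r s a l)) = ereal l"
    and "\<And>j. j < r \<Longrightarrow> has_bochner_integral lborel (\<lambda>u. u ^ (r - 1 - j) * (l * alternating Z u))
           (fact (r - 1 - j) * half_deriv j (spline r s a l) 0)"
proof -
  let ?\<phi> = "spline r s a l"
  have Z: "finite Z" "Z \<noteq> {}" "Z \<subseteq> {0<..}" using s a(2) by (auto simp: Z_def)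
  have hd: "half_deriv j ?\<phi> t = spline (Suc (r - 1 - j)) s a l t" if "j < r" "t \<le> 0" for j t
    using half_deriv_spline[OF that, of s a l] that by (simp add: Suc_diff_Suc)
  have nn: "half_deriv j ?\<phi> t \<ge> 0" if j: "j < r" "t \<le> 0" for j t
  proof -
    have "0 \<le> (\<integral>u. (if - t \<le> u then (t + u) ^ (r - 1 - j) / fact (r - 1 - j) * (l * alternating Z u) else 0) \<partial>lborel)"
      by (intro Bochner_Integration.integral_nonneg) (use l alternating_range(1) in auto)
    then show ?thesis
      using spline_eq_integral[OF a j(2), of "r - 1 - j" l] unfolding Z_def hd[OF j]
      by (simp add: has_bochner_integral_iff)
  qed
  have top: "half_deriv r ?\<phi> t = l * alternating Z (- t)" if "t < 0" "- t \<notin> Z" for t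
    unfolding Z_def by (rule half_deriv_spline_top[OF r a(1)]) (use that in \<open>auto simp: Z_def\<close>)
  have diffb: "half_deriv j ?\<phi> differentiable_on {..0}" if "j < r - 1" for j
    unfolding differentiable_on_def
  proof
    fix t :: real assume t: "t \<in> {..0}"
    have "(spline (r - j) s a l has_vector_derivative spline (r - j - 1) s a l t) (at t within {..0})"
      using that by (intro spline_has_vector_derivative_within) auto
    then have "(half_deriv j ?\<phi> has_vector_derivative spline (r - j - 1) s a l t) (at t within {..0})"
      by (rule has_vector_derivative_transform[rotated -1]) (use half_deriv_spline[of j r _ s a l] that t in auto)
    then show "half_deriv j ?\<phi> differentiable at t within {..0}"
      by (rule differentiableI_vector)
  qed
  have lac: "loc_abs_continuous (half_deriv (r - 1) ?\<phi>)"
    unfolding loc_abs_continuous_def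
  proof (intro allI impI)
    fix b c :: real assume bc: "b \<le> c \<and> c \<le> 0"
    show "abs_continuous_on b c (half_deriv (r - 1) ?\<phi>)"
    proof (rule lipschitz_abs_continuous_on[of "l * real s"])
      fix u v assume uv: "b \<le> u" "u \<le> v" "v \<le> c"
      have "half_deriv (r - 1) ?\<phi> v - half_deriv (r - 1) ?\<phi> u = l * (\<Sum>j=1..s. (-1) ^ (j + 1) * max 0 (v + a j))
          - l * (\<Sum>j=1..s. (-1) ^ (j + 1) * max 0 (u + a j))"
        using hd[of "r - 1" v] hd[of "r - 1" u] uv bc r by (simp add: spline_def)
      also have "\<dots> = l * (\<Sum>j=1..s. (-1) ^ (j + 1) * (max 0 (v + a j) - max 0 (u + a j)))"
        by (simp only: right_diff_distrib sum_subtractf)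
      finally have "half_deriv (r - 1) ?\<phi> v - half_deriv (r - 1) ?\<phi> u
          = l * (\<Sum>j=1..s. (-1) ^ (j + 1) * (max 0 (v + a j) - max 0 (u + a j)))" .
      moreover have "\<bar>\<Sum>j=1..s. (-1) ^ (j + 1) * (max 0 (v + a j) - max 0 (u + a j))\<bar> \<le> (\<Sum>j=1..s. v - u)"
        by (rule order_trans[OF sum_abs sum_mono]) (use uv in \<open>auto simp: abs_mult max_def\<close>)
      ultimately show "\<bar>half_deriv (r - 1) ?\<phi> v - half_deriv (r - 1) ?\<phi> u\<bar> \<le> l * real s * (v - u)"
        using l by (simp add: abs_mult)
    qed (use l in simp)
  qed
  have contspline: "continuous_on UNIV ?\<phi>" unfolding spline_def[abs_def] by (intro continuous_intros)
  have inf0: "?\<phi> \<in> Linf"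
  proof (rule LinfI(1))
    show "?\<phi> \<in> borel_measurable (lebesgue_on {..0})"
      by (rule continuous_imp_measurable_on_sets_lebesgue[OF continuous_on_subset[OF contspline]]) auto
    show "AE t in lebesgue_on {..0}. \<bar>?\<phi> t\<bar> \<le> l / fact r * (\<Sum>j=1..s. a j ^ r)"
    proof (rule AE_I2)
      fix t :: real assume "t \<in> space (lebesgue_on {..0})"
      then have t: "t \<le> 0" by simp
      have "\<bar>\<Sum>j=1..s. (-1) ^ (j + 1) * (max 0 (t + a j)) ^ r\<bar> \<le> (\<Sum>j=1..s. a j ^ r)"
      proof (rule order_trans[OF sum_abs sum_mono])
        fix j assume j: "j \<in> {1..s}"
        have "(max 0 (t + a j)) ^ r \<le> a j ^ r" using a(2) j t by (intro power_mono) (auto intro: less_imp_le)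
        then show "\<bar>(-1) ^ (j + 1) * (max 0 (t + a j)) ^ r\<bar> \<le> a j ^ r" by (simp add: abs_mult)
      qed
      then show "\<bar>?\<phi> t\<bar> \<le> l / fact r * (\<Sum>j=1..s. a j ^ r)"
        unfolding spline_def abs_mult using l by (intro mult_mono) auto
    qed
  qed
  have bm: "alternating Z \<in> borel_measurable borel" by (rule alternating_measurable[OF Z(1)])
  have topm: "half_deriv r ?\<phi> \<in> borel_measurable (lebesgue_on {..0})"
  proof (rule measurable_discrete_difference[of "\<lambda>t. l * alternating Z (- t)" _ _ "insert 0 (uminus ` Z) \<inter> {..0}"])
    have "(\<lambda>t. l * alternating Z (- t)) \<in> borel_measurable lebesgue"
      using bm by (intro measurable_completion) simp
    then show "(\<lambda>t. l * alternating Z (- t)) \<in> borel_measurable (lebesgue_on {..0})"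
      by (rule measurable_restrict_space1)
    show "countable (insert 0 (uminus ` Z) \<inter> {..0})" using Z(1) by (intro countable_finite) auto
    fix t assume "t \<in> space (lebesgue_on {..0})" "t \<notin> insert 0 (uminus ` Z) \<inter> {..0}"
    then have "t < 0" "- t \<notin> Z" by (auto simp: image_iff)
    then show "l * alternating Z (- t) = half_deriv r ?\<phi> t" using top by simp
  next
    fix t assume "t \<in> insert 0 (uminus ` Z) \<inter> {..0}"
    then show "{t} \<in> sets (lebesgue_on {..0})" by (subst sets_restrict_space_iff) auto
  qed simp_all
  have AEtop: "AE t in lebesgue_on {..0}. half_deriv r ?\<phi> t = l * alternating Z (- t)"
  proof -
    have "insert 0 (uminus ` Z) \<in> null_sets lebesgue"
    proof -
      have "finite (insert 0 (uminus ` Z))" using Z(1) by simp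
      from null_sets_completionI[OF finite_imp_null_set_lborel[OF this]] show ?thesis .
    qed
    then have "AE t in lebesgue. t \<notin> insert 0 (uminus ` Z)" by (rule AE_not_in)
    then have "AE t in lebesgue. t \<in> {..0} \<longrightarrow> half_deriv r ?\<phi> t = l * alternating Z (- t)"
    proof eventually_elim
      case (elim t)
      then have "- t \<notin> Z" "t \<noteq> 0" by (auto simp: image_iff)
      then show ?case using top[of t] by auto
    qed
    then show ?thesis by (subst AE_restrict_space_iff) auto
  qed
  have AEbd: "AE t in lebesgue_on {..0}. \<bar>half_deriv r ?\<phi> t\<bar> \<le> l"
    using AEtop by eventually_elim (use l alternating_range(1,2) in \<open>auto simp: abs_mult\<close>)
  have AEnn: "AE t in lebesgue_on {..0}. half_deriv r ?\<phi> t \<ge> 0"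
    using AEtop by eventually_elim (use l alternating_range(1) in auto)
  show "?\<phi> \<in> L_monotone r"
    using inf0 diffb lac LinfI(1)[OF topm AEbd] nn AEnn by (auto simp: L_monotone_def L_space_def)
  show "Linf_norm (half_deriv r ?\<phi>) = ereal l"
  proof (rule antisym)
    show "Linf_norm (half_deriv r ?\<phi>) \<le> ereal l" by (rule LinfI(2)[OF topm AEbd])
    show "ereal l \<le> Linf_norm (half_deriv r ?\<phi>)"
    proof (rule ccontr)
      assume "\<not> ?thesis"
      then have lt: "Linf_norm (half_deriv r ?\<phi>) < ereal l" by (simp only: not_le)
      have "AE t in lebesgue_on {..0}. ereal \<bar>half_deriv r ?\<phi> t\<bar> \<le> Linf_norm (half_deriv r ?\<phi>)"
        unfolding Linf_norm_def by (rule esssup_AE)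
      with AEtop have "AE t in lebesgue_on {..0}. alternating Z (- t) \<noteq> 1"
      proof eventually_elim
        case (elim t)
        from elim(2) lt have "ereal \<bar>half_deriv r ?\<phi> t\<bar> < ereal l" by (rule le_less_trans)
        then show ?case using elim(1) l by auto
      qed
      from AE_lebesgue_on_negligible[OF this] have neg: "negligible {t. t \<le> 0 \<and> \<not> (alternating Z (- t) \<noteq> 1)}" .
      obtain b c where bc: "0 \<le> b" "b < c" "\<And>u. u \<in> {b<..<c} \<Longrightarrow> alternating Z u = 1"
        using alternating_one_interval[OF Z] by blast
      have "{-c<..<-b} \<subseteq> {t. t \<le> 0 \<and> \<not> (alternating Z (- t) \<noteq> 1)}" using bc by auto
      then have "negligible {-c<..<-b}" using neg negligible_subset by blast
      moreover have "\<not> negligible {-c<..<-b}" using bc by (intro open_not_negligible) auto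
      ultimately show False by simp
    qed
  qed
  fix j assume j: "j < r"
  have "has_bochner_integral lborel (\<lambda>u. fact (r - 1 - j) * (if - 0 \<le> u then (0 + u) ^ (r - 1 - j) / fact (r - 1 - j) * (l * alternating Z u) else 0))
    (fact (r - 1 - j) * half_deriv j ?\<phi> 0)"
    unfolding hd[OF j order_refl] Z_def
    by (intro has_bochner_integral_mult_right spline_eq_integral a order_refl)
  moreover have "fact (r - 1 - j) * (if - 0 \<le> u then (0 + u) ^ (r - 1 - j) / fact (r - 1 - j) * (l * alternating Z u) else 0)
      = u ^ (r - 1 - j) * (l * alternating Z u)" for u
    by (auto simp: alternating_def)
  ultimately show "has_bochner_integral lborel (\<lambda>u. u ^ (r - 1 - j) * (l * alternating Z u))
           (fact (r - 1 - j) * half_deriv j ?\<phi> 0)" by simp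
qed

section \<open>Existence and minimality of extremal splines\<close>

lemma prod_sign:
  fixes u :: real
  assumes "finite Y" "u \<notin> Y"
  shows "(\<Prod>a\<in>Y. u - a) \<noteq> 0 \<and> ((\<Prod>a\<in>Y. u - a) < 0 \<longleftrightarrow> odd (card {a \<in> Y. u < a}))"
  using assms
proof (induction Y)
  case (insert b Y)
  let ?P = "\<Prod>a\<in>Y. u - a"
  have IH: "?P \<noteq> 0" "?P < 0 \<longleftrightarrow> odd (card {a \<in> Y. u < a})" and ub: "u \<noteq> b"
    using insert by auto
  have prod: "(\<Prod>a\<in>insert b Y. u - a) = (u - b) * ?P" using insert.hyps by simp
  show ?case
  proof (cases "u < b")
    case True
    have "{a \<in> insert b Y. u < a} = insert b {a \<in> Y. u < a}" using True by auto
    then have "card {a \<in> insert b Y. u < a} = Suc (card {a \<in> Y. u < a})" using insert.hyps by simp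
    moreover have "(u - b) * ?P < 0 \<longleftrightarrow> \<not> ?P < 0"
    proof (cases "?P < 0")
      case P: True
      have "0 < (u - b) * ?P" using True P by (intro mult_neg_neg) auto
      then show ?thesis using P by simp
    next
      case P: False
      then have "?P > 0" using IH(1) by linarith
      then have "(u - b) * ?P < 0" using True by (intro mult_neg_pos) auto
      then show ?thesis using P by simp
    qed
    ultimately show ?thesis unfolding prod using IH ub by simp
  next
    case False
    have "{a \<in> insert b Y. u < a} = {a \<in> Y. u < a}" using False by auto
    moreover have "(u - b) * ?P < 0 \<longleftrightarrow> ?P < 0"
      using False ub by (simp add: mult_less_0_iff)
    ultimately show ?thesis unfolding prod using IH ub by simp
  qed
qed simp

lemma AE_open_ex:
  fixes U :: "real set"
  assumes "AE u in lborel. P u" "open U" "U \<noteq> {}"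
  shows "\<exists>u\<in>U. P u"
proof (rule ccontr)
  assume n: "\<not> ?thesis"
  have "AE u in lebesgue. P u" using assms(1) by (rule AE_completion)
  then obtain N where N: "N \<in> null_sets lebesgue" "{u \<in> space lebesgue. \<not> P u} \<subseteq> N"
    unfolding eventually_ae_filter by blast
  then have "U \<subseteq> N" using n by auto
  then have "negligible U" using N(1) negligible_subset negligible_iff_null_sets by blast
  then show False using open_not_negligible assms(2,3) by blast
qed

lemma fewnomial_integral:
  assumes "\<And>i. i \<in> N \<Longrightarrow> integrable lborel (\<lambda>u. u ^ i * g u)"
  shows "has_bochner_integral lborel (\<lambda>u. fewnomial N c u * g u) (\<Sum>i\<in>N. c i * moment g i)"
proof -
  have "has_bochner_integral lborel (\<lambda>u. \<Sum>i\<in>N. c i * (u ^ i * g u)) (\<Sum>i\<in>N. c i * moment g i)"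
    by (intro has_bochner_integral_sum has_bochner_integral_mult_right has_bochner_integral_integrable assms)
  moreover have "(\<Sum>i\<in>N. c i * (u ^ i * g u)) = fewnomial N c u * g u" for u
    by (simp add: fewnomial_def sum_distrib_right mult.assoc)
  ultimately show ?thesis by simp
qed

lemma AE_not_finite: "finite (A :: real set) \<Longrightarrow> AE u in lborel. u \<notin> A"
  by (intro AE_not_in finite_imp_null_set_lborel)

text \<open>
  Strictness comes from the finiteness of the zero set of the polynomial.
\<close>

lemma nonpos_fewnomial_moments_neg:
  assumes N: "finite N" "i \<in> N" "c i \<noteq> 0" and nonpos: "\<And>u. u > 0 \<Longrightarrow> fewnomial N c u \<le> 0"
    and g: "\<And>u. 0 \<le> g u" "\<And>u. u < 0 \<Longrightarrow> g u = 0" and int: "\<And>i. i \<in> N \<Longrightarrow> integrable lborel (\<lambda>u. u ^ i * g u)"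
    and pos: "j \<in> N" "moment g j \<noteq> 0"
  shows "(\<Sum>i\<in>N. c i * moment g i) < 0"
proof -
  let ?I = "\<Sum>i\<in>N. c i * moment g i"
  have "has_bochner_integral lborel (\<lambda>u. - (fewnomial N c u * g u)) (- ?I)"
    by (intro has_bochner_integral_minus fewnomial_integral int)
  then have I: "integrable lborel (\<lambda>u. - (fewnomial N c u * g u))" "(\<integral>u. - (fewnomial N c u * g u) \<partial>lborel) = - ?I"
    by (auto simp: has_bochner_integral_iff)
  have A: "AE u in lborel. 0 \<le> - (fewnomial N c u * g u)"
    using AE_not_finite[of "{0}"]
  proof (rule AE_mp[OF _ AE_I2])
    fix u :: real
    show "u \<notin> {0} \<longrightarrow> 0 \<le> - (fewnomial N c u * g u)"
      using nonpos[of u] g[of u] by (cases "u > 0") (auto simp: mult_nonpos_nonneg not_less)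
  qed simp
  have "?I \<le> 0" using integral_nonneg_AE[OF A] I(2) by simp
  moreover have "?I \<noteq> 0"
  proof
    assume "?I = 0"
    then have "AE u in lborel. - (fewnomial N c u * g u) = 0"
      using integral_nonneg_eq_0_iff_AE[OF I(1) A] I(2) by simp
    moreover have "AE u in lborel. u \<notin> insert 0 {u. u > 0 \<and> fewnomial N c u = 0}"
      using fewnomial_finite_zeros[of N i c] N by (intro AE_not_finite) auto
    ultimately have "AE u in lborel. u ^ j * g u = 0"
    proof eventually_elim
      case (elim u)
      then show ?case using g(2)[of u] by (cases "u > 0") (auto simp: not_less)
    qed
    then have "moment g j = 0" by (rule integral_eq_zero_AE)
    then show False using pos(2) by simp
  qed
  ultimately show ?thesis by simp
qed

lemma continuous_pos_part_integral_pos: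
  fixes f :: "real \<Rightarrow> real"
  assumes f: "continuous_on UNIV f" and u0: "0 < u0" "f u0 > 0" "u0 < R"
  shows "(LINT u:{0..R}|lborel. max 0 (f u)) > 0"
proof -
  have i: "integrable lborel (\<lambda>u. indicator {0..R} u *\<^sub>R max 0 (f u))"
    unfolding set_integrable_def[symmetric]
    by (intro set_integrable_continuous_Icc continuous_intros f)
  have A: "AE u in lborel. 0 \<le> indicator {0..R} u *\<^sub>R max 0 (f u)" by (rule AE_I2) simp
  have "(LINT u:{0..R}|lborel. max 0 (f u)) \<ge> 0" by (rule set_integral_nonneg) simp
  moreover have "(LINT u:{0..R}|lborel. max 0 (f u)) \<noteq> 0"
  proof
    assume "(LINT u:{0..R}|lborel. max 0 (f u)) = 0"
    then have z: "AE u in lborel. indicator {0..R} u *\<^sub>R max 0 (f u) = 0"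
      using integral_nonneg_eq_0_iff_AE[OF i A] by (simp add: set_lebesgue_integral_def)
    have "open ({0<..<R} \<inter> {u. 0 < f u})"
      by (intro open_Int open_Collect_less f continuous_on_const open_greaterThanLessThan)
    moreover have "u0 \<in> {0<..<R} \<inter> {u. 0 < f u}" using u0 by simp
    ultimately obtain u where "u \<in> {0<..<R} \<inter> {u. 0 < f u}" "indicator {0..R} u *\<^sub>R max 0 (f u) = 0"
      using AE_open_ex[OF z] by blast
    then show False by simp
  qed
  ultimately show ?thesis by simp
qed

text \<open>
  The set \<open>Q\<^sub>c > u\<^sup>q\<close> of \<open>bang_bang_moments\<close>, with
  \<open>q\<close> above all exponents, is bounded and changes at the zeros of odd multiplicity of
  a polynomial with \<open>card N + 1\<close> terms, hence at no more than \<open>card N\<close>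
  points. Cutting it off at \<open>R = n\<close> does not add a knot: if the indicator function is
  1 just before \<open>R\<close>, then there is a change after \<open>R\<close>, which the cut
  replaces.
\<close>

theorem alternating_moments_solvable:
  fixes L :: "nat \<Rightarrow> real"
  assumes N: "finite N" and q: "\<And>i. i \<in> N \<Longrightarrow> i < q" and j: "j \<in> N" "m j > 0"
    and L: "\<And>n. L n \<ge> 0" "mono L"
    and coercive: "\<And>c. \<exists>i\<in>N. c i \<noteq> 0 \<Longrightarrow>
      \<exists>n. (\<Sum>i\<in>N. c i * m i) < L n * pos_mass N (real n) c"
  obtains n Z where "finite Z" "Z \<noteq> {}" "Z \<subseteq> {0<..}" "card Z \<le> card N" "L n > 0"
    "\<And>i. i \<in> N \<Longrightarrow> m i = L n * moment (alternating Z) i"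
proof -
  have qN: "q \<notin> N" using q by blast
  obtain n c where nc: "\<forall>i\<in>N. m i = L n * (LINT u:{0..real n}|lborel. u ^ i * indicator {u. fewnomial N c u > u ^ q} u)"
    using bang_bang_moments[OF N qN L coercive] by blast
  define R where "R = real n"
  define c' where "c' i = (if i = q then 1 else - c i)" for i
  have p: "fewnomial (insert q N) c' u = u ^ q - fewnomial N c u" for u
  proof -
    have "(\<Sum>i\<in>N. c' i * u ^ i) = - fewnomial N c u"
      unfolding fewnomial_def sum_negf[symmetric] using qN by (intro sum.cong) (auto simp: c'_def)
    then show ?thesis using N qN by (simp add: fewnomial_def c'_def)
  qed
  have "\<forall>\<^sub>F u in at_top. poly (few_poly (insert q N) c') u > 0"
    using fewnomial_eventually_pos[OF N q, of c'] by (simp add: c'_def)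
  from poly_sign_factor[OF this] obtain Y V where Y: "finite Y"
    "Y \<subseteq> {u. u > 0 \<and> poly (few_poly (insert q N) c') u = 0}"
    "few_poly (insert q N) c' = (\<Prod>a\<in>Y. [:- a, 1:]) * V" "\<forall>u>0. poly V u \<ge> 0" by blast
  have f: "u ^ q - fewnomial N c u = (\<Prod>a\<in>Y. u - a) * poly V u" for u
  proof -
    have "poly (few_poly (insert q N) c') u = poly ((\<Prod>a\<in>Y. [:- a, 1:]) * V) u" using Y(3) by simp
    then show ?thesis by (simp add: poly_prod p)
  qed
  have cardY: "card Y \<le> card N"
  proof -
    have "card Y < card (insert q N)"
      using Y(1,2) N by (intro fewnomial_zeros_less_card[of "insert q N" q c']) (auto simp: c'_def)
    then show ?thesis using N qN by simp
  qed
  have zeros: "finite {u. u > 0 \<and> fewnomial (insert q N) c' u = 0}"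
    using N by (intro fewnomial_finite_zeros[of _ q]) (auto simp: c'_def)
  \<comment> \<open>An odd number of changes at or after \<open>R\<close> means that the indicator
      function is 1 just before \<open>R\<close>.\<close>
  define Z where "Z = (Y \<inter> {..<R}) \<union> (if odd (card (Y \<inter> {R..})) then {R} else {})"
  have Z: "finite Z" using Y(1) by (simp add: Z_def)
  have cardZ: "card Z \<le> card N"
  proof -
    have "card Z \<le> card (Y \<inter> {..<R}) + card (Y \<inter> {R..})"
      unfolding Z_def by (rule order_trans[OF card_Un_le]) (auto simp: Suc_le_eq intro: odd_pos)
    also have "\<dots> = card ((Y \<inter> {..<R}) \<union> (Y \<inter> {R..}))"
      using Y(1) by (subst card_Un_disjoint) auto
    also have "(Y \<inter> {..<R}) \<union> (Y \<inter> {R..}) = Y" by auto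
    finally show ?thesis using cardY by simp
  qed
  have bang_ge: "alternating Z u = 0" if "u \<ge> R" for u
  proof -
    have "{a \<in> Z. u < a} = {}" using that by (auto simp: Z_def)
    then show ?thesis unfolding alternating_def by (simp only: card.empty) simp
  qed
  have bang_lt: "alternating Z u = (if odd (card {a \<in> Y. u < a}) then 1 else 0)" if u: "0 \<le> u" "u < R" for u
  proof -
    let ?A = "{a \<in> Y. u < a \<and> a < R}" and ?B = "Y \<inter> {R..}"
    have "{a \<in> Y. u < a} = ?A \<union> ?B" using u by auto
    then have c1: "card {a \<in> Y. u < a} = card ?A + card ?B"
      using Y(1) by (simp add: card_Un_disjoint disjoint_iff)
    have "{a \<in> Z. u < a} = ?A \<union> (if odd (card ?B) then {R} else {})"
      using u by (auto simp: Z_def)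
    then have c2: "card {a \<in> Z. u < a} = card ?A + (if odd (card ?B) then 1 else 0)"
      using Y(1) by (simp add: card_insert_if)
    show ?thesis unfolding alternating_def using u c1 c2 by simp
  qed
  have eq: "m i = L n * moment (alternating Z) i" if i: "i \<in> N" for i
  proof -
    have [measurable]: "fewnomial N c \<in> borel_measurable borel"
      by (rule borel_measurable_continuous_onI[OF continuous_on_fewnomial])
    have [measurable]: "alternating Z \<in> borel_measurable borel" by (rule alternating_measurable[OF Z])
    have "(LINT u:{0..R}|lborel. u ^ i * indicator {u. fewnomial N c u > u ^ q} u) = moment (alternating Z) i"
      unfolding set_lebesgue_integral_def
    proof (rule integral_cong_AE)
      show "AE u in lborel. indicator {0..R} u *\<^sub>R (u ^ i * indicator {u. u ^ q < fewnomial N c u} u) = u ^ i * alternating Z u"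
      proof -
        have AE0: "AE u in lborel. u \<notin> insert 0 (insert R {u. u > 0 \<and> fewnomial (insert q N) c' u = 0})"
          using zeros by (intro AE_not_finite) auto
        have pt: "indicator {0..R} u *\<^sub>R (u ^ i * indicator {u. u ^ q < fewnomial N c u} u) = u ^ i * alternating Z u"
          if u: "u \<notin> insert 0 (insert R {u. u > 0 \<and> fewnomial (insert q N) c' u = 0})" for u
        proof -
        have "u \<noteq> 0" "u \<noteq> R" using u by auto
        then consider "u < 0" | "u > R" | "0 < u" "u < R" by linarith
        then show "indicator {0..R} u *\<^sub>R (u ^ i * indicator {u. u ^ q < fewnomial N c u} u) = u ^ i * alternating Z u"
        proof cases
          case 1
          then show ?thesis by (simp add: alternating_def)
        next
          case 2
          then show ?thesis using bang_ge[of u] by simp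
        next
          case 3
          then have nz: "u ^ q - fewnomial N c u \<noteq> 0" using u p by auto
          then have uY: "u \<notin> Y" "poly V u \<noteq> 0" using f[of u] Y(1) by auto
          then have V: "poly V u > 0" using Y(4) 3 by (simp add: less_le)
          have "fewnomial N c u > u ^ q \<longleftrightarrow> (\<Prod>a\<in>Y. u - a) * poly V u < 0" using f[of u] by linarith
          also have "\<dots> \<longleftrightarrow> odd (card {a \<in> Y. u < a})"
            using prod_sign[OF Y(1) uY(1)] V by (simp add: mult_less_0_iff not_less)
          finally show ?thesis using 3 bang_lt[of u] by (simp add: indicator_def)
        qed
        qed
        show ?thesis using AE0 by eventually_elim (rule pt)
      qed
    qed measurable
    then show ?thesis using nc i by (simp add: R_def)
  qed
  have mj: "L n * moment (alternating Z) j > 0" using eq[OF j(1)] j(2) by simp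
  then have "L n \<noteq> 0" by auto
  then have Ln: "L n > 0" using L(1)[of n] by simp
  have Zne: "Z \<noteq> {}"
  proof
    assume "Z = {}"
    then have "alternating Z u = 0" for u by (simp add: alternating_def)
    then show False using mj by simp
  qed
  have "R > 0"
  proof (rule ccontr)
    assume "\<not> R > 0"
    then have "alternating Z u = 0" for u using bang_ge[of u] by (cases "u \<ge> 0") (auto simp: alternating_def)
    then show False using mj by simp
  qed
  then have "Z \<subseteq> {0<..}" using Y(2) by (auto simp: Z_def split: if_splits)
  then show ?thesis using that Z Zne cardZ Ln eq by blast
qed

text \<open>
  What the moment arguments use of a spline, with its coefficients hidden.
\<close>

definition knots :: "nat \<Rightarrow> (real \<Rightarrow> real) \<Rightarrow> real set \<Rightarrow> real \<Rightarrow> bool" where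
  "knots r \<phi> Z l \<longleftrightarrow> finite Z \<and> Z \<noteq> {} \<and> Z \<subseteq> {0<..} \<and> l > 0 \<and> \<phi> \<in> L_monotone r
    \<and> Linf_norm (half_deriv r \<phi>) = ereal l
    \<and> (\<forall>j<r. has_bochner_integral lborel (\<lambda>u. u ^ (r - 1 - j) * (l * alternating Z u))
           (fact (r - 1 - j) * half_deriv j \<phi> 0))"

lemma Phi_knots:
  assumes "\<phi> \<in> Phi r n" "r \<ge> 1"
  obtains Z l where "knots r \<phi> Z l" "card Z \<le> n"
proof -
  obtain s a l where s: "\<phi> = spline r s a l" "1 \<le> s" "s \<le> n"
    "\<forall>i\<in>{1..s}. \<forall>j\<in>{1..s}. i < j \<longrightarrow> a i > a j" "\<forall>i\<in>{1..s}. a i > 0" "l > 0"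
    using assms(1) unfolding Phi_def by blast
  show ?thesis
  proof (rule that)
    show "knots r \<phi> (a ` {1..s}) l"
      unfolding knots_def s(1) using spline_properties[OF assms(2) s(2,4,5,6)] s by auto
    show "card (a ` {1..s}) \<le> n" using card_image_le[of "{1..s}" a] s(3) by simp
  qed
qed

lemma knots_Phi:
  assumes Z: "finite Z" "Z \<noteq> {}" "Z \<subseteq> {0<..}" "card Z \<le> n" and l: "l > 0" and r: "r \<ge> 1"
  obtains \<phi> where "\<phi> \<in> Phi r n" "knots r \<phi> Z l"
proof -
  define xs where "xs = sorted_list_of_set Z"
  define s where "s = card Z"
  define a where "a j = xs ! (s - j)" for j
  have xs: "set xs = Z" "length xs = s" "sorted_wrt (<) xs"
    using Z(1) by (auto simp: xs_def s_def)
  have s1: "1 \<le> s" using Z by (simp add: s_def Suc_le_eq card_gt_0_iff)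
  have img: "a ` {1..s} = Z"
  proof -
    have "Z = (!) xs ` {0..<s}" using xs(1,2) by (metis list.set_map map_nth set_upt)
    moreover have "{0..<s} = (\<lambda>j. s - j) ` {1..s}"
    proof (intro set_eqI iffI)
      fix i assume "i \<in> {0..<s}"
      then show "i \<in> (\<lambda>j. s - j) ` {1..s}" by (intro image_eqI[of _ _ "s - i"]) auto
    qed auto
    ultimately show ?thesis by (simp add: image_image a_def)
  qed
  have dec: "\<forall>i\<in>{1..s}. \<forall>j\<in>{1..s}. i < j \<longrightarrow> a i > a j"
    unfolding a_def using xs(2) by (auto intro!: sorted_wrt_nth_less[OF xs(3)])
  have pos: "\<forall>i\<in>{1..s}. a i > 0" using img Z(3) by auto
  show ?thesis
  proof (rule that)
    show "spline r s a l \<in> Phi r n" unfolding Phi_def using s1 Z(4) dec pos l by (auto simp: s_def)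
    show "knots r (spline r s a l) Z l"
      unfolding knots_def using spline_properties[OF r s1 dec pos l] Z l img by auto
  qed
qed

text \<open>
  The moments of the density of \<open>x\<close>, which stays below some \<open>L < l\<close>,
  satisfy the hypothesis of \<open>alternating_moments_solvable\<close> with the constant bound
  \<open>l\<close>: integrating a generalized polynomial \<open>Q\<close> against this density
  gives strictly less than \<open>l\<close> times the integral of the positive part of
  \<open>Q\<close> over a long interval. The power \<open>u\<^sup>q\<close> is the one that
  belongs to \<open>k1\<close>, which bounds the number of knots by the number of prescribed
  derivatives.
\<close>

theorem extremal_spline_exists:
  assumes x: "x \<in> L_monotone r" and r: "r \<ge> 2" and l: "Linf_norm (half_deriv r x) < ereal l"
    and K: "finite K" "K \<noteq> {}" "card K \<le> n" "\<And>j. j \<in> K \<Longrightarrow> k1 < j \<and> j < r"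
    and pos: "\<And>j. j \<in> K \<Longrightarrow> half_deriv j x 0 > 0"
  obtains \<phi> where "\<phi> \<in> Phi r n" "Linf_norm (half_deriv r \<phi>) = ereal l" "\<phi> \<in> L_monotone r"
    "\<And>j. j \<in> K \<Longrightarrow> half_deriv j \<phi> 0 = half_deriv j x 0"
proof -
  obtain L where L: "Linf_norm (half_deriv r x) \<le> ereal L" "L < l"
    using ereal_dense2[OF l] by (auto intro: less_imp_le)
  obtain h where h: "bounded_density L h"
    "\<And>j. j < r \<Longrightarrow> integrable lborel (\<lambda>u. u ^ (r - 1 - j) * h u)"
    "\<And>j. 1 \<le> j \<Longrightarrow> j < r \<Longrightarrow> moment h (r - 1 - j) = fact (r - 1 - j) * half_deriv j x 0"
    using L_monotone_moments[OF x r L(1)] by metis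
  have hh: "\<And>u. 0 \<le> h u" "\<And>u. h u \<le> L" "\<And>u. u < 0 \<Longrightarrow> h u = 0" and [measurable]: "h \<in> borel_measurable borel"
    using h(1) by (auto simp: bounded_density_def)
  have L0: "L \<ge> 0" using hh(1)[of 0] hh(2)[of 0] by simp
  define e where "e j = r - 1 - j" for j
  define N where "N = e ` K"
  have N: "finite N" using K by (simp add: N_def)
  have cardN: "card N \<le> n" using card_image_le[OF K(1), of e] K(3) by (simp add: N_def)
  define m where "m i = moment h i" for i
  have int: "integrable lborel (\<lambda>u. u ^ i * h u)" if "i \<in> N" for i
    using that h(2) K(4) by (auto simp: N_def e_def)
  have mpos: "m (e j) > 0" if "j \<in> K" for j
    using h(3)[of j] K(4)[OF that] pos[OF that] by (simp add: m_def e_def)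
  obtain j0 where j0: "j0 \<in> K" using K(2) by blast
  have coercive: "\<exists>n. (\<Sum>i\<in>N. c i * m i) < l * pos_mass N (real n) c"
    if c: "\<exists>i\<in>N. c i \<noteq> 0" for c
  proof (cases "\<exists>u>0. fewnomial N c u > 0")
    case False
    then have np: "\<And>u. u > 0 \<Longrightarrow> fewnomial N c u \<le> 0" by (meson not_less)
    obtain i where i: "i \<in> N" "c i \<noteq> 0" using c by blast
    have "(\<Sum>i\<in>N. c i * m i) < 0" unfolding m_def
      using mpos[OF j0] by (intro nonpos_fewnomial_moments_neg[OF N i np hh(1,3) int, of "e j0"])
        (use j0 in \<open>auto simp: N_def m_def\<close>)
    moreover have "0 \<le> l * pos_mass N (real 0) c"
      using L0 L(2) by (intro mult_nonneg_nonneg set_integral_nonneg) auto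
    ultimately show ?thesis by (intro exI[of _ 0]) linarith
  next
    case True
    then obtain u0 where u0: "u0 > 0" "fewnomial N c u0 > 0" by blast
    define T where "T n = pos_mass N (real n) c" for n :: nat
    have Tmono: "T k \<le> T n" if "k \<le> n" for k n
      unfolding T_def using that by (intro pos_mass_mono) simp
    obtain n0 :: nat where n0: "u0 < real n0" using reals_Archimedean2 by blast
    have T0: "T n0 > 0" unfolding T_def
      by (rule continuous_pos_part_integral_pos[OF continuous_on_fewnomial u0 n0])
    have Qh: "has_bochner_integral lborel (\<lambda>u. fewnomial N c u * h u) (\<Sum>i\<in>N. c i * m i)"
      unfolding m_def by (rule fewnomial_integral[OF int])
    have lim: "(\<lambda>n. \<integral>u. indicator {0..real n} u * (fewnomial N c u * h u) \<partial>lborel) \<longlonglongrightarrow> (\<Sum>i\<in>N. c i * m i)"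
    proof -
      have [measurable]: "fewnomial N c \<in> borel_measurable borel"
        by (rule borel_measurable_continuous_onI[OF continuous_on_fewnomial])
      have "(\<lambda>n. \<integral>u. indicator {0..real n} u * (fewnomial N c u * h u) \<partial>lborel) \<longlonglongrightarrow> (\<integral>u. fewnomial N c u * h u \<partial>lborel)"
      proof (rule integral_dominated_convergence[where w = "\<lambda>u. \<bar>fewnomial N c u * h u\<bar>"])
        show "integrable lborel (\<lambda>u. \<bar>fewnomial N c u * h u\<bar>)"
          using Qh by (intro integrable_abs) (simp add: has_bochner_integral_iff)
        show "AE u in lborel. (\<lambda>n. indicator {0..real n} u * (fewnomial N c u * h u)) \<longlonglongrightarrow> fewnomial N c u * h u"
        proof (rule AE_I2)
          fix u :: real
          obtain k :: nat where k: "u \<le> real k" using real_arch_simple by blast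
          have "\<forall>\<^sub>F n in sequentially. indicator {0..real n} u * (fewnomial N c u * h u) = fewnomial N c u * h u"
            using eventually_ge_at_top[of k]
          proof eventually_elim
            case (elim n)
            then show ?case using k hh(3)[of u] by (cases "u < 0") (auto simp: indicator_def)
          qed
          then show "(\<lambda>n. indicator {0..real n} u * (fewnomial N c u * h u)) \<longlonglongrightarrow> fewnomial N c u * h u"
            by (rule tendsto_eventually)
        qed
      qed (measurable, auto simp: indicator_def)
      then show ?thesis using Qh by (simp add: has_bochner_integral_iff)
    qed
    show ?thesis
    proof (rule ccontr)
      assume "\<not> ?thesis"
      then have big: "l * T n \<le> (\<Sum>i\<in>N. c i * m i)" for n by (auto simp: T_def not_less)
      \<comment> \<open>The gap \<open>(l - L) T n0\<close> does not shrink as \<open>n\<close>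
          grows, while the integral over \<open>[0, n]\<close> tends to the whole sum.\<close>
      have "(\<integral>u. indicator {0..real n} u * (fewnomial N c u * h u) \<partial>lborel) \<le> (\<Sum>i\<in>N. c i * m i) - (l - L) * T n0"
        if n: "n \<ge> n0" for n
      proof -
        have "(\<integral>u. indicator {0..real n} u * (fewnomial N c u * h u) \<partial>lborel)
            \<le> (\<integral>u. L * (indicator {0..real n} u *\<^sub>R max 0 (fewnomial N c u)) \<partial>lborel)"
        proof (rule integral_mono)
          have "integrable lborel (\<lambda>u. indicator {0..real n} u *\<^sub>R (fewnomial N c u * h u))"
            using Qh by (intro integrable_mult_indicator) (auto simp: has_bochner_integral_iff)
          then show "integrable lborel (\<lambda>u. indicator {0..real n} u * (fewnomial N c u * h u))" by simp
          show "integrable lborel (\<lambda>u. L * (indicator {0..real n} u *\<^sub>R max 0 (fewnomial N c u)))"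
            using pos_mass_integrable[of 0 "real n" N c] unfolding set_integrable_def by (rule integrable_mult_right)
          fix u
          have "fewnomial N c u * h u \<le> max 0 (fewnomial N c u) * h u"
            using hh(1)[of u] by (intro mult_right_mono) auto
          also have "\<dots> \<le> max 0 (fewnomial N c u) * L" using hh(2)[of u] by (intro mult_left_mono) auto
          finally show "indicator {0..real n} u * (fewnomial N c u * h u) \<le> L * (indicator {0..real n} u *\<^sub>R max 0 (fewnomial N c u))"
            by (simp add: indicator_def mult.commute)
        qed
        also have "\<dots> = L * T n" by (simp add: T_def set_lebesgue_integral_def)
        also have "\<dots> = l * T n - (l - L) * T n" by (simp add: algebra_simps)
        also have "\<dots> \<le> (\<Sum>i\<in>N. c i * m i) - (l - L) * T n0"
          using big[of n] Tmono[OF n] L(2) by (intro diff_mono mult_left_mono) auto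
        finally show ?thesis .
      qed
      then have "(\<Sum>i\<in>N. c i * m i) \<le> (\<Sum>i\<in>N. c i * m i) - (l - L) * T n0"
        by (intro LIMSEQ_le_const2[OF lim]) blast
      moreover have "(l - L) * T n0 > 0" using T0 L(2) by simp
      ultimately show False by simp
    qed
  qed
  have qN: "i < e k1" if "i \<in> N" for i using that K(4) by (force simp: N_def e_def)
  have lpos: "0 \<le> l" and lmono: "mono (\<lambda>_::nat. l)" and jN: "e j0 \<in> N" and r1: "r \<ge> 1"
    using L0 L(2) j0 r by (auto simp: mono_def N_def)
  obtain Z where Z: "finite Z" "Z \<noteq> {}" "Z \<subseteq> {0<..}" "card Z \<le> card N" "l > 0"
    "\<And>i. i \<in> N \<Longrightarrow> m i = l * moment (alternating Z) i"
    using alternating_moments_solvable[of N "e k1" "e j0" m "\<lambda>_. l", OF N qN jN mpos[OF j0] lpos lmono coercive] by blast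
  obtain \<phi> where \<phi>: "\<phi> \<in> Phi r n" "knots r \<phi> Z l"
    by (rule knots_Phi[OF Z(1-3) order_trans[OF Z(4) cardN] Z(5) r1])
  show ?thesis
  proof (rule that[OF \<phi>(1)])
    show "Linf_norm (half_deriv r \<phi>) = ereal l" "\<phi> \<in> L_monotone r" using \<phi>(2) by (auto simp: knots_def)
    fix j assume j: "j \<in> K"
    have "fact (e j) * half_deriv j \<phi> 0 = (\<integral>u. u ^ e j * (l * alternating Z u) \<partial>lborel)"
      using \<phi>(2) K(4)[OF j] by (auto simp: knots_def e_def has_bochner_integral_iff)
    also have "\<dots> = l * moment (alternating Z) (e j)" by (simp add: mult.left_commute)
    also have "\<dots> = m (e j)" using Z(6)[of "e j"] j by (simp add: N_def)
    also have "\<dots> = fact (e j) * half_deriv j x 0" using h(3)[of j] K(4)[OF j] by (simp add: m_def e_def)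
    finally show "half_deriv j \<phi> 0 = half_deriv j x 0" by simp
  qed
qed

text \<open>
  Let \<open>P\<close> be the polynomial with leading power \<open>u\<^bsup>e k1\<^esup>\<close>
  and as many further exponents from \<open>N\<close> as there are knots which changes sign
  exactly at the knots, and let \<open>g\<close> be the density of \<open>x\<close> minus that of
  \<open>\<phi>\<close>. Where \<open>P\<close> is negative the density of \<open>\<phi>\<close>
  has its largest value \<open>l\<close> and \<open>g < 0\<close>; where \<open>P\<close> is
  positive it is 0 and \<open>g \<ge> 0\<close>. So \<open>P g \<ge> 0\<close>, and by the
  equality of the other moments the integral of \<open>P g\<close> is the difference of the two
  moments of order \<open>e k1\<close>.
\<close>

theorem spline_minimizes:
  assumes x: "x \<in> L_monotone r" and r: "r \<ge> 2" and l: "Linf_norm (half_deriv r x) < ereal l"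
    and K: "finite K" "\<And>j. j \<in> K \<Longrightarrow> k1 < j \<and> j < r"
    and \<phi>: "\<phi> \<in> Phi r (card K)" "Linf_norm (half_deriv r \<phi>) = ereal l" and k1: "k1 < r"
    and eq: "\<And>j. j \<in> K \<Longrightarrow> half_deriv j \<phi> 0 = half_deriv j x 0"
  shows "half_deriv k1 \<phi> 0 < half_deriv k1 x 0"
proof -
  have r1: "r \<ge> 1" using r by simp
  obtain L where L: "Linf_norm (half_deriv r x) \<le> ereal L" "L < l"
    using ereal_dense2[OF l] by (auto intro: less_imp_le)
  obtain h where h: "bounded_density L h"
    "\<And>j. j < r \<Longrightarrow> integrable lborel (\<lambda>u. u ^ (r - 1 - j) * h u)"
    "\<And>j. j < r \<Longrightarrow> moment h (r - 1 - j) \<le> fact (r - 1 - j) * half_deriv j x 0"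
    "\<And>j. 1 \<le> j \<Longrightarrow> j < r \<Longrightarrow> moment h (r - 1 - j) = fact (r - 1 - j) * half_deriv j x 0"
    using L_monotone_moments[OF x r L(1)] by blast
  have hh: "\<And>u. 0 \<le> h u" "\<And>u. h u \<le> L" "\<And>u. u < 0 \<Longrightarrow> h u = 0"
    using h(1) by (auto simp: bounded_density_def)
  obtain Z l' where kn: "knots r \<phi> Z l'" "card Z \<le> card K" using Phi_knots[OF \<phi>(1) r1] by blast
  have "l' = l" using kn(1) \<phi>(2) by (simp add: knots_def)
  then have Z: "finite Z" "Z \<noteq> {}" "Z \<subseteq> {0<..}" "l > 0"
    "\<And>j. j < r \<Longrightarrow> has_bochner_integral lborel (\<lambda>u. u ^ (r - 1 - j) * (l * alternating Z u))
       (fact (r - 1 - j) * half_deriv j \<phi> 0)"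
    using kn(1) by (auto simp: knots_def)
  define e where "e j = r - 1 - j" for j
  define N where "N = e ` K"
  define g where "g u = h u - l * alternating Z u" for u
  have "inj_on e K"
  proof (rule inj_onI)
    fix i j assume ij: "i \<in> K" "j \<in> K" "e i = e j"
    show "i = j" using ij(3) K(2)[OF ij(1)] K(2)[OF ij(2)] unfolding e_def by linarith
  qed
  then have "card N = card K" by (simp add: N_def card_image)
  then have "card Z \<le> card N" using kn(2) by simp
  then obtain E where E: "E \<subseteq> N" "card E = card Z" "finite E"
    by (rule obtain_subset_with_card_n)
  have Ee: "i < e k1" if "i \<in> E" for i using that E(1) K(2) by (force simp: N_def e_def)
  obtain c V where c: "c (e k1) = 1"
    "\<And>u. fewnomial (insert (e k1) E) c u = (\<Prod>a\<in>Z. u - a) * poly V u" "V \<noteq> 0" "\<And>u. u > 0 \<Longrightarrow> poly V u \<ge> 0"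
    using fewnomial_prescribed_signs[OF Z(1,3) E(3,2) Ee] by blast
  have gint: "has_bochner_integral lborel (\<lambda>u. u ^ e j * g u)
      (moment h (e j) - fact (e j) * half_deriv j \<phi> 0)" if "j < r" for j
  proof -
    have "has_bochner_integral lborel (\<lambda>u. u ^ e j * h u - u ^ e j * (l * alternating Z u))
      (moment h (e j) - fact (e j) * half_deriv j \<phi> 0)"
      using h(2)[OF that] Z(5)[OF that] unfolding e_def
      by (intro has_bochner_integral_diff has_bochner_integral_integrable)
    then show ?thesis by (simp add: g_def right_diff_distrib)
  qed
  have gE: "moment g i = 0" if iE: "i \<in> E" for i
  proof -
    obtain j where j: "j \<in> K" "i = e j" using iE E(1) by (auto simp: N_def)
    then show ?thesis using gint[of j] K(2)[of j] h(4)[of j] eq[of j] by (simp add: has_bochner_integral_iff e_def)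
  qed
  have gi: "integrable lborel (\<lambda>u. u ^ i * g u)" if i: "i \<in> insert (e k1) E" for i
  proof -
    obtain j where "j < r" "i = e j" using i k1 K(2) E(1) unfolding N_def by blast
    then show ?thesis using gint[of j] by (simp add: has_bochner_integral_iff)
  qed
  let ?P = "fewnomial (insert (e k1) E) c"
  have "e k1 \<notin> E" using Ee by blast
  then have "(\<Sum>i\<in>insert (e k1) E. c i * moment g i) = moment g (e k1)"
    using E(3) gE c(1) by simp
  with fewnomial_integral[of "insert (e k1) E" g c] gi
  have Pg: "integrable lborel (\<lambda>u. ?P u * g u)" "(\<integral>u. ?P u * g u \<partial>lborel) = moment g (e k1)"
    by (auto simp: has_bochner_integral_iff)
  have sgn: "0 \<le> ?P u * g u \<and> (alternating Z u = 1 \<and> poly V u \<noteq> 0 \<and> u \<notin> Z \<longrightarrow> 0 < ?P u * g u)" if u: "u > 0" for u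
  proof (cases "u \<in> Z")
    case True
    then have "(\<Prod>a\<in>Z. u - a) = 0" using Z(1) by (auto intro: prod_zero)
    then show ?thesis using True by (simp add: c(2))
  next
    case False
    note ps = prod_sign[OF Z(1) False]
    show ?thesis
    proof (cases "odd (card {a \<in> Z. u < a})")
      case True
      then have b: "alternating Z u = 1" using u by (simp add: alternating_def)
      then have g: "g u < 0" using hh(2)[of u] L(2) by (simp add: g_def)
      have p: "(\<Prod>a\<in>Z. u - a) < 0" using ps True by simp
      have "0 \<le> poly V u * ((\<Prod>a\<in>Z. u - a) * g u)"
        using c(4)[OF u] mult_neg_neg[OF p g] by simp
      moreover have "0 < poly V u * ((\<Prod>a\<in>Z. u - a) * g u)" if "poly V u \<noteq> 0"
        using c(4)[OF u] mult_neg_neg[OF p g] that by simp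
      ultimately show ?thesis by (simp add: c(2) ac_simps)
    next
      case False
      then have b: "alternating Z u = 0" by (simp add: alternating_def)
      have "\<not> (\<Prod>a\<in>Z. u - a) < 0" using ps False by blast
      then have p: "(\<Prod>a\<in>Z. u - a) > 0" using ps by linarith
      have "0 \<le> (\<Prod>a\<in>Z. u - a) * poly V u * g u"
        using p c(4)[OF u] hh(1)[of u] b by (simp add: g_def)
      then show ?thesis using b by (simp add: c(2))
    qed
  qed
  have A: "AE u in lborel. 0 \<le> ?P u * g u"
    using AE_not_finite[of "{0}"]
  proof (rule AE_mp[OF _ AE_I2])
    fix u :: real
    show "u \<notin> {0} \<longrightarrow> 0 \<le> ?P u * g u"
    proof
      assume "u \<notin> {0}"
      then have "u \<noteq> 0" by simp
      then consider "u > 0" | "u < 0" by linarith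
      then show "0 \<le> ?P u * g u"
      proof cases
        case 2
        then show ?thesis using hh(3)[of u] by (simp add: g_def alternating_def)
      qed (use sgn in blast)
    qed
  qed simp
  have "0 \<le> (\<integral>u. ?P u * g u \<partial>lborel)" by (rule integral_nonneg_AE[OF A])
  moreover have "(\<integral>u. ?P u * g u \<partial>lborel) \<noteq> 0"
  proof
    assume "(\<integral>u. ?P u * g u \<partial>lborel) = 0"
    then have 1: "AE u in lborel. ?P u * g u = 0" using integral_nonneg_eq_0_iff_AE[OF Pg(1) A] by simp
    have "finite {u. poly V u = 0}" using c(3) by (rule poly_roots_finite)
    then have 2: "AE u in lborel. u \<notin> Z \<union> {u. poly V u = 0}" using Z(1) by (intro AE_not_finite) auto
    obtain b d where bd: "0 \<le> b" "b < d" "\<And>u. u \<in> {b<..<d} \<Longrightarrow> alternating Z u = 1"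
      using alternating_one_interval[OF Z(1-3)] by blast
    have "AE u in lborel. ?P u * g u = 0 \<and> u \<notin> Z \<union> {u. poly V u = 0}" using 1 2 by (rule AE_conjI)
    from AE_open_ex[OF this open_greaterThanLessThan[of b d]] bd(2)
    obtain u where u: "u \<in> {b<..<d}" "?P u * g u = 0" "u \<notin> Z \<union> {u. poly V u = 0}" by auto
    then show False using sgn[of u] bd(1,3) by auto
  qed
  ultimately have "0 < moment g (e k1)" using Pg(2) by simp
  also have "\<dots> = moment h (e k1) - fact (e k1) * half_deriv k1 \<phi> 0"
    using gint[OF k1] by (simp add: has_bochner_integral_iff)
  finally have "fact (e k1) * half_deriv k1 \<phi> 0 < moment h (e k1)" by simp
  also have "\<dots> \<le> fact (e k1) * half_deriv k1 x 0" using h(3)[OF k1] unfolding e_def .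
  finally show ?thesis by simp
qed

text \<open>
  Raising the highest moment of a spline to an arbitrary larger value. A generalized polynomial
  that is nonpositive on the half-line has a nonpositive leading coefficient, so its value on the
  new moments is at most that on the moments of \<open>\<phi>\<close>, which is negative; for any
  other polynomial a large bound on a large interval makes the integral of the positive part
  dominate. Hence the hypothesis of \<open>alternating_moments_solvable\<close> holds with bounds
  \<open>L n = n\<close>.
\<close>

theorem admissible_extension:
  assumes r: "r \<ge> 1" and K: "finite K" "K \<noteq> {}" "\<And>j. j \<in> K \<Longrightarrow> k1 < j \<and> j < r" and k1: "k1 < r"
    and \<phi>: "knots r \<phi> Z l" and M: "\<And>j. j \<in> K \<Longrightarrow> half_deriv j \<phi> 0 = M j" "\<And>j. j \<in> K \<Longrightarrow> M j > 0"
    and M1: "half_deriv k1 \<phi> 0 < M k1"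
  obtains x where "x \<in> L_monotone r" "\<And>j. j \<in> insert k1 K \<Longrightarrow> half_deriv j x 0 = M j"
proof -
  define e where "e j = r - 1 - j" for j
  define N where "N = e ` insert k1 K"
  define m where "m i = fact i * M (r - 1 - i)" for i
  define g where "g u = l * alternating Z u" for u
  have Kr: "j < r" if "j \<in> insert k1 K" for j using that K(3) k1 by auto
  have ee: "r - 1 - e j = j" if "j \<in> insert k1 K" for j using Kr[OF that] by (simp add: e_def)
  have me: "m (e j) = fact (e j) * M j" if "j \<in> insert k1 K" for j by (simp only: m_def ee[OF that])
  have gint: "has_bochner_integral lborel (\<lambda>u. u ^ e j * g u) (fact (e j) * half_deriv j \<phi> 0)" if "j \<in> insert k1 K" for j
    using \<phi> Kr[OF that] by (simp add: knots_def g_def e_def)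
  have g0: "\<And>u. 0 \<le> g u" "\<And>u. u < 0 \<Longrightarrow> g u = 0"
    using \<phi> alternating_range(1) by (auto simp: g_def knots_def alternating_def)
  have gN: "integrable lborel (\<lambda>u. u ^ i * g u)" if "i \<in> N" for i
    using that gint by (auto simp: N_def has_bochner_integral_iff)
  obtain j0 where j0: "j0 \<in> K" using K(2) by blast
  have N: "finite N" "e j0 \<in> N" using K(1) j0 by (auto simp: N_def)
  have gj0: "moment g (e j0) > 0"
    using gint[of j0] M[OF j0] j0 by (simp add: has_bochner_integral_iff)
  have lt: "i < e k1" if "i \<in> e ` K" for i using that K(3) by (force simp: e_def)
  have Nins: "N = insert (e k1) (e ` K)" by (simp add: N_def)
  have coercive: "\<exists>n. (\<Sum>i\<in>N. c i * m i) < real n * pos_mass N (real n) c"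
    if c: "\<exists>i\<in>N. c i \<noteq> 0" for c
  proof (cases "\<exists>u>0. fewnomial N c u > 0")
    case False
    then have np: "\<And>u. u > 0 \<Longrightarrow> fewnomial N c u \<le> 0" by (meson not_less)
    obtain i where i: "i \<in> N" "c i \<noteq> 0" using c by blast
    have neg: "(\<Sum>i\<in>N. c i * moment g i) < 0"
      using gj0 by (intro nonpos_fewnomial_moments_neg[OF N(1) i np g0 gN N(2)]) auto
    have c1: "c (e k1) \<le> 0"
    proof (rule ccontr)
      assume "\<not> ?thesis"
      then have "\<forall>\<^sub>F u in at_top. fewnomial N c u > 0"
        unfolding Nins using K(1) lt by (intro fewnomial_eventually_pos) auto
      from eventually_happens[OF eventually_conj[OF this eventually_gt_at_top[of 0]]]
      show False using False by auto
    qed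
    have "(\<Sum>i\<in>N. c i * m i) \<le> (\<Sum>i\<in>N. c i * moment g i)"
    proof (rule sum_mono)
      fix i assume "i \<in> N"
      then obtain j where j: "j \<in> insert k1 K" "i = e j" by (auto simp: N_def)
      have I: "moment g i = fact i * half_deriv j \<phi> 0"
        using gint[OF j(1)] j(2) by (simp add: has_bochner_integral_iff)
      show "c i * m i \<le> c i * moment g i"
      proof (cases "j = k1")
        case True
        then have "fact i * half_deriv j \<phi> 0 \<le> m i" using me[OF j(1)] j(2) M1 by simp
        then show ?thesis unfolding I using c1 True j(2) by (intro mult_left_mono_neg) auto
      next
        case False
        then show ?thesis unfolding I using me[OF j(1)] j M(1) by auto
      qed
    qed
    then show ?thesis using neg by (intro exI[of _ 0]) simp
  next
    case True
    then obtain u0 where u0: "u0 > 0" "fewnomial N c u0 > 0" by blast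
    define T where "T n = pos_mass N (real n) c" for n :: nat
    have Tmono: "T k \<le> T n" if "k \<le> n" for k n
      unfolding T_def using that by (intro pos_mass_mono) simp
    obtain n0 :: nat where n0: "u0 < real n0" using reals_Archimedean2 by blast
    have T0: "T n0 > 0" unfolding T_def
      by (rule continuous_pos_part_integral_pos[OF continuous_on_fewnomial u0 n0])
    obtain n1 :: nat where n1: "(\<Sum>i\<in>N. c i * m i) < real n1 * T n0" using reals_Archimedean3[OF T0] by blast
    have "real n1 * T n0 \<le> real (max n0 n1) * T (max n0 n1)"
      using Tmono[of n0 "max n0 n1"] T0 by (intro mult_mono) auto
    then have "(\<Sum>i\<in>N. c i * m i) < real (max n0 n1) * T (max n0 n1)" using n1 by linarith
    then show ?thesis unfolding T_def by blast
  qed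
  have qN: "i < r" if "i \<in> N" for i using that Kr by (force simp: N_def e_def)
  have mj0: "m (e j0) > 0" using me[of j0] j0 M(2)[OF j0] by simp
  have rmono: "mono real" by (simp add: mono_def)
  obtain n Y where Y: "finite Y" "Y \<noteq> {}" "Y \<subseteq> {0<..}" "card Y \<le> card N" "real n > 0"
    "\<And>i. i \<in> N \<Longrightarrow> m i = real n * moment (alternating Y) i"
  proof (rule alternating_moments_solvable[of N r "e j0" m real, OF N(1) qN N(2) mj0 of_nat_0_le_iff rmono coercive])
    fix n Z
    assume a: "finite Z" "Z \<noteq> {}" "Z \<subseteq> {0<..}" "card Z \<le> card N" "real n > 0"
      "\<And>i. i \<in> N \<Longrightarrow> m i = real n * moment (alternating Z) i"
    show thesis by (rule that[OF a])
  qed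
  obtain x where x: "knots r x Y (real n)" by (rule knots_Phi[OF Y(1-3) order_refl Y(5) r])
  show ?thesis
  proof (rule that[of x])
    show "x \<in> L_monotone r" using x by (simp add: knots_def)
    fix j assume j: "j \<in> insert k1 K"
    have "fact (e j) * half_deriv j x 0 = (\<integral>u. u ^ e j * (real n * alternating Y u) \<partial>lborel)"
      using x Kr[OF j] by (auto simp: knots_def e_def has_bochner_integral_iff)
    also have "\<dots> = real n * moment (alternating Y) (e j)" by (simp add: mult.left_commute)
    also have "\<dots> = fact (e j) * M j" using Y(6)[of "e j"] j me[OF j] by (auto simp: N_def)
    finally show "half_deriv j x 0 = M j" by simp
  qed
qed

section \<open>The criterion for admissible systems\<close>

lemma Phi_subset_L_monotone: "\<phi> \<in> Phi r n \<Longrightarrow> r \<ge> 1 \<Longrightarrow> \<phi> \<in> L_monotone r"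
  by (erule (1) Phi_knots) (simp add: knots_def)

lemma Phi_mono: "m \<le> n \<Longrightarrow> Phi r m \<subseteq> Phi r n"
  unfolding Phi_def by (auto intro: order_trans)

theorem theorem4:
  fixes r d :: nat and k :: "nat \<Rightarrow> nat" and M :: "nat \<Rightarrow> real"
  assumes "r \<ge> 1" and "d \<ge> 3"
    and "strict_mono_on {1..d} k" and "k d < r"
    and "\<forall>i\<in>{1..d}. M (k i) > 0"
  defines "k2 \<equiv> \<lambda>i. k (i + 1)"
  shows
    "(\<exists>\<Lambda>.
        (\<forall>\<phi>. (\<forall>\<^sub>F l in at_top. extremal_spline r d k M l (\<phi> l)) \<longrightarrow>
             ((\<lambda>l. Linf_norm (half_deriv (k 1) (\<phi> l))) \<longlongrightarrow> \<Lambda>) at_top) \<and>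
        (admissible r d k M \<longleftrightarrow> admissible r (d - 1) k2 M \<and> ereal (M (k 1)) > \<Lambda>)) \<and>
     (admissible r (d - 1) k2 M \<longrightarrow>
        (\<forall>\<^sub>F l in at_top. \<exists>\<phi>. extremal_spline r d k M l \<phi>)) \<and>
     (\<forall>\<psi> l. interp_spline r (d - 1) k2 M \<psi> \<and> Linf_norm (half_deriv r \<psi>) \<le> ereal l \<longrightarrow>
        (\<exists>\<phi>. extremal_spline r d k M l \<phi>))"
proof -
  have k_less: "k i < k j" if "1 \<le> i" "i < j" "j \<le> d" for i j
    using strict_mono_onD[OF assms(3), of i j] that by auto
  have k_r: "k i < r" if "1 \<le> i" "i \<le> d" for i
    using k_less[of i d] that assms(4) by (cases "i = d") auto
  have r2: "r \<ge> 2" using k_less[of 1 2] k_r[of 2] assms(2) by linarith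
  define K where "K = k ` {2..d}"
  have "inj_on k {2..d}"
    using strict_mono_on_imp_inj_on[OF assms(3)] by (rule inj_on_subset) auto
  then have cardK: "card K = d - 1" using assms(2) by (simp add: K_def card_image)
  have K: "finite K" "K \<noteq> {}" "\<And>j. j \<in> K \<Longrightarrow> k 1 < j \<and> j < r"
    using assms(2) k_less k_r by (auto simp: K_def)
  have MK: "\<And>j. j \<in> K \<Longrightarrow> M j > 0" using assms(5) by (auto simp: K_def)
  have k1r: "k 1 < r" using k_r[of 1] assms(2) by simp
  have k1K: "insert (k 1) K = k ` {1..d}"
  proof -
    have "{1..d} = insert 1 {2..d}" using assms(2) by auto
    then show ?thesis by (simp add: K_def)
  qed
  have K2: "K = k2 ` {1..d - 1}"
  proof -
    have "{2..d} = {Suc 1..Suc (d - 1)}" using assms(2) by simp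
    then have "{2..d} = Suc ` {1..d - 1}" by (simp only: image_Suc_atLeastAtMost)
    then show ?thesis by (simp only: K_def k2_def image_image Suc_eq_plus1)
  qed
  have adm2: "admissible r (d - 1) k2 M \<longleftrightarrow> (\<exists>x\<in>L_monotone r. \<forall>j\<in>K. Linf_norm (half_deriv j x) = ereal (M j))"
    unfolding admissible_def K2 by simp
  have adm: "admissible r d k M \<longleftrightarrow> (\<exists>x\<in>L_monotone r. \<forall>j\<in>insert (k 1) K. Linf_norm (half_deriv j x) = ereal (M j))"
    unfolding admissible_def k1K by simp
  have ext: "extremal_spline r d k M l \<phi> \<longleftrightarrow> \<phi> \<in> Phi r (d - 1) \<and>
     (\<forall>j\<in>K. Linf_norm (half_deriv j \<phi>) = ereal (M j)) \<and> Linf_norm (half_deriv r \<phi>) = ereal l" for l \<phi>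
    unfolding extremal_spline_def K_def by simp
  have nrm: "Linf_norm (half_deriv j x) = ereal (half_deriv j x 0)" if "x \<in> L_monotone r" "j < r" for j x
    using L_monotone_norm[OF that(1) assms(1) that(2)] .
  have at0: "half_deriv j x 0 = M j"
    if "x \<in> L_monotone r" "\<forall>j\<in>K. Linf_norm (half_deriv j x) = ereal (M j)" "j \<in> K" for x j
    using nrm[OF that(1), of j] that(2,3) K(3) by auto
  have ex: "\<exists>\<phi>. extremal_spline r d k M l \<phi>"
    if x: "x \<in> L_monotone r" "\<forall>j\<in>K. Linf_norm (half_deriv j x) = ereal (M j)"
      and l: "Linf_norm (half_deriv r x) < ereal l" for x l
  proof -
    have c: "card K \<le> d - 1" using cardK by simp
    have pos: "\<And>j. j \<in> K \<Longrightarrow> half_deriv j x 0 > 0" using at0[OF x] MK by simp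
    obtain \<phi> where \<phi>: "\<phi> \<in> Phi r (d - 1)" "Linf_norm (half_deriv r \<phi>) = ereal l" "\<phi> \<in> L_monotone r"
      "\<And>j. j \<in> K \<Longrightarrow> half_deriv j \<phi> 0 = half_deriv j x 0"
      using extremal_spline_exists[OF x(1) r2 l K(1,2) c K(3) pos] by blast
    have "extremal_spline r d k M l \<phi>"
      unfolding ext using \<phi> nrm[OF \<phi>(3)] at0[OF x] K(3) by auto
    then show ?thesis by blast
  qed
  have less: "Linf_norm (half_deriv (k 1) \<phi>) < Linf_norm (half_deriv (k 1) x)"
    if x: "x \<in> L_monotone r" "\<forall>j\<in>K. Linf_norm (half_deriv j x) = ereal (M j)"
      and l: "Linf_norm (half_deriv r x) < ereal l" and \<phi>: "extremal_spline r d k M l \<phi>" for x l \<phi>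
  proof -
    have P: "\<phi> \<in> Phi r (card K)" "Linf_norm (half_deriv r \<phi>) = ereal l"
      "\<forall>j\<in>K. Linf_norm (half_deriv j \<phi>) = ereal (M j)" using \<phi> by (auto simp: ext cardK)
    have \<phi>m: "\<phi> \<in> L_monotone r" using Phi_subset_L_monotone[OF P(1) assms(1)] .
    have "half_deriv (k 1) \<phi> 0 < half_deriv (k 1) x 0"
      by (rule spline_minimizes[OF x(1) r2 l K(1,3) P(1,2) k1r]) (simp_all add: at0[OF x] at0[OF \<phi>m P(3)])
    then show ?thesis using nrm[OF \<phi>m k1r] nrm[OF x(1) k1r] by simp
  qed
  \<comment> \<open>By \<open>less\<close> the norms of the extremal splines decrease strictly in
      \<open>l\<close>, whichever splines are chosen, so the limit is the infimum over
      all of them; it is \<open>\<infinity>\<close> when there are none.\<close>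
  define \<Lambda> where "\<Lambda> = Inf {Linf_norm (half_deriv (k 1) \<phi>) | \<phi> l. extremal_spline r d k M l \<phi>}"
  have \<Lambda>le: "\<Lambda> \<le> Linf_norm (half_deriv (k 1) \<phi>)" if "extremal_spline r d k M l \<phi>" for l \<phi>
    unfolding \<Lambda>_def using that by (intro Inf_lower) blast
  have extm: "\<phi> \<in> L_monotone r" if "extremal_spline r d k M l \<phi>" for l \<phi>
    using that Phi_subset_L_monotone assms(1) by (auto simp: ext)
  have lim: "((\<lambda>l. Linf_norm (half_deriv (k 1) (\<phi> l))) \<longlongrightarrow> \<Lambda>) at_top"
    if ev: "\<forall>\<^sub>F l in at_top. extremal_spline r d k M l (\<phi> l)" for \<phi>
  proof (rule decreasing_tendsto)
    show "\<forall>\<^sub>F l in at_top. \<Lambda> \<le> Linf_norm (half_deriv (k 1) (\<phi> l))"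
      using ev by eventually_elim (rule \<Lambda>le)
    fix y assume "\<Lambda> < y"
    then obtain \<phi>0 l0 where \<phi>0: "extremal_spline r d k M l0 \<phi>0" "Linf_norm (half_deriv (k 1) \<phi>0) < y"
      unfolding \<Lambda>_def Inf_less_iff by blast
    have P: "\<forall>j\<in>K. Linf_norm (half_deriv j \<phi>0) = ereal (M j)" "Linf_norm (half_deriv r \<phi>0) = ereal l0"
      using \<phi>0(1) by (auto simp: ext)
    show "\<forall>\<^sub>F l in at_top. Linf_norm (half_deriv (k 1) (\<phi> l)) < y"
      using ev eventually_gt_at_top[of l0]
    proof eventually_elim
      case (elim l)
      have "Linf_norm (half_deriv (k 1) (\<phi> l)) < Linf_norm (half_deriv (k 1) \<phi>0)"
        using elim P(2) by (intro less[OF extm[OF \<phi>0(1)] P(1)]) auto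
      then show ?case using \<phi>0(2) by (rule less_trans)
    qed
  qed
  have iff: "admissible r d k M \<longleftrightarrow> admissible r (d - 1) k2 M \<and> ereal (M (k 1)) > \<Lambda>"
  proof
    assume "admissible r d k M"
    then obtain x where x: "x \<in> L_monotone r" "\<forall>j\<in>insert (k 1) K. Linf_norm (half_deriv j x) = ereal (M j)"
      unfolding adm by blast
    then have xK: "\<forall>j\<in>K. Linf_norm (half_deriv j x) = ereal (M j)" by blast
    obtain l where l: "Linf_norm (half_deriv r x) < ereal l" using L_monotone_top_norm_finite[OF x(1)] by blast
    obtain \<phi> where \<phi>: "extremal_spline r d k M l \<phi>" using ex[OF x(1) xK l] by blast
    \<comment> \<open>Any \<open>l\<close> above the top norm of \<open>x\<close> will do: the
        strictness comes from the strict inequality there.\<close>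
    have "\<Lambda> \<le> Linf_norm (half_deriv (k 1) \<phi>)" by (rule \<Lambda>le[OF \<phi>])
    also have "\<dots> < Linf_norm (half_deriv (k 1) x)" by (rule less[OF x(1) xK l \<phi>])
    also have "\<dots> = ereal (M (k 1))" using x(2) by blast
    finally show "admissible r (d - 1) k2 M \<and> ereal (M (k 1)) > \<Lambda>" using adm2 x(1) xK by blast
  next
    assume A: "admissible r (d - 1) k2 M \<and> ereal (M (k 1)) > \<Lambda>"
    then obtain \<phi> l where \<phi>: "extremal_spline r d k M l \<phi>" "Linf_norm (half_deriv (k 1) \<phi>) < ereal (M (k 1))"
      unfolding \<Lambda>_def Inf_less_iff by blast
    have P: "\<phi> \<in> Phi r (d - 1)" "\<forall>j\<in>K. Linf_norm (half_deriv j \<phi>) = ereal (M j)" using \<phi>(1) by (auto simp: ext)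
    obtain Z l' where Z: "knots r \<phi> Z l'" using Phi_knots[OF P(1) assms(1)] by blast
    have M1: "half_deriv (k 1) \<phi> 0 < M (k 1)" using \<phi>(2) nrm[OF extm[OF \<phi>(1)] k1r] by simp
    obtain x where x: "x \<in> L_monotone r" "\<And>j. j \<in> insert (k 1) K \<Longrightarrow> half_deriv j x 0 = M j"
      using admissible_extension[where M = M, OF assms(1) K k1r Z at0[OF extm[OF \<phi>(1)] P(2)] MK M1] by blast
    have "\<forall>j\<in>insert (k 1) K. Linf_norm (half_deriv j x) = ereal (M j)"
      using nrm[OF x(1)] x(2) K(3) k1r by auto
    then show "admissible r d k M" unfolding adm using x(1) by blast
  qed
  have ev: "\<forall>\<^sub>F l in at_top. \<exists>\<phi>. extremal_spline r d k M l \<phi>" if A: "admissible r (d - 1) k2 M"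
  proof -
    obtain x where x: "x \<in> L_monotone r" "\<forall>j\<in>K. Linf_norm (half_deriv j x) = ereal (M j)"
      using A unfolding adm2 by blast
    obtain L where L: "Linf_norm (half_deriv r x) < ereal L" using L_monotone_top_norm_finite[OF x(1)] by blast
    show ?thesis using eventually_ge_at_top[of L]
    proof eventually_elim
      case (elim l)
      have "ereal L \<le> ereal l" using elim by simp
      with L have "Linf_norm (half_deriv r x) < ereal l" by (rule less_le_trans)
      then show ?case by (rule ex[OF x])
    qed
  qed
  have interp: "\<exists>\<phi>. extremal_spline r d k M l \<phi>"
    if A: "interp_spline r (d - 1) k2 M \<psi>" "Linf_norm (half_deriv r \<psi>) \<le> ereal l" for \<psi> l
  proof -
    have \<psi>: "\<psi> \<in> Phi r (d - 1 - 1)" "\<forall>j\<in>K. Linf_norm (half_deriv j \<psi>) = ereal (M j)"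
      using A(1) unfolding interp_spline_def K2 by auto
    have \<psi>P: "\<psi> \<in> Phi r (d - 1)" by (rule subsetD[OF Phi_mono[OF diff_le_self] \<psi>(1)])
    show ?thesis
    proof (cases "Linf_norm (half_deriv r \<psi>) = ereal l")
      case True
      then have "extremal_spline r d k M l \<psi>" unfolding ext using \<psi>P \<psi>(2) by blast
      then show ?thesis by blast
    next
      case False
      then have "Linf_norm (half_deriv r \<psi>) < ereal l" using A(2) by (simp add: less_le)
      then show ?thesis by (rule ex[OF Phi_subset_L_monotone[OF \<psi>P assms(1)] \<psi>(2)])
    qed
  qed
  show ?thesis using lim iff ev interp by blast
qed

end
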